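(* Let $S\ge 1$ and $h\ge 0$ be fixed integers, and let $\{\boldsymbol{X}_n\}$ be a mean-zero $L^4$--$m$--approximable sequence in $\mathbb{H}=(L^2([0,1]))^S=\mathbb{R}^S\otimes L^2([0,1])$ with lag-$h$ covariance operator $C^{(h)}=E[\boldsymbol{X}_n\otimes\boldsymbol{X}_{n+h}]$, $\mathrm{Tr}(C^{(h)})\neq 0$. Let $C_1^{(h)}=\mathrm{Tr}_2(C^{(h)})/\mathrm{Tr}(C^{(h)})$ and $C_2^{(h)}=\mathrm{Tr}_1(C^{(h)})$, let $\widehat C^{(h)},\widehat C_1^{(h)},\widehat C_2^{(h)}$ be the estimators defined in the context, and let $$\widehat T=N\,\big\|\widehat C_1^{(h)}\widetilde\otimes\widehat C_2^{(h)}-\widehat C^{(h)}\big\|^2,$$ where $\|\cdot\|$ is the Hilbert--Schmidt norm. Suppose that $$\Delta:=C_1^{(h)}\widetilde\otimes C_2^{(h)}-C^{(h)}\neq0.$$ Then, as $N\to\infty$, $$\widehat T=N\|\Delta\|^2+O_P(N^{1/2})\xrightarrow{\ \mathcal{P}\ }\infty .$$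
   Context: **Approximability.** For a separable Hilbert space $\mathbb{H}$, $p\ge1$, and an $\mathbb{H}$-valued random element $Z$, put $\nu_p(Z)=(E\|Z\|^p)^{1/p}$. A sequence $\{Z_n\}_{n\in\mathbb{Z}}$ of $\mathbb{H}$-valued random elements with $\nu_p(Z_n)<\infty$ is $L^p$--$m$--approximable if (1) $Z_n=f(u_n,u_{n-1},\dots)$ for iid elements $\{u_n\}$ of a measurable space $\mathcal{U}$ and a measurable $f:\mathcal{U}^\infty\to\mathbb{H}$; and (2) with $Z_{n,M}=f(u_n,\dots,u_{n-M},u^\star_{n-M-1},u^\star_{n-M-2},\dots)$, where for each $(n,M)$ the sequence $\{u^\star_k\}=\{u_k^\star(n,M)\}$ is a copy of $\{u_k\}$, these copies being independent across $M$ and $n$ and independent of $\{u_k\}$, one has $\sum_{M=1}^\infty\nu_p(Z_n-Z_{n,M})<\infty$. **Operators.** For $x,y$ in a Hilbert space, $x\otimes y$ is the rank-one operator $z\mapsto\langle y,z\rangle x$. $\mathbb{H}_1=\mathbb{R}^S$, $\mathbb{H}_2=L^2([0,1])$, $\mathbb{H}=\mathbb{H}_1\otimes\mathbb{H}_2=(L^2([0,1]))^S$. For operators $A$ on $\mathbb{H}_1$, $B$ on $\mathbb{H}_2$, $A\widetilde\otimes B$ is the operator on $\mathbb{H}$ with $(A\widetilde\otimes B)(u\otimes v)=(Au)\otimes(Bv)$. $\mathrm{Tr}$ is the trace. With orthonormal bases $\{u_i\}$ of $\mathbb{H}_1$, $\{v_j\}$ of $\mathbb{H}_2$, and a trace-class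 operator $T=\sum_{ijkl}T_{ijkl}\,(u_i\otimes v_j)\otimes(u_k\otimes v_l)$ on $\mathbb{H}$, the partial traces are $\mathrm{Tr}_1(T)=\sum_{jl}\big(\sum_iT_{ijil}\big)v_j\otimes v_l$ (operator on $\mathbb{H}_2$) and $\mathrm{Tr}_2(T)=\sum_{ik}\big(\sum_jT_{ijkj}\big)u_i\otimes u_k$ (operator on $\mathbb{H}_1$); thus $\mathrm{Tr}_1(A\widetilde\otimes B)=\mathrm{Tr}(A)B$, $\mathrm{Tr}_2(A\widetilde\otimes B)=\mathrm{Tr}(B)A$. **Estimators.** From $\boldsymbol{X}_1,\dots,\boldsymbol{X}_N$: $\widehat C^{(h)}=\frac1{N-h}\sum_{n=1}^{N-h}\boldsymbol{X}_n\otimes\boldsymbol{X}_{n+h}$, $\widehat C_1^{(h)}=\mathrm{Tr}_2(\widehat C^{(h)})/\mathrm{Tr}(\widehat C^{(h)})$ (set to $0$ if $\mathrm{Tr}(\widehat C^{(h)})=0$), $\widehat C_2^{(h)}=\mathrm{Tr}_1(\widehat C^{(h)})$. $\widehat T\xrightarrow{\mathcal{P}}\infty$ means $P(\widehat T>K)\to1$ for every $K<\infty$. *)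

theory Defs
  imports "HOL-Probability.Probability"
begin

section \<open>The Hilbert space $L^2([0,1])$\<close>

text \<open>
  Functions are Borel measurable; identifying functions that agree almost everywhere, this gives
  the same space as Lebesgue measurable functions.
\<close>

abbreviation leb01 :: "real measure" where
  "leb01 \<equiv> restrict_space lborel {0..1}"

definition sq_integrable :: "(real \<Rightarrow> real) \<Rightarrow> bool" where
  "sq_integrable f \<longleftrightarrow> f \<in> borel_measurable leb01 \<and> integrable leb01 (\<lambda>t. (f t)\<^sup>2)"

interpretation leb01: finite_measure leb01
  by (rule finite_measureI) (simp add: emeasure_restrict_space space_restrict_space)

lemma sq_integrable_measurable [measurable_dest]:
  "sq_integrable f \<Longrightarrow> f \<in> borel_measurable leb01"
  by (simp add: sq_integrable_def)

lemma sq_integrable_mult: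
  assumes "sq_integrable f" "sq_integrable g"
  shows "integrable leb01 (\<lambda>t. f t * g t)"
proof (rule Bochner_Integration.integrable_bound)
  show "integrable leb01 (\<lambda>t. (f t)\<^sup>2 + (g t)\<^sup>2)"
    using assms by (auto simp: sq_integrable_def)
  have "\<bar>f t * g t\<bar> \<le> (f t)\<^sup>2 + (g t)\<^sup>2" for t
    using sum_squares_bound[of "\<bar>f t\<bar>" "\<bar>g t\<bar>"] mult_nonneg_nonneg[of "\<bar>f t\<bar>" "\<bar>g t\<bar>"]
    unfolding abs_mult power2_abs by linarith
  then show "AE t in leb01. norm (f t * g t) \<le> norm ((f t)\<^sup>2 + (g t)\<^sup>2)"
    by auto
qed (use assms in measurable)

lemma sq_integrable_add:
  assumes "sq_integrable f" "sq_integrable g"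
  shows "sq_integrable (\<lambda>t. f t + g t)"
proof -
  have "integrable leb01 (\<lambda>t. (f t)\<^sup>2 + (g t)\<^sup>2 + 2 * (f t * g t))"
    using assms sq_integrable_mult[OF assms] by (auto simp: sq_integrable_def)
  moreover have "(\<lambda>t. (f t)\<^sup>2 + (g t)\<^sup>2 + 2 * (f t * g t)) = (\<lambda>t. (f t + g t)\<^sup>2)"
    by (auto simp: power2_sum)
  ultimately show ?thesis
    using assms unfolding sq_integrable_def by (auto intro!: borel_measurable_add)
qed

lemma sq_integrable_scale: "sq_integrable f \<Longrightarrow> sq_integrable (\<lambda>t. c * f t)"
  unfolding sq_integrable_def by (auto simp: power_mult_distrib intro!: borel_measurable_times)

lemma sq_integrable_uminus: "sq_integrable f \<Longrightarrow> sq_integrable (\<lambda>t. - f t)"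
  using sq_integrable_scale[of f "-1"] by simp

lemma sq_integrable_diff:
  "sq_integrable f \<Longrightarrow> sq_integrable g \<Longrightarrow> sq_integrable (\<lambda>t. f t - g t)"
  using sq_integrable_add[of f "\<lambda>t. - g t"] sq_integrable_uminus[of g] by simp

lemma sq_integrable_zero: "sq_integrable (\<lambda>t. 0)"
  by (simp add: sq_integrable_def)

quotient_type L2 = "real \<Rightarrow> real" / partial:
  "\<lambda>f g. sq_integrable f \<and> sq_integrable g \<and> (AE t in leb01. f t = g t)"
proof (rule part_equivpI)
  show "\<exists>f. sq_integrable f \<and> sq_integrable f \<and> (AE t in leb01. f t = f t)"
    using sq_integrable_zero by auto
  show "transp (\<lambda>f g. sq_integrable f \<and> sq_integrable g \<and> (AE t in leb01. f t = g t))"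
    unfolding transp_def by (auto elim: AE_mp)
qed (auto simp: symp_def elim: eventually_mono)

instantiation L2 :: real_inner
begin

lift_definition zero_L2 :: L2 is "\<lambda>t. 0"
  by (simp add: sq_integrable_zero)

lift_definition plus_L2 :: "L2 \<Rightarrow> L2 \<Rightarrow> L2" is "\<lambda>f g t. f t + g t"
  by (auto intro: sq_integrable_add)

lift_definition uminus_L2 :: "L2 \<Rightarrow> L2" is "\<lambda>f t. - f t"
  by (auto intro: sq_integrable_uminus)

lift_definition minus_L2 :: "L2 \<Rightarrow> L2 \<Rightarrow> L2" is "\<lambda>f g t. f t - g t"
  by (auto intro: sq_integrable_diff)

lift_definition scaleR_L2 :: "real \<Rightarrow> L2 \<Rightarrow> L2" is "\<lambda>c f t. c * f t"
  by (auto intro: sq_integrable_scale)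

lift_definition inner_L2 :: "L2 \<Rightarrow> L2 \<Rightarrow> real" is "\<lambda>f g. \<integral>t. f t * g t \<partial>leb01"
  by (rule integral_cong_AE) (auto simp: sq_integrable_def)

definition norm_L2 :: "L2 \<Rightarrow> real" where
  "norm_L2 x = sqrt (inner x x)"

definition dist_L2 :: "L2 \<Rightarrow> L2 \<Rightarrow> real" where
  "dist_L2 x y = norm (x - y)"

definition sgn_L2 :: "L2 \<Rightarrow> L2" where
  "sgn_L2 x = scaleR (inverse (norm x)) x"

definition uniformity_L2 :: "(L2 \<times> L2) filter" where
  "uniformity_L2 = (INF e\<in>{0 <..}. principal {(x, y). dist x y < e})"

definition open_L2 :: "L2 set \<Rightarrow> bool" where
  "open_L2 U = (\<forall>x\<in>U. \<forall>\<^sub>F (x', y) in uniformity. x' = x \<longrightarrow> y \<in> U)"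

instance
proof
  fix x y z :: L2 and a b :: real and U :: "L2 set"
  show "dist x y = norm (x - y)" by (rule dist_L2_def)
  show "sgn x = scaleR (inverse (norm x)) x" by (rule sgn_L2_def)
  show "uniformity = (INF e\<in>{0 <..}. principal {(x::L2, y). dist x y < e})"
    by (rule uniformity_L2_def)
  show "open U = (\<forall>x\<in>U. \<forall>\<^sub>F (x', y) in uniformity. x' = x \<longrightarrow> y \<in> U)"
    by (rule open_L2_def)
  show "norm x = sqrt (inner x x)" by (rule norm_L2_def)
  show "x + y + z = x + (y + z)"
    by transfer (auto simp: algebra_simps intro!: sq_integrable_add)
  show "x + y = y + x"
    by transfer (auto simp: algebra_simps intro!: sq_integrable_add)
  show "0 + x = x" by transfer auto
  show "- x + x = 0" by transfer (auto simp: sq_integrable_zero)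
  show "x - y = x + - y"
    by transfer (auto intro!: sq_integrable_diff)
  show "a *\<^sub>R (x + y) = a *\<^sub>R x + a *\<^sub>R y"
    by transfer (auto simp: algebra_simps intro!: sq_integrable_add sq_integrable_scale)
  show "(a + b) *\<^sub>R x = a *\<^sub>R x + b *\<^sub>R x"
    by transfer (auto simp: algebra_simps intro!: sq_integrable_add sq_integrable_scale)
  show "a *\<^sub>R b *\<^sub>R x = (a * b) *\<^sub>R x"
    by transfer (auto simp: algebra_simps dest: sq_integrable_scale)
  show "1 *\<^sub>R x = x" by transfer auto
  show "inner x y = inner y x"
    by transfer (simp add: mult.commute)
  show "inner (x + y) z = inner x z + inner y z"
    by transfer (simp add: distrib_right sq_integrable_mult)
  show "inner (a *\<^sub>R x) y = a * inner x y"
    by transfer (simp add: mult.assoc)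
  show "0 \<le> inner x x"
    by transfer simp
  show "(inner x x = 0) = (x = 0)"
  proof transfer
    fix f :: "real \<Rightarrow> real"
    assume f: "sq_integrable f \<and> sq_integrable f \<and> (AE t in leb01. f t = f t)"
    then have "(\<integral>t. f t * f t \<partial>leb01) = 0 \<longleftrightarrow> (AE t in leb01. f t * f t = 0)"
      by (intro integral_nonneg_eq_0_iff_AE sq_integrable_mult) auto
    then show "((\<integral>t. f t * f t \<partial>leb01) = 0) =
        (sq_integrable f \<and> sq_integrable (\<lambda>t. 0) \<and> (AE t in leb01. f t = 0))"
      using f sq_integrable_zero by auto
  qed
qed

end

lemma L2_obtain_rep:
  obtains f where "sq_integrable f" "x = abs_L2 f"
  using that Quotient3_rep_reflp[OF Quotient3_L2, of x] Quotient3_abs_rep[OF Quotient3_L2, of x]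
  by metis

lemma abs_L2_eq_iff:
  "sq_integrable f \<Longrightarrow> sq_integrable g \<Longrightarrow> abs_L2 f = abs_L2 g \<longleftrightarrow> (AE t in leb01. f t = g t)"
  using Quotient3_rel[OF Quotient3_L2, of f g] by simp

lemma abs_L2_diff:
  "sq_integrable f \<Longrightarrow> sq_integrable g \<Longrightarrow> abs_L2 f - abs_L2 g = abs_L2 (\<lambda>t. f t - g t)"
  by (simp add: minus_L2.abs_eq)

lemma abs_L2_add:
  "sq_integrable f \<Longrightarrow> sq_integrable g \<Longrightarrow> abs_L2 f + abs_L2 g = abs_L2 (\<lambda>t. f t + g t)"
  by (simp add: plus_L2.abs_eq)

lemma abs_L2_scale:
  "sq_integrable f \<Longrightarrow> c *\<^sub>R abs_L2 f = abs_L2 (\<lambda>t. c * f t)"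
  by (simp add: scaleR_L2.abs_eq)

lemma norm_abs_L2:
  "sq_integrable f \<Longrightarrow> (norm (abs_L2 f))\<^sup>2 = (\<integral>t. (f t)\<^sup>2 \<partial>leb01)"
  by (simp only: power2_norm_eq_inner) (simp add: inner_L2.abs_eq power2_eq_square)


lemma norm_abs_L2_le:
  assumes f: "sq_integrable f" and "c \<ge> 0"
    and le: "(\<integral>\<^sup>+t. ennreal ((f t)\<^sup>2) \<partial>leb01) \<le> ennreal (c\<^sup>2)"
  shows "norm (abs_L2 f) \<le> c"
proof -
  have "(\<integral>\<^sup>+t. ennreal ((f t)\<^sup>2) \<partial>leb01) = ennreal (\<integral>t. (f t)\<^sup>2 \<partial>leb01)"
    using f by (intro nn_integral_eq_integral) (auto simp: sq_integrable_def)
  then have "(norm (abs_L2 f))\<^sup>2 \<le> c\<^sup>2"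
    using le norm_abs_L2[OF f] by simp
  then show ?thesis
    using \<open>c \<ge> 0\<close> by (rule power2_le_imp_le)
qed

lemma nn_norm_abs_L2:
  assumes f: "sq_integrable f"
  shows "(\<integral>\<^sup>+t. ennreal ((f t)\<^sup>2) \<partial>leb01) = ennreal ((norm (abs_L2 f))\<^sup>2)"
proof -
  have "(\<integral>\<^sup>+t. ennreal ((f t)\<^sup>2) \<partial>leb01) = ennreal (\<integral>t. (f t)\<^sup>2 \<partial>leb01)"
    using f by (intro nn_integral_eq_integral) (auto simp: sq_integrable_def)
  then show ?thesis
    using norm_abs_L2[OF f] by simp
qed

lemma sq_integrableI_nn:
  assumes "f \<in> borel_measurable leb01" "(\<integral>\<^sup>+t. ennreal ((f t)\<^sup>2) \<partial>leb01) < \<infinity>"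
  shows "sq_integrable f"
  unfolding sq_integrable_def using assms by (auto intro!: integrableI_nonneg)

lemma sq_integrable_const: "sq_integrable (\<lambda>t. c)"
  by (simp add: sq_integrable_def leb01.integrable_const)

lemma nn_abs_le_L2:
  assumes f: "sq_integrable f"
  shows "(\<integral>\<^sup>+t. ennreal \<bar>f t\<bar> \<partial>leb01) \<le> ennreal (norm (abs_L2 f))"
proof -
  have af: "sq_integrable (\<lambda>t. \<bar>f t\<bar>)"
    using f unfolding sq_integrable_def by auto
  have c1: "sq_integrable (\<lambda>t. 1)" by (rule sq_integrable_const)
  have "(norm (abs_L2 (\<lambda>t. 1)))\<^sup>2 = 1\<^sup>2"
    unfolding norm_abs_L2[OF c1] by (simp add: measure_restrict_space space_restrict_space)
  then have n1: "norm (abs_L2 (\<lambda>t. 1)) = 1"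
    by (rule power2_eq_imp_eq) simp_all
  have "(norm (abs_L2 (\<lambda>t. \<bar>f t\<bar>)))\<^sup>2 = (norm (abs_L2 f))\<^sup>2"
    unfolding norm_abs_L2[OF af] norm_abs_L2[OF f] by simp
  then have naf: "norm (abs_L2 (\<lambda>t. \<bar>f t\<bar>)) = norm (abs_L2 f)"
    by (rule power2_eq_imp_eq) simp_all
  have "(\<integral>t. \<bar>f t\<bar> \<partial>leb01) = inner (abs_L2 (\<lambda>t. \<bar>f t\<bar>)) (abs_L2 (\<lambda>t. 1))"
    using af c1 by (simp add: inner_L2.abs_eq)
  also have "\<dots> \<le> norm (abs_L2 f)"
    using norm_cauchy_schwarz[of "abs_L2 (\<lambda>t. \<bar>f t\<bar>)" "abs_L2 (\<lambda>t. 1)"] n1 naf by simp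
  finally have "(\<integral>t. \<bar>f t\<bar> \<partial>leb01) \<le> norm (abs_L2 f)" .
  moreover have "(\<integral>\<^sup>+t. ennreal \<bar>f t\<bar> \<partial>leb01) = ennreal (\<integral>t. \<bar>f t\<bar> \<partial>leb01)"
    using sq_integrable_mult[OF af c1] by (intro nn_integral_eq_integral) auto
  ultimately show ?thesis by (simp add: ennreal_leI)
qed

instance L2 :: complete_space
proof
  fix X :: "nat \<Rightarrow> L2"
  assume X: "Cauchy X"
  have "\<exists>n\<ge>m. \<forall>i\<ge>n. norm (X i - X n) < (1/2)^k" for m k
  proof -
    obtain N where N: "\<And>i j. i \<ge> N \<Longrightarrow> j \<ge> N \<Longrightarrow> norm (X i - X j) < (1/2)^k"
      using X unfolding Cauchy_iff by (metis zero_less_divide_1_iff zero_less_numeral zero_less_power)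
    show ?thesis by (rule exI[of _ "max m N"]) (auto intro!: N)
  qed
  then obtain s where s: "\<And>m k. s m k \<ge> m" "\<And>m k i. i \<ge> s m k \<Longrightarrow> norm (X i - X (s m k)) < (1/2)^k"
    by metis
  define r where "r = rec_nat (s 0 0) (\<lambda>k m. s (Suc m) (Suc k))"
  have r0: "r 0 = s 0 0" and rS: "r (Suc k) = s (Suc (r k)) (Suc k)" for k
    by (simp_all add: r_def)
  have mono: "strict_mono r"
    unfolding strict_mono_Suc_iff rS using s(1) by (meson less_le_trans lessI)
  have r: "norm (X i - X (r k)) < (1/2)^k" if "i \<ge> r k" for i k
    using that s(2) by (cases k) (simp_all only: r0 rS)
  have "\<forall>k. \<exists>f. sq_integrable f \<and> X (r k) = abs_L2 f"
    by (metis L2_obtain_rep)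
  then obtain g where g: "\<And>k. sq_integrable (g k)" "\<And>k. X (r k) = abs_L2 (g k)"
    by metis
  have gm [measurable]: "g k \<in> borel_measurable leb01" for k
    by (rule sq_integrable_measurable[OF g(1)])
  have gd: "sq_integrable (\<lambda>t. g i t - g k t)" for i k
    by (rule sq_integrable_diff[OF g(1) g(1)])
  have gn: "norm (abs_L2 (\<lambda>t. g i t - g k t)) \<le> (1/2)^k" if "i \<ge> k" for i k
    using r[of k "r i"] that mono g by (simp add: abs_L2_diff strict_mono_less_eq)
  have "(\<integral>\<^sup>+t. (\<Sum>k. ennreal \<bar>g (Suc k) t - g k t\<bar>) \<partial>leb01)
      = (\<Sum>k. \<integral>\<^sup>+t. ennreal \<bar>g (Suc k) t - g k t\<bar> \<partial>leb01)"
    by (intro nn_integral_suminf) measurable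
  also have "\<dots> \<le> (\<Sum>k. ennreal ((1/2)^k))"
    by (intro suminf_le summableI order_trans[OF nn_abs_le_L2] gd ennreal_leI gn) auto
  also have "\<dots> = ennreal (\<Sum>k. (1/2)^k)"
    by (intro suminf_ennreal2 summable_geometric) auto
  also have "\<dots> < \<infinity>" by simp
  finally have "(\<integral>\<^sup>+t. (\<Sum>k. ennreal \<bar>g (Suc k) t - g k t\<bar>) \<partial>leb01) \<noteq> \<infinity>" by simp
  then have "AE t in leb01. (\<Sum>k. ennreal \<bar>g (Suc k) t - g k t\<bar>) \<noteq> \<infinity>"
    by (intro nn_integral_noteq_infinite) measurable
  then have ae: "AE t in leb01. convergent (\<lambda>k. g k t)"
  proof eventually_elim
    case (elim t)
    have "summable (\<lambda>k. \<bar>g (Suc k) t - g k t\<bar>)"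
      using elim by (intro summable_suminf_not_top) auto
    then have "summable (\<lambda>k. g (Suc k) t - g k t)"
      by (rule summable_rabs_cancel)
    then have "convergent (\<lambda>n. \<Sum>k<n. g (Suc k) t - g k t)"
      by (simp add: summable_iff_convergent)
    also have "(\<lambda>n. \<Sum>k<n. g (Suc k) t - g k t) = (\<lambda>n. g n t - g 0 t)"
      by (rule ext) (rule sum_lessThan_telescope)
    finally have "convergent (\<lambda>n. (g n t - g 0 t) + g 0 t)"
      by (intro convergent_add convergent_const)
    then show ?case by simp
  qed
  define l where "l t = lim (\<lambda>k. g k t)" for t
  have lm [measurable]: "l \<in> borel_measurable leb01"
    unfolding l_def by measurable
  have lim: "AE t in leb01. (\<lambda>k. g k t) \<longlonglongrightarrow> l t"
    using ae by eventually_elim (simp add: l_def convergent_LIMSEQ_iff)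
  have bound: "(\<integral>\<^sup>+t. ennreal ((l t - g k t)\<^sup>2) \<partial>leb01) \<le> ennreal (((1/2)^k)\<^sup>2)" for k
  proof -
    have "(\<integral>\<^sup>+t. ennreal ((l t - g k t)\<^sup>2) \<partial>leb01)
        = (\<integral>\<^sup>+t. liminf (\<lambda>i. ennreal ((g i t - g k t)\<^sup>2)) \<partial>leb01)"
    proof (intro nn_integral_cong_AE, use lim in eventually_elim)
      fix t assume t: "(\<lambda>k. g k t) \<longlonglongrightarrow> l t"
      have "(\<lambda>i. ennreal ((g i t - g k t)\<^sup>2)) \<longlonglongrightarrow> ennreal ((l t - g k t)\<^sup>2)"
        by (intro tendsto_ennrealI tendsto_power tendsto_diff t tendsto_const)
      then show "ennreal ((l t - g k t)\<^sup>2) = liminf (\<lambda>i. ennreal ((g i t - g k t)\<^sup>2))"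
        by (rule lim_imp_Liminf[OF sequentially_bot, symmetric])
    qed
    also have "\<dots> \<le> liminf (\<lambda>i. \<integral>\<^sup>+t. ennreal ((g i t - g k t)\<^sup>2) \<partial>leb01)"
      by (intro nn_integral_liminf) measurable
    also have "\<dots> = liminf (\<lambda>i. ennreal ((norm (abs_L2 (\<lambda>t. g i t - g k t)))\<^sup>2))"
      by (simp add: nn_norm_abs_L2[OF gd])
    also have "\<dots> \<le> ennreal (((1/2)^k)\<^sup>2)"
      by (intro Liminf_le eventually_sequentiallyI[of k] ennreal_leI power_mono gn) auto
    finally show ?thesis .
  qed
  have ld: "sq_integrable (\<lambda>t. l t - g k t)" for k
    using bound[of k] by (intro sq_integrableI_nn) (auto intro: le_less_trans)
  have l: "sq_integrable l"
    using sq_integrable_add[OF ld[of 0] g(1)[of 0]] by simp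
  have Xl: "norm (X (r k) - abs_L2 l) \<le> (1/2)^k" for k
    using norm_abs_L2_le[OF ld _ bound, of k] g l norm_minus_commute[of "X (r k)" "abs_L2 l"]
    by (simp add: abs_L2_diff)
  have "(\<lambda>k. (1/2::real)^k) \<longlonglongrightarrow> 0"
    by (rule LIMSEQ_power_zero) simp
  then have "(\<lambda>k. X (r k) - abs_L2 l) \<longlonglongrightarrow> 0"
    by (rule Lim_null_comparison[rotated]) (simp add: Xl)
  then have "(X \<circ> r) \<longlonglongrightarrow> abs_L2 l"
    unfolding o_def by (rule LIM_zero_cancel)
  then show "convergent X"
    unfolding convergent_def by (blast intro: Cauchy_converges_subseq[OF X mono])
qed

instance L2 :: banach ..


lemma tendsto_if_norm_sq:
  fixes x :: "nat \<Rightarrow> 'a::real_normed_vector"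
  assumes "(\<lambda>n. (norm (x n - l))\<^sup>2) \<longlonglongrightarrow> 0"
  shows "x \<longlonglongrightarrow> l"
proof -
  have "(\<lambda>n. sqrt ((norm (x n - l))\<^sup>2)) \<longlonglongrightarrow> sqrt 0"
    using assms by (rule tendsto_real_sqrt)
  then have "(\<lambda>n. norm (x n - l)) \<longlonglongrightarrow> 0" by simp
  then show ?thesis
    by (subst tendsto_dist_iff) (simp add: dist_norm)
qed

lemma L2_dominated_convergence:
  assumes f: "\<And>n. sq_integrable (f n)" and l: "l \<in> borel_measurable leb01" and w: "sq_integrable w"
    and lim: "\<And>t. t \<in> {0..1} \<Longrightarrow> (\<lambda>n. f n t) \<longlonglongrightarrow> l t"
    and bd: "\<And>n t. t \<in> {0..1} \<Longrightarrow> \<bar>f n t\<bar> \<le> w t"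
  shows "sq_integrable l" "(\<lambda>n. abs_L2 (f n)) \<longlonglongrightarrow> abs_L2 l"
proof -
  have [measurable]: "f n \<in> borel_measurable leb01" "w \<in> borel_measurable leb01" for n
    using f w by (auto intro: sq_integrable_measurable)
  note l [measurable]
  have lw: "\<bar>l t\<bar> \<le> w t" if "t \<in> {0..1}" for t
    by (rule tendsto_upperbound[OF tendsto_rabs[OF lim[OF that]] always_eventually])
      (simp_all add: bd[OF that])
  have w0: "0 \<le> w t" if "t \<in> {0..1}" for t
    using lw[OF that] by linarith
  have w2: "integrable leb01 (\<lambda>t. (w t)\<^sup>2)"
    using w by (simp add: sq_integrable_def)
  show sl: "sq_integrable l"
    unfolding sq_integrable_def
  proof
    show "integrable leb01 (\<lambda>t. (l t)\<^sup>2)"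
    proof (rule Bochner_Integration.integrable_bound[OF w2])
      show "AE t in leb01. norm ((l t)\<^sup>2) \<le> norm ((w t)\<^sup>2)"
      proof (intro AE_I2)
        fix t assume "t \<in> space leb01"
        then have t: "t \<in> {0..1}" by (simp add: space_restrict_space)
        have "(l t)\<^sup>2 \<le> (w t)\<^sup>2"
          using lw[OF t] w0[OF t] by (intro abs_le_square_iff[THEN iffD1]) simp
        then show "norm ((l t)\<^sup>2) \<le> norm ((w t)\<^sup>2)" by simp
      qed
    qed measurable
  qed (rule l)
  have "(\<lambda>n. \<integral>t. (f n t - l t)\<^sup>2 \<partial>leb01) \<longlonglongrightarrow> (\<integral>t. 0 \<partial>leb01)"
  proof (rule integral_dominated_convergence)
    show "integrable leb01 (\<lambda>t. 4 * (w t)\<^sup>2)" using w2 by simp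
    show "AE t in leb01. (\<lambda>n. (f n t - l t)\<^sup>2) \<longlonglongrightarrow> 0"
    proof (intro AE_I2)
      fix t assume "t \<in> space leb01"
      then have "(\<lambda>n. (f n t - l t)\<^sup>2) \<longlonglongrightarrow> (l t - l t)\<^sup>2"
        by (intro tendsto_intros lim) (simp add: space_restrict_space)
      then show "(\<lambda>n. (f n t - l t)\<^sup>2) \<longlonglongrightarrow> 0" by simp
    qed
    show "AE t in leb01. norm ((f n t - l t)\<^sup>2) \<le> 4 * (w t)\<^sup>2" for n
    proof (intro AE_I2)
      fix t assume "t \<in> space leb01"
      then have t: "t \<in> {0..1}" by (simp add: space_restrict_space)
      have "\<bar>f n t - l t\<bar> \<le> \<bar>2 * w t\<bar>"
        using bd[OF t, of n] lw[OF t] by linarith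
      then have "(f n t - l t)\<^sup>2 \<le> (2 * w t)\<^sup>2"
        by (rule abs_le_square_iff[THEN iffD1])
      then show "norm ((f n t - l t)\<^sup>2) \<le> 4 * (w t)\<^sup>2"
        by (simp add: power_mult_distrib)
    qed
  qed measurable
  then have "(\<lambda>n. (norm (abs_L2 (f n) - abs_L2 l))\<^sup>2) \<longlonglongrightarrow> 0"
    using f sl by (simp add: abs_L2_diff norm_abs_L2 sq_integrable_diff)
  then show "(\<lambda>n. abs_L2 (f n)) \<longlonglongrightarrow> abs_L2 l"
    by (rule tendsto_if_norm_sq)
qed

lemma sq_integrable_indicator:
  assumes "A \<in> sets borel" shows "sq_integrable (indicator A)"
proof (rule sq_integrableI_nn)
  show m: "indicator A \<in> borel_measurable leb01"
    using assms by (intro measurable_restrict_space1) simp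
  have "(\<integral>\<^sup>+t. ennreal ((indicator A t)\<^sup>2) \<partial>leb01) \<le> (\<integral>\<^sup>+t. 1 \<partial>leb01)"
    by (intro nn_integral_mono) (auto simp: indicator_def)
  also have "\<dots> < \<infinity>" by (simp add: emeasure_restrict_space space_restrict_space)
  finally show "(\<integral>\<^sup>+t. ennreal ((indicator A t)\<^sup>2) \<partial>leb01) < \<infinity>" .
qed

lemma second_countable_if_countable_dense:
  fixes K :: "'a::metric_space set"
  assumes "countable K" "closure K = UNIV"
  shows "\<exists>B::'a set set. countable B \<and> open = generate_topology B"
proof -
  define B where "B = (\<lambda>(x::'a, n). ball x (1 / Suc n)) ` (K \<times> UNIV)"
  have "topological_basis B"
  proof (rule topological_basisI)
    fix U and x :: 'a assume "open U" "x \<in> U"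
    then obtain e where e: "e > 0" "ball x e \<subseteq> U"
      using open_contains_ball by blast
    obtain n where n: "1 / Suc n < e / 2"
      using nat_approx_posE[of "e/2"] e by auto
    obtain y where y: "y \<in> K" "dist y x < 1 / Suc n"
      using assms(2) closure_approachable[of x K] by (metis UNIV_I of_nat_0_less_iff zero_less_Suc zero_less_divide_1_iff)
    have "ball y (1 / Suc n) \<subseteq> U"
    proof
      fix z assume "z \<in> ball y (1 / Suc n)"
      then have "dist x z < e"
        using y n dist_triangle[of x z y] by (simp add: dist_commute)
      then show "z \<in> U" using e by auto
    qed
    then show "\<exists>V\<in>B. x \<in> V \<and> V \<subseteq> U"
      using y by (intro bexI[of _ "ball y (1 / Suc n)"]) (auto simp: B_def)
  qed (auto simp: B_def)
  moreover have "countable B"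
    using assms(1) by (simp add: B_def)
  ultimately show ?thesis
    using topological_basis_imp_subbasis by blast
qed

instance L2 :: second_countable_topology
proof
  define e :: "rat \<times> rat \<Rightarrow> L2" where "e = (\<lambda>(a, b). abs_L2 (indicator {of_rat a..of_rat b}))"
  define K where "K = range (\<lambda>xs. \<Sum>(q::rat, d)\<leftarrow>xs. of_rat q *\<^sub>R e d)"
  define V where "V = closure K"
  have K_add: "x + y \<in> K" if xy: "x \<in> K" "y \<in> K" for x y
  proof -
    obtain xs ys where "x = (\<Sum>(q, d)\<leftarrow>xs. of_rat q *\<^sub>R e d)" "y = (\<Sum>(q, d)\<leftarrow>ys. of_rat q *\<^sub>R e d)"
      using xy unfolding K_def by blast
    then have "x + y = (\<Sum>(q, d)\<leftarrow>xs @ ys. of_rat q *\<^sub>R e d)" by simp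
    then show ?thesis unfolding K_def by blast
  qed
  have K_rat: "of_rat c *\<^sub>R x \<in> K" if x: "x \<in> K" for c x
  proof -
    obtain xs where "x = (\<Sum>(q, d)\<leftarrow>xs. of_rat q *\<^sub>R e d)"
      using x unfolding K_def by blast
    moreover have "of_rat c *\<^sub>R (\<Sum>(q, d)\<leftarrow>xs. of_rat q *\<^sub>R e d)
        = (\<Sum>(q, d)\<leftarrow>map (\<lambda>(q, d). (c * q, d)) xs. of_rat q *\<^sub>R e d)" for xs
      by (induction xs) (auto simp: scaleR_add_right of_rat_mult)
    ultimately show ?thesis unfolding K_def by blast
  qed
  have V_lim: "l \<in> V" if "\<And>n::nat. x n \<in> V" "x \<longlonglongrightarrow> l" for x l
    using that closed_sequential_limits[of V] by (auto simp: V_def)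
  have V_add: "x + y \<in> V" if "x \<in> V" "y \<in> V" for x y
  proof -
    obtain f g where "\<And>n. f n \<in> K" "f \<longlonglongrightarrow> x" "\<And>n. g n \<in> K" "g \<longlonglongrightarrow> y"
      using \<open>x \<in> V\<close> \<open>y \<in> V\<close> unfolding V_def closure_sequential by blast
    then show ?thesis
      unfolding V_def closure_sequential by (intro exI[of _ "\<lambda>n. f n + g n"]) (auto intro: K_add tendsto_add)
  qed
  have V_scale: "c *\<^sub>R x \<in> V" if "x \<in> V" for c x
  proof -
    obtain f where f: "\<And>n. f n \<in> K" "f \<longlonglongrightarrow> x"
      using \<open>x \<in> V\<close> unfolding V_def closure_sequential by blast
    have "\<exists>q. \<bar>of_rat q - c\<bar> < 1 / Suc n" for n
      using of_rat_dense[of "c - 1 / Suc n" "c + 1 / Suc n"] by (auto simp: abs_less_iff algebra_simps)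
    then obtain q where q: "\<And>n. \<bar>of_rat (q n) - c\<bar> < 1 / Suc n" by metis
    have "(\<lambda>n. of_rat (q n) - c) \<longlonglongrightarrow> 0"
      by (rule Lim_null_comparison[OF _ LIMSEQ_inverse_real_of_nat]) (use q in \<open>auto intro!: always_eventually less_imp_le simp: inverse_eq_divide\<close>)
    then have "(\<lambda>n. of_rat (q n) *\<^sub>R f n) \<longlonglongrightarrow> c *\<^sub>R x"
      using f(2) LIM_zero_cancel by (intro tendsto_scaleR) fast+
    then show ?thesis
      unfolding V_def closure_sequential by (intro exI[of _ "\<lambda>n. of_rat (q n) *\<^sub>R f n"]) (auto intro: K_rat f)
  qed
  have V_e: "e d \<in> V" for d
  proof -
    have "(\<Sum>(q, d)\<leftarrow>[(1, d)]. of_rat q *\<^sub>R e d) \<in> K" unfolding K_def by (rule rangeI)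
    then show ?thesis unfolding V_def using closure_subset by auto
  qed
  have V_0: "0 \<in> V"
    using V_scale[OF V_e, of 0 undefined] by simp
  have V_one: "abs_L2 (\<lambda>t. 1) \<in> V"
  proof -
    have "abs_L2 (\<lambda>t. 1) = e (0, 1)"
      unfolding e_def by (simp, subst abs_L2_eq_iff)
        (auto intro!: sq_integrable_const sq_integrable_indicator AE_I2 simp: space_restrict_space)
    then show ?thesis using V_e by simp
  qed
  have V_ind: "abs_L2 (indicator A) \<in> V" if "A \<in> sets borel" for A
    using that
  proof (induction A rule: borel_set_induct)
    case empty
    have "abs_L2 (indicator {}) = 0"
      unfolding zero_L2_def by (rule arg_cong[of _ _ abs_L2]) auto
    then show ?case using V_0 by metis
  next
    case (interval a b)
    have "\<exists>q. a - 1 / Suc n < of_rat q \<and> of_rat q < a" "\<exists>q. b < of_rat q \<and> of_rat q < b + 1 / Suc n" for n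
      by (rule of_rat_dense; simp)+
    then obtain p q where p: "\<And>n. a - 1 / Suc n < of_rat (p n)" "\<And>n. of_rat (p n) < a"
      and q: "\<And>n. b < of_rat (q n)" "\<And>n. of_rat (q n) < b + 1 / Suc n"
      by metis
    have "(\<lambda>n. abs_L2 (indicator {of_rat (p n)..of_rat (q n)})) \<longlonglongrightarrow> abs_L2 (indicator {a..b})"
    proof (rule L2_dominated_convergence)
      fix t :: real
      show "(\<lambda>n. indicator {of_rat (p n)..of_rat (q n)} t) \<longlonglongrightarrow> (indicator {a..b} t :: real)"
      proof (rule tendsto_eventually)
        show "\<forall>\<^sub>F n in sequentially. indicator {of_rat (p n)..of_rat (q n)} t = (indicator {a..b} t :: real)"
        proof (cases "t \<in> {a..b}")
          case True
          then have "t \<in> {of_rat (p n)..of_rat (q n)}" for n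
            using p(2)[of n] q(1)[of n] by auto
          with True show ?thesis by (simp add: indicator_def)
        next
          case False
          then have "0 < max (a - t) (t - b)" by auto
          then obtain m where m: "1 / Suc m < max (a - t) (t - b)"
            using nat_approx_posE by blast
          have "t \<notin> {of_rat (p n)..of_rat (q n)}" if "n \<ge> m" for n
          proof -
            have "1 / real (Suc n) \<le> 1 / real (Suc m)" using that by (intro divide_left_mono) auto
            then show ?thesis using m p(1)[of n] q(2)[of n] by auto
          qed
          with False show ?thesis by (auto simp: indicator_def eventually_sequentially)
        qed
      qed
      show "\<bar>indicator {of_rat (p n)..of_rat (q n)} t :: real\<bar> \<le> 1" for n
        by (simp add: indicator_def)
    qed (auto intro: sq_integrable_indicator sq_integrable_const sq_integrable_measurable[OF sq_integrable_indicator])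
    moreover have "abs_L2 (indicator {of_rat (p n)..of_rat (q n)}) \<in> V" for n
      using V_e[of "(p n, q n)"] by (simp add: e_def)
    ultimately show ?case by (rule V_lim[rotated])
  next
    case (compl A)
    have "abs_L2 (indicator (- A)) = abs_L2 (\<lambda>t. 1) + (-1) *\<^sub>R abs_L2 (indicator A)"
      using compl(1) sq_integrable_indicator[of A] sq_integrable_const[of 1]
      by (simp add: abs_L2_diff indicator_compl[abs_def])
    then show ?case using V_add[OF V_one V_scale[OF compl(2), of "-1"]] by simp
  next
    case (union A)
    have ps: "abs_L2 (indicator (\<Union>i<n. A i)) \<in> V" for n
    proof (induction n)
      case 0
      have "abs_L2 (indicator (\<Union>i<0. A i)) = 0"
        unfolding zero_L2_def by (rule arg_cong[of _ _ abs_L2]) auto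
      then show ?case by (rule ssubst) (rule V_0)
    next
      case (Suc n)
      have "A i \<inter> A n = {}" if "i < n" for i
        using union(1) that by (auto simp: disjoint_family_on_def)
      then have disj: "(\<Union>i<n. A i) \<inter> A n = {}" by blast
      have "(\<Union>i<Suc n. A i) = (\<Union>i<n. A i) \<union> A n" by (auto simp: less_Suc_eq)
      with disj have "(indicator (\<Union>i<Suc n. A i) :: real \<Rightarrow> real) = (\<lambda>t. indicator (\<Union>i<n. A i) t + indicator (A n) t)"
        by (simp only: indicator_add)
      then have "abs_L2 (indicator (\<Union>i<Suc n. A i)) = abs_L2 (indicator (\<Union>i<n. A i)) + abs_L2 (indicator (A n))"
        using union(2) by (subst abs_L2_add) (auto intro!: sq_integrable_indicator)
      then show ?case using V_add[OF Suc union(3)] by simp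
    qed
    have "(\<lambda>n. abs_L2 (indicator (\<Union>i<n. A i))) \<longlonglongrightarrow> abs_L2 (indicator (\<Union>i. A i))"
    proof (rule L2_dominated_convergence)
      show "(\<lambda>n. indicator (\<Union>i<n. A i) t) \<longlonglongrightarrow> (indicator (\<Union>i. A i) t :: real)" for t
        by (rule LIMSEQ_indicator_UN)
      show "\<bar>indicator (\<Union>i<n. A i) t :: real\<bar> \<le> 1" for n t
        by (simp add: indicator_def)
    qed (use union(2) in \<open>auto intro!: sq_integrable_indicator sq_integrable_const sq_integrable_measurable[OF sq_integrable_indicator]\<close>)
    then show ?case using ps by (rule V_lim[rotated])
  qed
  have V_simple: "sq_integrable g \<and> abs_L2 g \<in> V" if g: "simple_function leb01 g" for g
  proof -
    define c where "c y = g -` {y} \<inter> {0..1}" for y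
    have c: "c y \<in> sets borel" for y
    proof -
      have "c y \<in> sets leb01"
        using simple_functionD(2)[OF g, of "{y}"] by (simp add: c_def space_restrict_space)
      then show ?thesis by (simp add: sets_restrict_space_iff)
    qed
    have sums: "sq_integrable (\<lambda>t. \<Sum>y\<in>Y. y * indicator (c y) t) \<and> abs_L2 (\<lambda>t. \<Sum>y\<in>Y. y * indicator (c y) t) \<in> V"
      if "finite Y" for Y
      using that
    proof (induction Y)
      case empty
      then show ?case using V_0 sq_integrable_zero by (simp add: zero_L2_def)
    next
      case (insert y Y)
      have iy: "sq_integrable (\<lambda>t. y * indicator (c y) t)"
        by (intro sq_integrable_scale sq_integrable_indicator c)
      have "abs_L2 (\<lambda>t. y * indicator (c y) t) \<in> V"
        using V_scale[OF V_ind[OF c], of y y] by (simp add: abs_L2_scale sq_integrable_indicator c)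
      then have "abs_L2 (\<lambda>t. y * indicator (c y) t + (\<Sum>y\<in>Y. y * indicator (c y) t)) \<in> V"
        unfolding abs_L2_add[OF iy conjunct1[OF insert.IH], symmetric]
        by (rule V_add) (rule conjunct2[OF insert.IH])
      with sq_integrable_add[OF iy conjunct1[OF insert.IH]] show ?case
        unfolding sum.insert[OF insert.hyps(1,2)] by (rule conjI)
    qed
    let ?h = "\<lambda>t. \<Sum>y\<in>g ` {0..1}. y * indicator (c y) t"
    have fin: "finite (g ` {0..1})"
      using simple_functionD(1)[OF g] by (simp add: space_restrict_space)
    have eq: "g t = ?h t" if "t \<in> {0..1}" for t
    proof -
      have "?h t = (\<Sum>y\<in>g ` {0..1}. if y = g t then y else 0)"
        using that by (intro sum.cong) (auto simp: c_def indicator_def)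
      also have "\<dots> = g t" using that fin by (subst sum.delta) auto
      finally show ?thesis ..
    qed
    have h: "sq_integrable ?h" "abs_L2 ?h \<in> V" using sums[OF fin] by auto
    have "integrable leb01 (\<lambda>t. (g t)\<^sup>2) \<longleftrightarrow> integrable leb01 (\<lambda>t. (?h t)\<^sup>2)"
      by (rule Bochner_Integration.integrable_cong[OF refl], rule arg_cong[where f = "\<lambda>x. x\<^sup>2"], rule eq)
        (simp add: space_restrict_space)
    then have sg: "sq_integrable g"
      using h(1) borel_measurable_simple_function[OF g] by (simp add: sq_integrable_def)
    then have "abs_L2 g = abs_L2 ?h"
      using h(1)
    proof (subst abs_L2_eq_iff)
      show "AE t in leb01. g t = ?h t"
        by (rule AE_I2, rule eq) (simp add: space_restrict_space)
    qed
    with h sg show ?thesis by simp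
  qed
  have "x \<in> V" for x
  proof -
    obtain f where f: "sq_integrable f" "x = abs_L2 f" by (rule L2_obtain_rep)
    obtain F where F: "\<And>i. simple_function leb01 (F i)"
      "\<And>t. t \<in> space leb01 \<Longrightarrow> (\<lambda>i. F i t) \<longlonglongrightarrow> f t"
      "\<And>i t. t \<in> space leb01 \<Longrightarrow> dist (F i t) 0 \<le> 2 * dist (f t) 0"
      using borel_measurable_implies_sequence_metric[OF sq_integrable_measurable[OF f(1)], of 0] by metis
    have "(\<lambda>i. abs_L2 (F i)) \<longlonglongrightarrow> abs_L2 f"
    proof (rule L2_dominated_convergence)
      show "sq_integrable (\<lambda>t. 2 * \<bar>f t\<bar>)"
        using f(1) by (intro sq_integrable_scale) (auto simp: sq_integrable_def)
    qed (use F V_simple f in \<open>auto simp: space_restrict_space intro: sq_integrable_measurable\<close>)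
    then show ?thesis
      unfolding f(2) by (rule V_lim[rotated]) (use V_simple[OF F(1)] in blast)
  qed
  then have "closure K = UNIV" by (auto simp: V_def)
  moreover have "countable K" by (simp add: K_def)
  ultimately show "\<exists>B::L2 set set. countable B \<and> open = generate_topology B"
    by (rule second_countable_if_countable_dense[rotated])
qed


instance vec :: ("{metric_space, second_countable_topology}", finite) second_countable_topology
proof
  obtain B :: "'a set set" where B: "countable B" "topological_basis B"
    using ex_countable_basis by blast
  define K where "K = (\<lambda>A. {x :: 'a ^ 'b. \<forall>i. x $ i \<in> A i}) ` (\<Pi>\<^sub>E i\<in>UNIV. B)"
  have "countable (\<Pi>\<^sub>E i\<in>(UNIV :: 'b set). B)"
    using B(1) by (intro countable_PiE) auto
  then have "countable K" by (simp add: K_def)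
  moreover have "topological_basis K"
  proof (rule topological_basisI)
    fix U and x :: "'a ^ 'b" assume "open U" "x \<in> U"
    then obtain A where A: "\<And>i. open (A i)" "\<And>i. x $ i \<in> A i" "\<And>y. (\<forall>i. y $ i \<in> A i) \<longrightarrow> y \<in> U"
      unfolding open_vec_def by metis
    have "\<exists>S\<in>B. x $ i \<in> S \<and> S \<subseteq> A i" for i
      by (rule topological_basisE[OF B(2) A(1)[of i] A(2)[of i]]) blast
    then obtain S where S: "\<And>i. S i \<in> B" "\<And>i. x $ i \<in> S i" "\<And>i. S i \<subseteq> A i" by metis
    have "{x :: 'a ^ 'b. \<forall>i. x $ i \<in> S i} \<in> K"
      unfolding K_def by (intro imageI) (auto simp: S(1))
    moreover have "{x :: 'a ^ 'b. \<forall>i. x $ i \<in> S i} \<subseteq> U" using A(3) S(3) by blast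
    ultimately show "\<exists>V\<in>K. x \<in> V \<and> V \<subseteq> U"
      using S(2) by (intro bexI[of _ "{x. \<forall>i. x $ i \<in> S i}"] conjI) simp_all
  next
    fix V assume "V \<in> K"
    then obtain A where A: "A \<in> (\<Pi>\<^sub>E i\<in>UNIV. B)" and V: "V = {x. \<forall>i. x $ i \<in> A i}"
      unfolding K_def by (rule imageE)
    have "open (A i)" for i
      using A topological_basis_open[OF B(2)] by auto
    then show "open V"
      unfolding V open_vec_def by (intro ballI exI[of _ A]) simp
  qed
  ultimately show "\<exists>B::('a ^ 'b) set set. countable B \<and> open = generate_topology B"
    using topological_basis_imp_subbasis by blast
qed


section \<open>Orthonormal bases and operators\<close>

definition onb :: "'a::real_inner set \<Rightarrow> bool" where
  "onb B \<longleftrightarrow> (\<forall>b\<in>B. norm b = 1) \<and> pairwise orthogonal B \<and> closure (span B) = UNIV"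

lemma onb_exists: "\<exists>B :: 'a::{real_inner, second_countable_topology} set. onb B"
proof -
  obtain D :: "'a set" where D: "countable D" "\<And>U. open U \<Longrightarrow> U \<noteq> {} \<Longrightarrow> \<exists>d\<in>D. d \<in> U"
    by (erule countable_dense_setE)
  define d where "d = from_nat_into D"
  define on where "on B \<longleftrightarrow> finite B \<and> (\<forall>b\<in>B. norm b = 1) \<and> pairwise orthogonal B" for B :: "'a set"
  have ext: "\<exists>B'. on B' \<and> B \<subseteq> B' \<and> x \<in> span B'" if B: "on B" for B x
  proof -
    define y where "y = x - (\<Sum>b\<in>B. inner x b *\<^sub>R b)"
    have fin: "finite B" using B by (simp add: on_def)
    have orth: "inner y c = 0" if c: "c \<in> B" for c
    proof -
      have "(\<Sum>b\<in>B. inner x b * inner b c) = (\<Sum>b\<in>B. if b = c then inner x c else 0)"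
        using B c by (intro sum.cong refl)
          (auto simp: on_def pairwise_def orthogonal_def dot_square_norm)
      then show ?thesis using fin c by (simp add: y_def inner_diff_left inner_sum_left)
    qed
    have xs: "x = y + (\<Sum>b\<in>B. inner x b *\<^sub>R b)" by (simp add: y_def)
    have sp: "(\<Sum>b\<in>B. inner x b *\<^sub>R b) \<in> span B"
      by (intro span_sum span_scale span_base)
    show ?thesis
    proof (cases "y = 0")
      case True
      then show ?thesis using B xs sp by (intro exI[of _ B]) auto
    next
      case False
      let ?z = "(1 / norm y) *\<^sub>R y"
      have "on (insert ?z B)"
        using B False orth by (auto simp: on_def pairwise_insert orthogonal_def inner_commute)
      moreover have "y = norm y *\<^sub>R ?z" using False by simp
      then have "y \<in> span (insert ?z B)"
        by (metis insertI1 span_base span_scale)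
      then have "x \<in> span (insert ?z B)"
        by (subst xs) (intro span_add, auto intro: subsetD[OF span_mono sp] sp span_mono[THEN subsetD])
      ultimately show ?thesis by blast
    qed
  qed
  have "\<exists>f. \<forall>n. on (f n) \<and> (f n \<subseteq> f (Suc n) \<and> d n \<in> span (f (Suc n)))"
  proof (rule dependent_nat_choice)
    show "\<exists>B. on B" by (rule exI[of _ "{}"]) (simp add: on_def)
  qed (use ext in blast)
  then obtain f where f: "\<And>n. on (f n)" "\<And>n. f n \<subseteq> f (Suc n)" "\<And>n. d n \<in> span (f (Suc n))"
    by blast
  have mono: "f i \<subseteq> f j" if "i \<le> j" for i j
    using lift_Suc_mono_le[of f, OF f(2) that] .
  define B where "B = (\<Union>n. f n)"
  have orth: "pairwise orthogonal B"
  proof (rule pairwiseI)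
    fix x y assume "x \<in> B" "y \<in> B" "x \<noteq> y"
    then obtain i j where "x \<in> f i" "y \<in> f j" by (auto simp: B_def)
    then have "x \<in> f (max i j)" "y \<in> f (max i j)"
      using mono[of i "max i j"] mono[of j "max i j"] by auto
    then show "orthogonal x y"
      using f(1)[of "max i j"] \<open>x \<noteq> y\<close> by (auto simp: on_def pairwise_def)
  qed
  have norm: "norm b = 1" if "b \<in> B" for b
    using that f(1) by (auto simp: B_def on_def)
  have dense: "x \<in> closure (span B)" for x
  proof -
    have "\<exists>y\<in>span B. dist y x < e" if "e > 0" for e
    proof -
      obtain y where y: "y \<in> D" "y \<in> ball x e"
        using D(2)[of "ball x e"] \<open>e > 0\<close> by auto
      then obtain n where "y = d n"
        using from_nat_into_surj[OF D(1)] unfolding d_def by metis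
      then have "y \<in> span B"
        using f(3)[of n] span_mono[of "f (Suc n)" B] by (auto simp: B_def)
      then show ?thesis using y by (auto simp: dist_commute)
    qed
    then show ?thesis by (simp add: closure_approachable)
  qed
  have "onb B"
    unfolding onb_def by (simp add: orth norm dense set_eq_iff)
  then show ?thesis ..
qed

text \<open>
  An arbitrary but fixed orthonormal basis. The trace of a trace-class operator, the Hilbert--Schmidt
  norm of a Hilbert--Schmidt operator and the partial traces of a trace-class operator do not depend
  on this choice; all infinite sums below are unconditional.
\<close>

definition some_onb :: "'a::real_inner set" where
  "some_onb = (SOME B. onb B)"

lemma onb_some_onb: "onb (some_onb :: 'a::{real_inner, second_countable_topology} set)"
  unfolding some_onb_def using onb_exists by (rule someI_ex)

definition op_trace :: "('a::real_inner \<Rightarrow>\<^sub>L 'a) \<Rightarrow> real" where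
  "op_trace T = (\<Sum>\<^sub>\<infinity>e\<in>some_onb. inner e (blinfun_apply T e))"

definition hs_norm :: "('a::real_inner \<Rightarrow>\<^sub>L 'b::real_inner) \<Rightarrow> real" where
  "hs_norm T = sqrt (\<Sum>\<^sub>\<infinity>e\<in>some_onb. (norm (blinfun_apply T e))\<^sup>2)"

lift_definition outer :: "'a::real_inner \<Rightarrow> 'b::real_inner \<Rightarrow> 'b \<Rightarrow>\<^sub>L 'a" is
  "\<lambda>x y z. inner y z *\<^sub>R x"
  by (intro bounded_linear_scaleR_const bounded_linear_inner_right)


section \<open>The tensor product $R^S \otimes H_2 = H_2^S$\<close>

definition tensor_vec :: "real ^ 's \<Rightarrow> 'b::real_vector \<Rightarrow> 'b ^ 's" where
  "tensor_vec u v = (\<chi> s. u $ s *\<^sub>R v)"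

lemma bounded_linear_tensor_vec: "bounded_linear (tensor_vec u :: 'b::real_normed_vector \<Rightarrow> 'b ^ 's)"
proof (rule bounded_linear_intro[where K = "norm u"])
  show "norm (tensor_vec u v :: 'b ^ 's) \<le> norm v * norm u" for v
    by (simp add: tensor_vec_def norm_vec_def L2_set_right_distrib mult.commute)
next
  show "tensor_vec u (v + w) = tensor_vec u v + (tensor_vec u w :: 'b ^ 's)" for v w
    by (simp add: tensor_vec_def vec_eq_iff scaleR_add_right)
  show "tensor_vec u (c *\<^sub>R v) = c *\<^sub>R (tensor_vec u v :: 'b ^ 's)" for c v
    by (simp add: tensor_vec_def vec_eq_iff mult.commute)
qed

lift_definition tensor_op ::
  "((real ^ 's) \<Rightarrow>\<^sub>L (real ^ 's)) \<Rightarrow> ('b::real_normed_vector \<Rightarrow>\<^sub>L 'b) \<Rightarrow> (('b ^ 's) \<Rightarrow>\<^sub>L ('b ^ 's))" is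
  "\<lambda>A B x. \<Sum>k\<in>UNIV. tensor_vec (A (axis k 1)) (B (x $ k))"
  by (rule bounded_linear_sum, rule bounded_linear_compose[OF bounded_linear_tensor_vec],
      rule bounded_linear_compose[OF _ bounded_linear_vec_nth])

lemma tensor_op_tensor_vec:
  "blinfun_apply (tensor_op A B) (tensor_vec u v) = tensor_vec (blinfun_apply A u) (blinfun_apply B v)"
proof -
  have "blinfun_apply A u = blinfun_apply A (\<Sum>k\<in>UNIV. u $ k *\<^sub>R axis k 1)"
    by (simp add: basis_expansion flip: scalar_mult_eq_scaleR)
  also have "\<dots> = (\<Sum>k\<in>UNIV. u $ k *\<^sub>R blinfun_apply A (axis k 1))"
    by (simp add: blinfun.sum_right blinfun.scaleR_right)
  finally have A: "blinfun_apply A u = \<dots>" .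
  show ?thesis
    unfolding A tensor_op.rep_eq
    by (simp add: vec_eq_iff tensor_vec_def blinfun.scaleR_right scaleR_sum_left mult.commute)
qed

text \<open>The coefficient $T_{ijkl}$ of $T$ for $u_i$ the standard basis and $v = v_j$, $w = v_l$.\<close>

definition tcoeff :: "(('b::real_inner ^ 's) \<Rightarrow>\<^sub>L ('b ^ 's)) \<Rightarrow> 's \<Rightarrow> 'b \<Rightarrow> 's \<Rightarrow> 'b \<Rightarrow> real" where
  "tcoeff T i v k w =
     inner (tensor_vec (axis i 1) v) (blinfun_apply T (tensor_vec (axis k 1) w))"

text \<open>The sum over pairs is a limit in operator norm; it even converges in Hilbert--Schmidt norm.\<close>

definition ptrace1 :: "(('b::real_inner ^ 's) \<Rightarrow>\<^sub>L ('b ^ 's)) \<Rightarrow> ('b \<Rightarrow>\<^sub>L 'b)" where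
  "ptrace1 T = (\<Sum>\<^sub>\<infinity>(v, w)\<in>some_onb \<times> some_onb. (\<Sum>i\<in>UNIV. tcoeff T i v i w) *\<^sub>R outer v w)"

definition ptrace2 :: "(('b::real_inner ^ 's) \<Rightarrow>\<^sub>L ('b ^ 's)) \<Rightarrow> ((real ^ 's) \<Rightarrow>\<^sub>L (real ^ 's))" where
  "ptrace2 T = (\<Sum>i\<in>UNIV. \<Sum>k\<in>UNIV.
     (\<Sum>\<^sub>\<infinity>v\<in>some_onb. tcoeff T i v k v) *\<^sub>R outer (axis i 1) (axis k 1))"


section \<open>Approximable sequences\<close>

text \<open>$\nu_p(Z) = (E \Vert Z \Vert^p)^{1/p}$ as an element of $[0,\infty]$.\<close>

definition nu :: "'w measure \<Rightarrow> real \<Rightarrow> ('w \<Rightarrow> 'a::real_normed_vector) \<Rightarrow> ennreal" where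
  "nu M p Z = (let I = (\<integral>\<^sup>+\<omega>. ennreal (norm (Z \<omega>) powr p) \<partial>M) in
     if I = \<infinity> then \<infinity> else ennreal (enn2real I powr (1 / p)))"

text \<open>
  The sequences $(u^*_k(n,m))_k$ for $n \in Z$, $m \ge 1$ are copies of $(u_k)_k$; index
  \<^term>\<open>None\<close> stands for $(u_k)_k$ itself.
\<close>

definition independent_copies ::
  "'w measure \<Rightarrow> 'u measure \<Rightarrow> (int \<Rightarrow> 'w \<Rightarrow> 'u) \<Rightarrow> (int \<Rightarrow> nat \<Rightarrow> int \<Rightarrow> 'w \<Rightarrow> 'u) \<Rightarrow> bool" where
  "independent_copies M U u ustar \<longleftrightarrow>
     prob_space.indep_vars M (\<lambda>_. \<Pi>\<^sub>M k\<in>UNIV. U)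
       (\<lambda>c \<omega>. case c of None \<Rightarrow> (\<lambda>k. u k \<omega>) | Some (n, m) \<Rightarrow> (\<lambda>k. ustar n m k \<omega>))
       (insert None (Some ` (UNIV \<times> {1..}))) \<and>
     (\<forall>n. \<forall>m\<ge>1. distr M (\<Pi>\<^sub>M k\<in>UNIV. U) (\<lambda>\<omega> k. ustar n m k \<omega>)
       = distr M (\<Pi>\<^sub>M k\<in>UNIV. U) (\<lambda>\<omega> k. u k \<omega>))"

definition Lp_m_approximable ::
  "'w measure \<Rightarrow> 'u measure \<Rightarrow> real
    \<Rightarrow> (int \<Rightarrow> 'w \<Rightarrow> 'h::{real_inner, banach, second_countable_topology}) \<Rightarrow> bool" where
  "Lp_m_approximable M U p Z \<longleftrightarrow>
     (\<forall>n. nu M p (Z n) < \<infinity>) \<and>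
     (\<exists>(f :: (nat \<Rightarrow> 'u) \<Rightarrow> 'h) u ustar.
        f \<in> borel_measurable (\<Pi>\<^sub>M j\<in>UNIV. U) \<and>
        prob_space.indep_vars M (\<lambda>_. U) u UNIV \<and>
        (\<forall>k. distr M U (u k) = distr M U (u 0)) \<and>
        (\<forall>n. \<forall>\<omega>\<in>space M. Z n \<omega> = f (\<lambda>j. u (n - int j) \<omega>)) \<and>
        independent_copies M U u ustar \<and>
        (\<forall>n. (\<Sum>i. let m = Suc i in nu M p (\<lambda>\<omega>. Z n \<omega> -
           f (\<lambda>j. if j \<le> m then u (n - int j) \<omega> else ustar n m (n - int j) \<omega>))) < \<infinity>))"


section \<open>Covariance operators and the test statistic\<close>

text \<open>
  The expectation of a random operator, taken pointwise as a Bochner integral. For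
  trace-class valued operators with integrable trace norm this is the usual expectation.
\<close>

definition expect_op ::
  "'w measure \<Rightarrow> ('w \<Rightarrow> 'a::real_normed_vector \<Rightarrow>\<^sub>L 'b::{banach, second_countable_topology}) \<Rightarrow> ('a \<Rightarrow>\<^sub>L 'b)" where
  "expect_op M A = Blinfun (\<lambda>z. \<integral>\<omega>. blinfun_apply (A \<omega>) z \<partial>M)"

lemma blinfun_apply_expect_op:
  assumes m: "\<And>z. (\<lambda>\<omega>. blinfun_apply (A \<omega>) z) \<in> borel_measurable M"
    and i: "integrable M (\<lambda>\<omega>. norm (A \<omega>))"
  shows "blinfun_apply (expect_op M A) z = (\<integral>\<omega>. blinfun_apply (A \<omega>) z \<partial>M)"
proof -
  have int: "integrable M (\<lambda>\<omega>. blinfun_apply (A \<omega>) z)" for z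
  proof (rule Bochner_Integration.integrable_bound)
    show "integrable M (\<lambda>\<omega>. norm (A \<omega>) * norm z)" using i by simp
  qed (simp_all add: m norm_blinfun)
  have "bounded_linear (\<lambda>z. \<integral>\<omega>. blinfun_apply (A \<omega>) z \<partial>M)"
  proof (rule bounded_linear_intro[where K = "\<integral>\<omega>. norm (A \<omega>) \<partial>M"])
    fix z
    have "norm (\<integral>\<omega>. blinfun_apply (A \<omega>) z \<partial>M) \<le> (\<integral>\<omega>. norm (A \<omega>) * norm z \<partial>M)"
      by (rule order_trans[OF integral_norm_bound integral_mono])
        (use i int[of z] in \<open>simp_all add: norm_blinfun\<close>)
    then show "norm (\<integral>\<omega>. blinfun_apply (A \<omega>) z \<partial>M) \<le> norm z * (\<integral>\<omega>. norm (A \<omega>) \<partial>M)"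
      by (simp add: mult.commute)
  qed (simp_all add: blinfun.add_right blinfun.scaleR_right int)
  then show ?thesis by (simp add: expect_op_def bounded_linear_Blinfun_apply)
qed

text \<open>
  The definition takes $n = 0$ in $E[X_n \otimes X_{n+h}]$, which is no restriction for stationary
  sequences, in particular for approximable ones.
\<close>

definition lag_cov ::
  "'w measure \<Rightarrow> (int \<Rightarrow> 'w \<Rightarrow> 'a::{real_inner, banach, second_countable_topology}) \<Rightarrow> nat \<Rightarrow> ('a \<Rightarrow>\<^sub>L 'a)" where
  "lag_cov M X h = expect_op M (\<lambda>\<omega>. outer (X 0 \<omega>) (X (int h) \<omega>))"

definition est_cov :: "nat \<Rightarrow> nat \<Rightarrow> (int \<Rightarrow> 'a::real_inner) \<Rightarrow> ('a \<Rightarrow>\<^sub>L 'a)" where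
  "est_cov N h x =
     (1 / (real N - real h)) *\<^sub>R (\<Sum>n = 1..int N - int h. outer (x n) (x (n + int h)))"

definition factor1 :: "(('b::real_inner ^ 's) \<Rightarrow>\<^sub>L ('b ^ 's)) \<Rightarrow> ((real ^ 's) \<Rightarrow>\<^sub>L (real ^ 's))" where
  "factor1 T = (if op_trace T = 0 then 0 else (1 / op_trace T) *\<^sub>R ptrace2 T)"

definition factor2 :: "(('b::real_inner ^ 's) \<Rightarrow>\<^sub>L ('b ^ 's)) \<Rightarrow> ('b \<Rightarrow>\<^sub>L 'b)" where
  "factor2 T = ptrace1 T"

definition test_stat :: "nat \<Rightarrow> nat \<Rightarrow> (int \<Rightarrow> 'b::real_inner ^ 's) \<Rightarrow> real" where
  "test_stat N h x =
     (let C = est_cov N h x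
      in real N * (hs_norm (tensor_op (factor1 C) (factor2 C) - C))\<^sup>2)"


section \<open>Stochastic asymptotics\<close>

text \<open>
  Both notions are phrased through events whose probability is bounded from below, so that they
  cannot hold by virtue of a non-measurable event being assigned measure zero.
\<close>

definition big_O_P :: "'w measure \<Rightarrow> (nat \<Rightarrow> 'w \<Rightarrow> real) \<Rightarrow> (nat \<Rightarrow> real) \<Rightarrow> bool" where
  "big_O_P M Y a \<longleftrightarrow> (\<forall>\<epsilon>>0. \<exists>K. \<forall>\<^sub>F N in sequentially.
     measure M {\<omega> \<in> space M. \<bar>Y N \<omega>\<bar> \<le> K * a N} \<ge> 1 - \<epsilon>)"

definition diverges_in_prob :: "'w measure \<Rightarrow> (nat \<Rightarrow> 'w \<Rightarrow> real) \<Rightarrow> bool" where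
  "diverges_in_prob M Y \<longleftrightarrow>
     (\<forall>K. (\<lambda>N. measure M {\<omega> \<in> space M. Y N \<omega> > K}) \<longlonglongrightarrow> 1)"

end

theory Submission
  imports Defs
begin

text \<open>
  The statistic is $N$ times the squared Hilbert--Schmidt norm of a map $D$ applied to the estimated
  covariance operator. $D$ is Lipschitz near $C^{(h)}$ as soon as the trace and the coefficients of
  the second partial trace are controlled along with the Hilbert--Schmidt norm (they are not
  continuous in that norm), so it suffices that these quantities are estimated at rate $N^{-1/2}$.
  All of them are sample means of families of bilinear forms $\beta_i(X_n, X_{n+h})$ with
  $\sum_i \beta_i(x,y)^2 \le \Vert x \Vert^2 \Vert y \Vert^2$. To bound the covariance of such a term
  at time $n$ with one at a later time $k$, the innovations before time $n + h + 1$ entering the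
  latter are replaced by those of one independent copy: the replaced term is independent of the one
  at time $n$, and the error is controlled by the fourth-moment approximation error at lag about
  $k - n - h$, which is summable. Hence the variances, summed over $i$, are $O(1/N)$, and Chebyshev's
  inequality applies.
\<close>

section \<open>Orthonormal bases\<close>

text \<open>The random operators are never treated as random elements of a space of Hilbert--Schmidt
  operators. Only their coefficients are random variables, and the moment estimates are stated for
  an arbitrary finite set of indices with a constant independent of that set;
  \<open>hs_coeffI\<close> turns such bounds into Hilbert--Schmidt bounds. To get one event that
  serves all finite sets at once, the sum over the countable index set is written as a nonnegative
  integral over a counting measure, and Markov's inequality is applied to it. One copy serves for
  all times and lags because the joint law of the innovations with any single copy is the same, so
  the approximation errors keep their laws. It also makes the truncated pair a function of the
  innovations and one independent sequence; independence from an earlier pair then follows by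
  freezing that sequence. The remainder has order sqrt N because N (a^2 - b^2) = N (a - b) (a + b),
  where a and b are the norms of the deviations at the estimate and at the truth: a - b has order 1
  / sqrt N and a + b stays bounded.\<close>

lemma onbD:
  assumes "onb B"
  shows "\<And>b. b \<in> B \<Longrightarrow> inner b b = 1" "\<And>b c. b \<in> B \<Longrightarrow> c \<in> B \<Longrightarrow> b \<noteq> c \<Longrightarrow> inner b c = 0"
  using assms by (auto simp: onb_def pairwise_def orthogonal_def dot_square_norm)

text \<open>The incomplete counterpart of \<open>onb\<close>: it applies to finite subsets of a
  basis and to a single unit vector, as in \<open>norm_le_hs_norm\<close>.\<close>

definition orthonormal :: "'a::real_inner set \<Rightarrow> bool" where
  "orthonormal F \<longleftrightarrow> (\<forall>b\<in>F. \<forall>c\<in>F. inner b c = (if b = c then 1 else 0))"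

lemma orthonormal_onb: "onb B \<Longrightarrow> F \<subseteq> B \<Longrightarrow> orthonormal F"
  using onbD[of B] by (auto simp: orthonormal_def subset_eq)

text \<open>Completing the square around the coefficients \<open>inner b x\<close>. Taking these
  coefficients gives Bessel's inequality; general \<open>c\<close> shows that they give the best
  approximation from the span.\<close>

lemma norm_sq_sum_orthonormal:
  assumes "finite F" "orthonormal F"
  shows "(norm (x - (\<Sum>b\<in>F. c b *\<^sub>R b)))\<^sup>2 =
    (norm x)\<^sup>2 - (\<Sum>b\<in>F. (inner b x)\<^sup>2) + (\<Sum>b\<in>F. (c b - inner b x)\<^sup>2)"
proof -
  have 1: "inner (\<Sum>b\<in>F. c b *\<^sub>R b) (\<Sum>b\<in>F. c b *\<^sub>R b) = (\<Sum>b\<in>F. (c b)\<^sup>2)"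
  proof -
    have "inner (\<Sum>b\<in>F. c b *\<^sub>R b) (\<Sum>b\<in>F. c b *\<^sub>R b)
        = (\<Sum>b\<in>F. \<Sum>d\<in>F. c b * (c d * inner d b))"
      unfolding inner_sum_left inner_sum_right inner_scaleR_left inner_scaleR_right
      by (simp add: sum_distrib_left mult.left_commute)
    also have "\<dots> = (\<Sum>b\<in>F. \<Sum>d\<in>F. if d = b then c b * c d else 0)"
      using assms(2) by (intro sum.cong refl) (auto simp: orthonormal_def)
    also have "\<dots> = (\<Sum>b\<in>F. (c b)\<^sup>2)"
      using assms(1) by (simp add: power2_eq_square)
    finally show ?thesis .
  qed
  have 2: "inner x (\<Sum>b\<in>F. c b *\<^sub>R b) = (\<Sum>b\<in>F. c b * inner b x)"
    by (simp add: inner_sum_right inner_commute)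
  have 3: "(\<Sum>b\<in>F. (c b - inner b x)\<^sup>2)
      = (\<Sum>b\<in>F. (c b)\<^sup>2) + (\<Sum>b\<in>F. (inner b x)\<^sup>2) - 2 * (\<Sum>b\<in>F. c b * inner b x)"
    by (simp add: power2_diff sum.distrib sum_subtractf sum_distrib_left mult.assoc)
  show ?thesis
    unfolding power2_norm_eq_inner
    by (simp add: inner_diff_left inner_diff_right 1 2 3 inner_commute[of "sum _ _" x])
qed

lemma bessel:
  assumes "finite F" "orthonormal F"
  shows "(\<Sum>b\<in>F. (inner b x)\<^sup>2) \<le> (norm x)\<^sup>2"
  using norm_sq_sum_orthonormal[OF assms, of x "\<lambda>b. inner b x"]
    zero_le_power2[of "norm (x - (\<Sum>b\<in>F. inner b x *\<^sub>R b))"] by simp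

text \<open>By density some combination over a finite \<open>F0\<close> is within \<open>e\<close>
  of \<open>x\<close>; the orthogonal projection onto the span of any larger finite set is at least
  as close.\<close>

lemma onb_expansion:
  assumes B: "onb B"
  shows "((\<lambda>b. inner b x *\<^sub>R b) has_sum x) B"
  unfolding has_sum_def tendsto_iff
proof (intro allI impI)
  fix e :: real assume e: "e > 0"
  have "x \<in> closure (span B)" using B by (simp add: onb_def)
  then obtain y where y: "y \<in> span B" "dist y x < e"
    using e by (auto simp: closure_approachable)
  then obtain F0 c where F0: "finite F0" "F0 \<subseteq> B" "y = (\<Sum>b\<in>F0. c b *\<^sub>R b)"
    by (auto simp: span_explicit)
  show "\<forall>\<^sub>F G in finite_subsets_at_top B. dist (\<Sum>b\<in>G. inner b x *\<^sub>R b) x < e"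
    unfolding eventually_finite_subsets_at_top
  proof (intro exI[of _ F0] conjI allI impI F0)
    fix G assume G: "finite G \<and> F0 \<subseteq> G \<and> G \<subseteq> B"
    then have on: "finite G" "orthonormal G" using orthonormal_onb[OF B] by auto
    \<comment> \<open>The coefficients of \<open>y\<close> padded with zeros, so that
      \<open>y\<close> competes with the projection onto the span of \<open>G\<close>.\<close>
    define c' where "c' b = (if b \<in> F0 then c b else 0)" for b
    have y': "y = (\<Sum>b\<in>G. c' b *\<^sub>R b)"
      unfolding F0(3) c'_def using G by (intro sum.mono_neutral_cong_left) auto
    have "(norm (x - (\<Sum>b\<in>G. inner b x *\<^sub>R b)))\<^sup>2 \<le> (norm (x - y))\<^sup>2"
      unfolding y' norm_sq_sum_orthonormal[OF on] by (simp add: sum_nonneg)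
    then have "norm (x - (\<Sum>b\<in>G. inner b x *\<^sub>R b)) \<le> norm (x - y)"
      by (rule power2_le_imp_le) simp
    then show "dist (\<Sum>b\<in>G. inner b x *\<^sub>R b) x < e"
      using y(2) by (simp add: dist_norm norm_minus_commute)
  qed
qed

lemma parseval:
  assumes "onb B"
  shows "((\<lambda>b. inner b x * inner b y) has_sum inner x y) B"
  using has_sum_bounded_linear[OF bounded_linear_inner_left[of y] onb_expansion[OF assms, of x]]
  by (simp add: o_def)

lemma parseval_norm:
  assumes "onb B"
  shows "((\<lambda>b. (inner b x)\<^sup>2) has_sum (norm x)\<^sup>2) B"
  using parseval[OF assms, of x x] by (simp add: power2_eq_square dot_square_norm)

text \<open>By Parseval each point of a countable dense set has only countably many nonzero
  coefficients. Every basis vector has a dense point at distance less than 1, and orthogonality to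
  it would force distance at least 1.\<close>

lemma countable_onb:
  fixes B :: "'a::{real_inner,second_countable_topology} set"
  assumes B: "onb B"
  shows "countable B"
proof -
  obtain D :: "'a set" where D: "countable D" "\<And>U. open U \<Longrightarrow> U \<noteq> {} \<Longrightarrow> \<exists>d\<in>D. d \<in> U"
    by (erule countable_dense_setE)
  have "countable {b\<in>B. (inner b d)\<^sup>2 \<noteq> 0}" for d
    by (rule summable_countable_real) (use parseval_norm[OF B] in \<open>auto simp: has_sum_iff\<close>)
  then have "countable (\<Union>d\<in>D. {b\<in>B. (inner b d)\<^sup>2 \<noteq> 0})"
    using D(1) by blast
  moreover have "B \<subseteq> (\<Union>d\<in>D. {b\<in>B. (inner b d)\<^sup>2 \<noteq> 0})"
  proof
    fix b assume b: "b \<in> B"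
    obtain d where d: "d \<in> D" "d \<in> ball b 1" using D(2)[of "ball b 1"] by auto
    have "inner b d \<noteq> 0"
    proof
      assume 0: "inner b d = 0"
      have "(norm (b - d))\<^sup>2 = 1 + (norm d)\<^sup>2"
        using 0 onbD(1)[OF B b] by (simp add: power2_norm_eq_inner inner_diff inner_commute)
      moreover have "(norm (b - d))\<^sup>2 < 1"
        using d(2) by (simp add: dist_norm abs_square_less_1)
      ultimately show False by simp
    qed
    with b d show "b \<in> (\<Union>d\<in>D. {b\<in>B. (inner b d)\<^sup>2 \<noteq> 0})" by auto
  qed
  ultimately show ?thesis using countable_subset by blast
qed

text \<open>Cauchy--Schwarz applied to the basis expansion of \<open>z\<close>. Together with
  \<open>functional_orthonormal\<close> it shows that the square sum of a functional over any finite
  orthonormal set is at most the one over a basis.\<close>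

lemma functional_bound:
  assumes B: "onb B" and phi: "bounded_linear (\<phi> :: 'a::real_inner \<Rightarrow> real)"
    and s: "(\<lambda>b. (\<phi> b)\<^sup>2) summable_on B"
  shows "\<bar>\<phi> z\<bar> \<le> sqrt (\<Sum>\<^sub>\<infinity>b\<in>B. (\<phi> b)\<^sup>2) * norm z"
proof (rule tendsto_upperbound)
  show "((\<lambda>G. \<bar>\<Sum>b\<in>G. inner b z * \<phi> b\<bar>) \<longlongrightarrow> \<bar>\<phi> z\<bar>) (finite_subsets_at_top B)"
    using has_sum_bounded_linear[OF phi onb_expansion[OF B, of z]]
    by (auto simp: o_def has_sum_def linear_simps[OF phi] intro!: tendsto_rabs)
  show "\<forall>\<^sub>F G in finite_subsets_at_top B.
      \<bar>\<Sum>b\<in>G. inner b z * \<phi> b\<bar> \<le> sqrt (\<Sum>\<^sub>\<infinity>b\<in>B. (\<phi> b)\<^sup>2) * norm z"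
  proof (rule eventually_finite_subsets_at_top_weakI)
    fix G assume G: "finite G" "G \<subseteq> B"
    have "\<bar>\<Sum>b\<in>G. inner b z * \<phi> b\<bar> \<le> (\<Sum>b\<in>G. \<bar>\<phi> b\<bar> * \<bar>inner b z\<bar>)"
      by (rule order_trans[OF sum_abs]) (simp add: abs_mult mult.commute)
    also have "\<dots> \<le> L2_set \<phi> G * L2_set (\<lambda>b. inner b z) G"
      by (rule L2_set_mult_ineq)
    also have "\<dots> \<le> sqrt (\<Sum>\<^sub>\<infinity>b\<in>B. (\<phi> b)\<^sup>2) * norm z"
    proof (rule mult_mono)
      show "L2_set \<phi> G \<le> sqrt (\<Sum>\<^sub>\<infinity>b\<in>B. (\<phi> b)\<^sup>2)"
        unfolding L2_set_def using finite_sum_le_infsum[OF s G] by simp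
      show "L2_set (\<lambda>b. inner b z) G \<le> norm z"
        unfolding L2_set_def using bessel[OF G(1) orthonormal_onb[OF B G(2)], of z]
        by (simp add: real_le_lsqrt)
    qed (simp_all add: infsum_nonneg)
    finally show "\<bar>\<Sum>b\<in>G. inner b z * \<phi> b\<bar> \<le> sqrt (\<Sum>\<^sub>\<infinity>b\<in>B. (\<phi> b)\<^sup>2) * norm z" .
  qed
qed simp

text \<open>The functional is tested on the sum \<open>y\<close> of the vectors
  \<open>\<phi> b *\<^sub>R b\<close>, where it takes the value \<open>s\<close> while
  \<open>y\<close> has norm \<open>sqrt s\<close>.\<close>

lemma functional_orthonormal:
  assumes phi: "bounded_linear (\<phi> :: 'a::real_inner \<Rightarrow> real)" and F: "finite F" "orthonormal F"
    and c: "\<And>z. \<bar>\<phi> z\<bar> \<le> c * norm z"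
  shows "(\<Sum>b\<in>F. (\<phi> b)\<^sup>2) \<le> c\<^sup>2"
proof -
  define s where "s = (\<Sum>b\<in>F. (\<phi> b)\<^sup>2)"
  define y where "y = (\<Sum>b\<in>F. \<phi> b *\<^sub>R b)"
  have s0: "s \<ge> 0" by (simp add: s_def sum_nonneg)
  have "(norm (0 - y))\<^sup>2 = s"
    unfolding y_def norm_sq_sum_orthonormal[OF F] by (simp add: s_def)
  then have ny: "norm y = sqrt s" by (simp add: real_sqrt_unique)
  have "\<phi> y = s"
    unfolding y_def s_def by (simp add: linear_sum[OF bounded_linear.linear[OF phi]]
      linear_simps[OF phi] power2_eq_square)
  then have "sqrt s * sqrt s \<le> c * sqrt s"
    using c[of y] ny s0 by simp
  then have "s = 0 \<or> sqrt s \<le> c" using s0 by (metis mult_right_le_imp_le real_sqrt_gt_zero less_eq_real_def)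
  then show ?thesis
    using s0 unfolding s_def[symmetric] by (auto dest: sqrt_le_D)
qed

lemma has_sum_sum:
  fixes f :: "'i \<Rightarrow> 'a \<Rightarrow> 'b::topological_comm_monoid_add"
  assumes "finite F" "\<And>i. i \<in> F \<Longrightarrow> (f i has_sum s i) A"
  shows "((\<lambda>x. \<Sum>i\<in>F. f i x) has_sum (\<Sum>i\<in>F. s i)) A"
  using assms by (induction F rule: finite_induct) (auto intro: has_sum_add)

section \<open>Hilbert--Schmidt operators\<close>

text \<open>\<open>hs_norm\<close> is built on \<open>infsum\<close>, which is 0 for a divergent
  sum; a bound on it is meaningful only together with this predicate.\<close>

definition hs :: "('a::real_inner \<Rightarrow>\<^sub>L 'b::real_inner) \<Rightarrow> bool" where
  "hs T \<longleftrightarrow> (\<lambda>e. (norm (blinfun_apply T e))\<^sup>2) summable_on some_onb"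

lemma hs_norm_nonneg: "0 \<le> hs_norm T"
  by (simp add: hs_norm_def infsum_nonneg)

lemma hsI:
  assumes "0 \<le> c" "\<And>F. finite F \<Longrightarrow> F \<subseteq> some_onb \<Longrightarrow> L2_set (\<lambda>e. norm (blinfun_apply T e)) F \<le> c"
  shows "hs T" "hs_norm T \<le> c"
proof -
  have *: "(\<Sum>e\<in>F. (norm (blinfun_apply T e))\<^sup>2) \<le> c\<^sup>2" if "finite F" "F \<subseteq> some_onb" for F
    using assms(2)[OF that] unfolding L2_set_def by (rule sqrt_le_D)
  show "hs T"
    unfolding hs_def by (rule nonneg_bdd_above_summable_on) (auto intro!: bdd_aboveI2 *)
  then have "(\<Sum>\<^sub>\<infinity>e\<in>some_onb. (norm (blinfun_apply T e))\<^sup>2) \<le> c\<^sup>2"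
    unfolding hs_def by (intro infsum_le_finite_sums) (auto intro!: *)
  then show "hs_norm T \<le> c"
    unfolding hs_norm_def using assms(1) by (intro real_le_lsqrt) auto
qed

lemma hs_norm_sq: "(hs_norm T)\<^sup>2 = (\<Sum>\<^sub>\<infinity>e\<in>some_onb. (norm (blinfun_apply T e))\<^sup>2)"
  by (simp add: hs_norm_def infsum_nonneg)

lemma L2_set_sum_triangle:
  "finite J \<Longrightarrow> L2_set (\<lambda>e. \<Sum>j\<in>J. f j e) F \<le> (\<Sum>j\<in>J. L2_set (f j) F)"
proof (induction J rule: finite_induct)
  case (insert x J)
  have "L2_set (\<lambda>e. f x e + (\<Sum>j\<in>J. f j e)) F \<le> L2_set (f x) F + (\<Sum>j\<in>J. L2_set (f j) F)"
    by (rule order_trans[OF L2_set_triangle_ineq]) (rule add_left_mono, rule insert.IH)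
  then show ?case using insert.hyps by simp
qed (simp add: L2_set_def)

text \<open>
  The case where \<^term>\<open>g\<close> is the identity shows that the Hilbert--Schmidt norm can be computed in any
  orthonormal basis.
\<close>

lemma hs_contraction:
  fixes T :: "'a::{real_inner,second_countable_topology} \<Rightarrow>\<^sub>L 'b::{real_inner,second_countable_topology}"
  assumes T: "hs T" and F: "finite F" "orthonormal F"
    and g: "bounded_linear g" "\<And>x. norm (g x) \<le> norm x"
  shows "L2_set (\<lambda>e. norm (blinfun_apply T (g e))) F \<le> hs_norm T"
proof -
  let ?O = "some_onb :: 'a set" and ?P = "some_onb :: 'b set"
  \<comment> \<open>Finitely many coordinates \<open>v\<close> are taken at a time. For each of them
    \<open>inner v (T z)\<close> is a scalar functional of \<open>z\<close>, bounded by its square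
    sum over the basis and then tested on \<open>F\<close> through \<open>g\<close>. Parseval
    restores all coordinates afterwards.\<close>
  have fin: "(\<Sum>v\<in>V. \<Sum>e\<in>F. (inner v (blinfun_apply T (g e)))\<^sup>2) \<le> (hs_norm T)\<^sup>2"
    if V: "finite V" "V \<subseteq> ?P" for V
  proof -
    have oV: "orthonormal V" using orthonormal_onb[OF onb_some_onb V(2)] .
    have sv: "(\<lambda>w. (inner v (blinfun_apply T w))\<^sup>2) summable_on ?O" if "v \<in> V" for v
    proof (rule summable_on_comparison_test[OF T[unfolded hs_def]])
      fix w assume "w \<in> ?O"
      have "norm v = 1" using oV that by (auto simp: orthonormal_def norm_eq_sqrt_inner)
      then show "(inner v (blinfun_apply T w))\<^sup>2 \<le> (norm (blinfun_apply T w))\<^sup>2"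
        using Cauchy_Schwarz_ineq[of v "blinfun_apply T w"] by (simp add: dot_square_norm)
    qed simp
    have "(\<Sum>v\<in>V. \<Sum>e\<in>F. (inner v (blinfun_apply T (g e)))\<^sup>2)
        \<le> (\<Sum>v\<in>V. \<Sum>\<^sub>\<infinity>w\<in>?O. (inner v (blinfun_apply T w))\<^sup>2)"
    proof (rule sum_mono)
      fix v assume v: "v \<in> V"
      let ?s = "\<Sum>\<^sub>\<infinity>w\<in>?O. (inner v (blinfun_apply T w))\<^sup>2"
      have bl: "bounded_linear (\<lambda>z. inner v (blinfun_apply T z))"
        by (intro bounded_linear_intros blinfun.bounded_linear_right)
      have "(\<Sum>e\<in>F. (inner v (blinfun_apply T (g e)))\<^sup>2) \<le> (sqrt ?s)\<^sup>2"
      proof (rule functional_orthonormal[OF _ F])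
        show "bounded_linear (\<lambda>z. inner v (blinfun_apply T (g z)))"
          by (rule bounded_linear_compose[OF bl g(1)])
        fix z
        have "\<bar>inner v (blinfun_apply T (g z))\<bar> \<le> sqrt ?s * norm (g z)"
          by (rule functional_bound[OF onb_some_onb bl sv[OF v]])
        also have "\<dots> \<le> sqrt ?s * norm z"
          by (intro mult_left_mono g) (simp add: infsum_nonneg)
        finally show "\<bar>inner v (blinfun_apply T (g z))\<bar> \<le> sqrt ?s * norm z" .
      qed
      then show "(\<Sum>e\<in>F. (inner v (blinfun_apply T (g e)))\<^sup>2) \<le> ?s"
        by (simp add: infsum_nonneg)
    qed
    also have "\<dots> \<le> (hs_norm T)\<^sup>2"
    proof (rule has_sum_mono)
      show "((\<lambda>w. \<Sum>v\<in>V. (inner v (blinfun_apply T w))\<^sup>2) has_sum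
          (\<Sum>v\<in>V. \<Sum>\<^sub>\<infinity>w\<in>?O. (inner v (blinfun_apply T w))\<^sup>2)) ?O"
        by (intro has_sum_sum V has_sum_infsum sv)
      show "((\<lambda>w. (norm (blinfun_apply T w))\<^sup>2) has_sum (hs_norm T)\<^sup>2) ?O"
        unfolding hs_norm_sq by (intro has_sum_infsum T[unfolded hs_def])
    qed (rule bessel[OF V(1) oV])
    finally show ?thesis .
  qed
  have "((\<lambda>v. \<Sum>e\<in>F. (inner v (blinfun_apply T (g e)))\<^sup>2) has_sum
      (\<Sum>e\<in>F. (norm (blinfun_apply T (g e)))\<^sup>2)) ?P"
    by (rule has_sum_sum[OF F(1)]) (rule parseval_norm[OF onb_some_onb])
  then have "(\<Sum>e\<in>F. (norm (blinfun_apply T (g e)))\<^sup>2) \<le> (hs_norm T)\<^sup>2"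
    by (rule has_sum_le_finite_sums) (rule fin)
  then show ?thesis
    unfolding L2_set_def using hs_norm_nonneg by (intro real_le_lsqrt) auto
qed

lemma hs_orthonormal:
  fixes T :: "'a::{real_inner,second_countable_topology} \<Rightarrow>\<^sub>L 'b::{real_inner,second_countable_topology}"
  assumes "hs T" "finite F" "orthonormal F"
  shows "L2_set (\<lambda>e. norm (blinfun_apply T e)) F \<le> hs_norm T"
  using hs_contraction[OF assms, of "\<lambda>x. x"] by simp

text \<open>A unit vector is an orthonormal set by itself, so \<open>hs_orthonormal\<close> applies
  to it.\<close>

lemma norm_le_hs_norm:
  fixes T :: "'a::{real_inner,second_countable_topology} \<Rightarrow>\<^sub>L 'b::{real_inner,second_countable_topology}"
  assumes "hs T"
  shows "norm T \<le> hs_norm T"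
proof (rule norm_blinfun_bound[OF hs_norm_nonneg])
  fix z
  show "norm (blinfun_apply T z) \<le> hs_norm T * norm z"
  proof (cases "z = 0")
    case False
    have "orthonormal {z /\<^sub>R norm z}"
      using False by (simp add: orthonormal_def dot_square_norm power2_eq_square)
    from hs_orthonormal[OF assms _ this]
    have "norm (blinfun_apply T (z /\<^sub>R norm z)) \<le> hs_norm T"
      by (simp add: L2_set_def)
    then show ?thesis using False by (simp add: blinfun.scaleR_right field_simps)
  qed simp
qed

lemma hs_add:
  fixes A :: "'a::{real_inner,second_countable_topology} \<Rightarrow>\<^sub>L 'b::{real_inner,second_countable_topology}"
  assumes "hs A" "hs B"
  shows "hs (A + B)" "hs_norm (A + B) \<le> hs_norm A + hs_norm B"
proof -
  have "L2_set (\<lambda>e. norm (blinfun_apply (A + B) e)) F \<le> hs_norm A + hs_norm B"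
    if F: "finite F" "F \<subseteq> some_onb" for F
  proof -
    have "L2_set (\<lambda>e. norm (blinfun_apply (A + B) e)) F
        \<le> L2_set (\<lambda>e. norm (blinfun_apply A e) + norm (blinfun_apply B e)) F"
      by (intro L2_set_mono) (auto simp: blinfun.add_left norm_triangle_ineq)
    also have "\<dots> \<le> hs_norm A + hs_norm B"
      using orthonormal_onb[OF onb_some_onb F(2)] F(1)
      by (intro order_trans[OF L2_set_triangle_ineq] add_mono hs_orthonormal assms)
    finally show ?thesis .
  qed
  from hsI[OF _ this] show "hs (A + B)" "hs_norm (A + B) \<le> hs_norm A + hs_norm B"
    by (auto simp: hs_norm_nonneg)
qed

lemma hs_uminus: "hs (- A) \<longleftrightarrow> hs A" "hs_norm (- A) = hs_norm A"
  by (simp_all add: hs_def hs_norm_def blinfun.minus_left)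

lemma hs_diff:
  fixes A :: "'a::{real_inner,second_countable_topology} \<Rightarrow>\<^sub>L 'b::{real_inner,second_countable_topology}"
  assumes "hs A" "hs B"
  shows "hs (A - B)" "hs_norm (A - B) \<le> hs_norm A + hs_norm B"
  using hs_add[OF assms(1), of "- B"] assms(2) by (simp_all add: hs_uminus)

text \<open>Parseval in the codomain reduces the norms of finitely many columns to finite sums over
  rectangles of indices.\<close>

lemma hs_coeffI:
  fixes T :: "'a::{real_inner,second_countable_topology} \<Rightarrow>\<^sub>L 'b::{real_inner,second_countable_topology}"
  assumes c: "0 \<le> c"
    and le: "\<And>F. finite F \<Longrightarrow> F \<subseteq> some_onb \<times> some_onb \<Longrightarrow> (\<Sum>(v,w)\<in>F. (inner v (blinfun_apply T w))\<^sup>2) \<le> c\<^sup>2"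
  shows "hs T" "hs_norm T \<le> c"
proof -
  have "L2_set (\<lambda>e. norm (blinfun_apply T e)) F \<le> c" if F: "finite F" "F \<subseteq> some_onb" for F
  proof -
    have "((\<lambda>v. \<Sum>w\<in>F. (inner v (blinfun_apply T w))\<^sup>2) has_sum
        (\<Sum>w\<in>F. (norm (blinfun_apply T w))\<^sup>2)) some_onb"
      by (rule has_sum_sum[OF F(1)]) (rule parseval_norm[OF onb_some_onb])
    then have "(\<Sum>w\<in>F. (norm (blinfun_apply T w))\<^sup>2) \<le> c\<^sup>2"
    proof (rule has_sum_le_finite_sums)
      fix V :: "'b set" assume V: "finite V" "V \<subseteq> some_onb"
      show "(\<Sum>v\<in>V. \<Sum>w\<in>F. (inner v (blinfun_apply T w))\<^sup>2) \<le> c\<^sup>2"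
        using le[of "V \<times> F"] V F by (auto simp: sum.cartesian_product Sigma_mono)
    qed
    then show ?thesis
      unfolding L2_set_def using c by (intro real_le_lsqrt) auto
  qed
  from hsI[OF c this] show "hs T" "hs_norm T \<le> c" by auto
qed

text \<open>\<open>F\<close> is enlarged to the rectangle of its projections, where Bessel's
  inequality applies column by column.\<close>

lemma hs_coeff_le:
  fixes T :: "'a::{real_inner,second_countable_topology} \<Rightarrow>\<^sub>L 'b::{real_inner,second_countable_topology}"
  assumes T: "hs T" and F: "finite F" "F \<subseteq> some_onb \<times> some_onb"
  shows "(\<Sum>(v,w)\<in>F. (inner v (blinfun_apply T w))\<^sup>2) \<le> (hs_norm T)\<^sup>2"
proof -
  let ?V = "fst ` F" and ?W = "snd ` F"
  have V: "finite ?V" "?V \<subseteq> some_onb" and W: "finite ?W" "?W \<subseteq> some_onb" using F by auto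
  have "(\<Sum>(v,w)\<in>F. (inner v (blinfun_apply T w))\<^sup>2) \<le> (\<Sum>(v,w)\<in>?V \<times> ?W. (inner v (blinfun_apply T w))\<^sup>2)"
    by (rule sum_mono2) (use V W in \<open>force+\<close>)
  also have "\<dots> = (\<Sum>w\<in>?W. \<Sum>v\<in>?V. (inner v (blinfun_apply T w))\<^sup>2)"
    by (simp add: sum.cartesian_product[symmetric] sum.swap[of _ ?W])
  also have "\<dots> \<le> (\<Sum>w\<in>?W. (norm (blinfun_apply T w))\<^sup>2)"
    by (intro sum_mono bessel V orthonormal_onb[OF onb_some_onb])
  also have "\<dots> \<le> (hs_norm T)\<^sup>2"
    unfolding hs_norm_sq using T W by (intro finite_sum_le_infsum) (auto simp: hs_def)
  finally show ?thesis .
qed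

lemma some_onb_inner:
  fixes b c :: "'a::{real_inner,second_countable_topology}"
  assumes "b \<in> some_onb" "c \<in> some_onb"
  shows "inner b c = (if b = c then 1 else 0)"
  using onbD[OF onb_some_onb] assms by auto

lemma outer_apply: "blinfun_apply (outer x y) z = inner y z *\<^sub>R x"
  by (simp add: outer.rep_eq)

text \<open>The Hilbert--Schmidt norm of the remainder is the tail of a convergent series of squared
  coefficients, and it dominates the operator norm. This evaluates the infinite sum in
  \<open>ptrace1\<close>.\<close>

lemma hs_has_sum_outer:
  fixes R :: "'a::{real_inner,second_countable_topology} \<Rightarrow>\<^sub>L 'b::{real_inner,second_countable_topology}"
  assumes R: "hs R"
  shows "((\<lambda>(v,w). inner v (blinfun_apply R w) *\<^sub>R outer v w) has_sum R) (some_onb \<times> some_onb)"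
  unfolding has_sum_def tendsto_iff
proof (intro allI impI)
  fix e :: real assume e: "e > 0"
  let ?A = "some_onb \<times> some_onb :: ('b \<times> 'a) set"
  define c where "c = (\<lambda>(v::'b, w::'a). inner v (blinfun_apply R w))"
  have csum: "(\<lambda>p. (c p)\<^sup>2) summable_on ?A"
  proof (rule nonneg_bdd_above_summable_on)
    show "bdd_above (sum (\<lambda>p. (c p)\<^sup>2) ` {F. F \<subseteq> ?A \<and> finite F})"
    proof (rule bdd_aboveI2)
      fix F assume "F \<in> {F. F \<subseteq> ?A \<and> finite F}"
      then have "(\<Sum>(v,w)\<in>F. (inner v (blinfun_apply R w))\<^sup>2) \<le> (hs_norm R)\<^sup>2"
        by (intro hs_coeff_le[OF R]) auto
      then show "(\<Sum>p\<in>F. (c p)\<^sup>2) \<le> (hs_norm R)\<^sup>2"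
        unfolding c_def case_prod_unfold .
    qed
  qed (rule zero_le_power2)
  have ev: "\<forall>\<^sub>F G in finite_subsets_at_top ?A. dist (\<Sum>p\<in>G. (c p)\<^sup>2) (\<Sum>\<^sub>\<infinity>p\<in>?A. (c p)\<^sup>2) < (e/2)\<^sup>2"
    using infsum_tendsto[OF csum] e by (intro tendstoD) auto
  have "dist (\<Sum>(v,w)\<in>G. inner v (blinfun_apply R w) *\<^sub>R outer v w) R < e"
    if G: "finite G" "G \<subseteq> ?A" and d: "dist (\<Sum>p\<in>G. (c p)\<^sup>2) (\<Sum>\<^sub>\<infinity>p\<in>?A. (c p)\<^sup>2) < (e/2)\<^sup>2" for G
  proof -
    \<comment> \<open>The remainder has the coefficients of \<open>R\<close> outside
      \<open>G\<close> and zeros on \<open>G\<close>, so each of its finite square sums is at most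
      the total minus the part over \<open>G\<close>.\<close>
    define D where "D = R - (\<Sum>(v,w)\<in>G. inner v (blinfun_apply R w) *\<^sub>R outer v w)"
    have coeff: "inner v (blinfun_apply D w) = (if (v,w) \<in> G then 0 else c (v,w))"
      if v: "v \<in> some_onb" and w: "w \<in> some_onb" for v w
    proof -
      have "inner v (blinfun_apply (\<Sum>(v,w)\<in>G. inner v (blinfun_apply R w) *\<^sub>R outer v w) w)
          = (\<Sum>p\<in>G. c p * (inner (snd p) w * inner v (fst p)))"
        by (simp add: blinfun.sum_left inner_sum_right case_prod_unfold blinfun.scaleR_left outer_apply c_def mult.assoc)
      also have "\<dots> = (\<Sum>p\<in>G. if p = (v,w) then c (v,w) else 0)"
      proof (rule sum.cong[OF refl])
        fix p assume "p \<in> G"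
        then have "fst p \<in> some_onb" "snd p \<in> some_onb" using G by auto
        then show "c p * (inner (snd p) w * inner v (fst p)) = (if p = (v,w) then c (v,w) else 0)"
          using v w by (cases p) (auto simp: some_onb_inner)
      qed
      also have "\<dots> = (if (v,w) \<in> G then c (v,w) else 0)" using G(1) by simp
      finally show ?thesis
        by (simp add: D_def blinfun.diff_left inner_diff_right c_def)
    qed
    have le: "(\<Sum>(v,w)\<in>F. (inner v (blinfun_apply D w))\<^sup>2) \<le> (e/2)\<^sup>2" if F: "finite F" "F \<subseteq> ?A" for F
    proof -
      have "(\<Sum>(v,w)\<in>F. (inner v (blinfun_apply D w))\<^sup>2) = (\<Sum>p\<in>F - G. (c p)\<^sup>2)"
        using F coeff by (intro sum.mono_neutral_cong_right) auto
      also have "\<dots> = (\<Sum>p\<in>G \<union> F. (c p)\<^sup>2) - (\<Sum>p\<in>G. (c p)\<^sup>2)"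
        using F(1) G(1) by (subst sum_diff[symmetric]) (auto intro!: sum.cong)
      also have "(\<Sum>p\<in>G \<union> F. (c p)\<^sup>2) \<le> (\<Sum>\<^sub>\<infinity>p\<in>?A. (c p)\<^sup>2)"
        using F G csum by (intro finite_sum_le_infsum) auto
      finally show ?thesis using d by (simp add: dist_real_def)
    qed
    have "norm D \<le> hs_norm D" "hs_norm D \<le> e/2"
      using hs_coeffI[OF _ le] e norm_le_hs_norm[of D] by auto
    then show ?thesis using e by (simp add: D_def dist_norm norm_minus_commute)
  qed
  note close = this
  have "\<forall>\<^sub>F G in finite_subsets_at_top ?A. finite G \<and> G \<subseteq> ?A"
    by (rule eventually_finite_subsets_at_top_weakI) simp
  then show "\<forall>\<^sub>F G in finite_subsets_at_top ?A.
      dist (\<Sum>(v,w)\<in>G. inner v (blinfun_apply R w) *\<^sub>R outer v w) R < e"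
    using ev by eventually_elim (rule close, auto)
qed

lemma hs_norm_pos:
  fixes T :: "'a::{real_inner,second_countable_topology} \<Rightarrow>\<^sub>L 'b::{real_inner,second_countable_topology}"
  assumes "hs T" "T \<noteq> 0"
  shows "hs_norm T > 0"
  using norm_le_hs_norm[OF assms(1)] assms(2) by (meson order_less_le_trans zero_less_norm_iff)

section \<open>Partial traces and tensor products of Hilbert--Schmidt operators\<close>

lemma tensor_vec_axis_nth: "tensor_vec (axis i 1) v $ s = (if s = i then v else 0)"
  by (simp add: tensor_vec_def axis_def)

lemma inner_tensor_vec_axis: "inner (tensor_vec (axis i 1) v) x = inner v (x $ i)"
proof -
  have "inner (tensor_vec (axis i 1) v) x = (\<Sum>s\<in>UNIV. if s = i then inner v (x $ s) else 0)"
    unfolding inner_vec_def tensor_vec_axis_nth by (intro sum.cong refl) auto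
  then show ?thesis by simp
qed

lemma norm_tensor_vec: "norm (tensor_vec u v) = norm u * norm v"
  by (simp add: tensor_vec_def norm_vec_def L2_set_left_distrib)

lemma tcoeff_eq: "tcoeff T i v k w = inner v (blinfun_apply T (tensor_vec (axis k 1) w) $ i)"
  by (simp add: tcoeff_def inner_tensor_vec_axis)

text \<open>The sum of the diagonal blocks of \<open>T\<close>, seen as a matrix of operators. It
  involves no basis of the second factor, so linearity and norm bounds are immediate;
  \<open>factor2_eq\<close> identifies it with \<open>ptrace1\<close>.\<close>

lift_definition partial_trace1 :: "(('b::real_inner ^ 's) \<Rightarrow>\<^sub>L ('b ^ 's)) \<Rightarrow> ('b \<Rightarrow>\<^sub>L 'b)" is
  "\<lambda>T z. \<Sum>i\<in>UNIV. T (tensor_vec (axis i 1) z) $ i"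
  by (intro bounded_linear_sum bounded_linear_compose[OF bounded_linear_vec_nth]
      bounded_linear_compose[OF _ bounded_linear_tensor_vec])

lemma partial_trace1_diff: "partial_trace1 (S - T) = partial_trace1 S - partial_trace1 T"
  by (rule blinfun_eqI) (simp add: partial_trace1.rep_eq blinfun.diff_left sum_subtractf)

text \<open>A diagonal block is \<open>T\<close> preceded by an isometric embedding and followed by
  a coordinate projection, neither of which increases the norm. The factor counts the
  blocks.\<close>

lemma hs_partial_trace1:
  fixes T :: "('b::{real_inner,second_countable_topology} ^ 's) \<Rightarrow>\<^sub>L ('b ^ 's)"
  assumes "hs T"
  shows "hs (partial_trace1 T)" "hs_norm (partial_trace1 T) \<le> real CARD('s) * hs_norm T"
proof -
  have "L2_set (\<lambda>e. norm (blinfun_apply (partial_trace1 T) e)) F \<le> real CARD('s) * hs_norm T"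
    if F: "finite F" "F \<subseteq> some_onb" for F
  proof -
    have "L2_set (\<lambda>e. norm (blinfun_apply (partial_trace1 T) e)) F
        \<le> L2_set (\<lambda>e. \<Sum>i\<in>UNIV. norm (blinfun_apply T (tensor_vec (axis i 1) e))) F"
      by (intro L2_set_mono)
        (auto simp: partial_trace1.rep_eq intro!: order_trans[OF norm_sum] sum_mono Finite_Cartesian_Product.norm_nth_le)
    also have "\<dots> \<le> (\<Sum>i\<in>(UNIV :: 's set). L2_set (\<lambda>e. norm (blinfun_apply T (tensor_vec (axis i 1) e))) F)"
      by (rule L2_set_sum_triangle) simp
    also have "\<dots> \<le> (\<Sum>i\<in>(UNIV :: 's set). hs_norm T)"
      by (intro sum_mono hs_contraction assms F orthonormal_onb[OF onb_some_onb] bounded_linear_tensor_vec)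
        (simp add: norm_tensor_vec norm_axis_1)
    finally show ?thesis by simp
  qed
  from hsI[OF _ this] show "hs (partial_trace1 T)" "hs_norm (partial_trace1 T) \<le> real CARD('s) * hs_norm T"
    by (auto simp: hs_norm_nonneg)
qed

text \<open>The sum defining \<open>ptrace1\<close> has exactly the coefficients of
  \<open>partial_trace1 T\<close>, and a Hilbert--Schmidt operator is the sum of its
  expansion.\<close>

lemma factor2_eq:
  fixes T :: "('b::{real_inner,second_countable_topology} ^ 's) \<Rightarrow>\<^sub>L ('b ^ 's)"
  assumes "hs T"
  shows "factor2 T = partial_trace1 T"
proof -
  have "(\<lambda>(v,w). inner v (blinfun_apply (partial_trace1 T) w) *\<^sub>R outer v w)
      = (\<lambda>(v,w). (\<Sum>i\<in>UNIV. tcoeff T i v i w) *\<^sub>R outer v w)"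
    by (simp add: fun_eq_iff tcoeff_eq partial_trace1.rep_eq inner_sum_right)
  with hs_has_sum_outer[OF hs_partial_trace1(1)[OF assms]] show ?thesis
    by (simp add: factor2_def ptrace1_def infsumI)
qed

text \<open>The trace of the block in row \<open>i\<close> and column \<open>k\<close>; by
  \<open>ptrace2_axis\<close> it is an entry of the matrix of \<open>ptrace2 T\<close>.\<close>

definition ptcoeff :: "(('b::real_inner ^ 's) \<Rightarrow>\<^sub>L ('b ^ 's)) \<Rightarrow> 's \<Rightarrow> 's \<Rightarrow> real" where
  "ptcoeff T i k = (\<Sum>\<^sub>\<infinity>v\<in>some_onb. tcoeff T i v k v)"

lemma ptrace2_axis: "blinfun_apply (ptrace2 T) (axis k 1) $ i = ptcoeff T i k"
proof -
  have ax: "axis j (1::real) $ i = (if j = i then 1 else 0)" for j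
    by (simp add: axis_def)
  have "blinfun_apply (ptrace2 T) (axis k 1) $ i = (\<Sum>i'\<in>UNIV. \<Sum>k'\<in>UNIV.
      ptcoeff T i' k' * (inner (axis k' (1::real)) (axis k 1) * axis i' (1::real) $ i))"
    unfolding ptrace2_def ptcoeff_def[symmetric]
    by (simp add: blinfun.sum_left blinfun.scaleR_left outer_apply mult.assoc)
  also have "\<dots> = (\<Sum>i'\<in>UNIV. \<Sum>k'\<in>UNIV. if k' = k then if i' = i then ptcoeff T i k else 0 else 0)"
    by (intro sum.cong refl) (auto simp: inner_axis_axis ax)
  also have "\<dots> = ptcoeff T i k" by simp
  finally show ?thesis .
qed

lemma factor1_axis:
  "blinfun_apply (factor1 T) (axis k 1) $ i = ptcoeff T i k / op_trace T"
  by (simp add: factor1_def blinfun.scaleR_left ptrace2_axis)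

lemma tensor_op_diff_left: "tensor_op (A - B) D = tensor_op A D - tensor_op B D"
  by (rule blinfun_eqI)
    (simp add: tensor_op.rep_eq blinfun.diff_left tensor_vec_def vec_eq_iff scaleR_diff_left sum_subtractf)

lemma tensor_op_diff_right: "tensor_op A (B - D) = tensor_op A B - tensor_op A D"
  by (rule blinfun_eqI)
    (simp add: tensor_op.rep_eq blinfun.diff_left tensor_vec_def vec_eq_iff scaleR_diff_right sum_subtractf)

text \<open>The columns of \<open>A\<close> are added up by the triangle inequality. The bound is
  weaker than the product of the two Hilbert--Schmidt norms, but it can be proved in any basis of
  the product space, since coordinate projections are contractions.\<close>

lemma hs_tensor_op:
  fixes A :: "(real ^ 's) \<Rightarrow>\<^sub>L (real ^ 's)" and B :: "'b::{real_inner,second_countable_topology} \<Rightarrow>\<^sub>L 'b"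
  assumes "hs B"
  shows "hs (tensor_op A B)"
    "hs_norm (tensor_op A B) \<le> (\<Sum>k\<in>UNIV. norm (blinfun_apply A (axis k 1))) * hs_norm B"
proof -
  have "L2_set (\<lambda>e. norm (blinfun_apply (tensor_op A B) e)) F
      \<le> (\<Sum>k\<in>UNIV. norm (blinfun_apply A (axis k 1))) * hs_norm B"
    if F: "finite F" "F \<subseteq> some_onb" for F
  proof -
    have "L2_set (\<lambda>e. norm (blinfun_apply (tensor_op A B) e)) F
        \<le> L2_set (\<lambda>e. \<Sum>k\<in>UNIV. norm (blinfun_apply A (axis k 1)) * norm (blinfun_apply B (e $ k))) F"
      by (intro L2_set_mono)
        (auto simp: tensor_op.rep_eq norm_tensor_vec[symmetric] intro!: norm_sum)
    also have "\<dots> \<le> (\<Sum>k\<in>UNIV. L2_set (\<lambda>e. norm (blinfun_apply A (axis k 1)) * norm (blinfun_apply B (e $ k))) F)"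
      by (rule L2_set_sum_triangle) simp
    also have "\<dots> \<le> (\<Sum>k\<in>UNIV. norm (blinfun_apply A (axis k 1)) * hs_norm B)"
      unfolding L2_set_right_distrib[OF norm_ge_zero, symmetric]
      by (intro sum_mono mult_left_mono hs_contraction assms F orthonormal_onb[OF onb_some_onb]
          bounded_linear_vec_nth Finite_Cartesian_Product.norm_nth_le norm_ge_zero)
    finally show ?thesis by (simp add: sum_distrib_right)
  qed
  from hsI[OF _ this] show "hs (tensor_op A B)"
    "hs_norm (tensor_op A B) \<le> (\<Sum>k\<in>UNIV. norm (blinfun_apply A (axis k 1))) * hs_norm B"
    by (auto simp: hs_norm_nonneg sum_nonneg)
qed

section \<open>Stability of the deviation from separability\<close>

definition deviation :: "(('b::real_inner ^ 's) \<Rightarrow>\<^sub>L ('b ^ 's)) \<Rightarrow> (('b ^ 's) \<Rightarrow>\<^sub>L ('b ^ 's))" where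
  "deviation T = tensor_op (factor1 T) (factor2 T) - T"

lemma hs_deviation:
  fixes T :: "('b::{real_inner,second_countable_topology} ^ 's) \<Rightarrow>\<^sub>L ('b ^ 's)"
  assumes "hs T"
  shows "hs (deviation T)"
  unfolding deviation_def factor2_eq[OF assms]
  by (intro hs_diff(1) hs_tensor_op(1) hs_partial_trace1(1) assms)

text \<open>The quotient rule with the denominator kept away from zero:
  \<open>\<bar>s * t\<bar>\<close> is at least \<open>t\<^sup>2 / 2\<close>. In the application
  \<open>s\<close> and \<open>t\<close> are traces, sums of \<open>n\<close> entries, whence the
  error \<open>n * q\<close>.\<close>

lemma divide_diff_bound:
  fixes a b s t q P :: real
  assumes "\<bar>a - b\<bar> \<le> q" "\<bar>s - t\<bar> \<le> n * q" "\<bar>b\<bar> \<le> P" "\<bar>t\<bar> / 2 \<le> \<bar>s\<bar>" "t \<noteq> 0" "0 \<le> n" "0 \<le> q"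
  shows "\<bar>a / s - b / t\<bar> \<le> q * ((\<bar>t\<bar> + P * n) * 2 / t\<^sup>2)"
proof -
  have s: "s \<noteq> 0" "\<bar>s\<bar> > 0" using assms by auto
  have "a / s - b / t = ((a - b) * t - b * (s - t)) / (s * t)"
    using s assms(5) by (simp add: field_simps)
  then have "\<bar>a / s - b / t\<bar> = \<bar>(a - b) * t - b * (s - t)\<bar> / (\<bar>s\<bar> * \<bar>t\<bar>)"
    by (simp add: abs_mult abs_divide)
  also have "\<dots> \<le> (q * \<bar>t\<bar> + P * (n * q)) / ((\<bar>t\<bar> / 2) * \<bar>t\<bar>)"
  proof (rule frac_le)
    have "\<bar>(a - b) * t - b * (s - t)\<bar> \<le> \<bar>a - b\<bar> * \<bar>t\<bar> + \<bar>b\<bar> * \<bar>s - t\<bar>"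
      unfolding abs_mult[symmetric] by (rule abs_triangle_ineq4)
    also have "\<dots> \<le> q * \<bar>t\<bar> + P * (n * q)"
      using assms by (intro add_mono mult_mono) auto
    finally show "\<bar>(a - b) * t - b * (s - t)\<bar> \<le> q * \<bar>t\<bar> + P * (n * q)" .
    show "0 < \<bar>t\<bar> / 2 * \<bar>t\<bar>" using assms(5) by (intro mult_pos_pos) auto
    show "\<bar>t\<bar> / 2 * \<bar>t\<bar> \<le> \<bar>s\<bar> * \<bar>t\<bar>" by (rule mult_right_mono[OF assms(4)]) simp
  qed (use assms in \<open>auto intro!: add_nonneg_nonneg mult_nonneg_nonneg\<close>)
  also have "\<dots> = q * ((\<bar>t\<bar> + P * n) * 2 / t\<^sup>2)"
    by (simp add: power2_eq_square field_simps)
  finally show ?thesis .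
qed

text \<open>Hilbert--Schmidt closeness controls the second factor, closeness of the block traces the
  first. The trace identity is a hypothesis on \<open>T\<close> because its two sides are infinite
  sums in different bases, which have a default value when they diverge.\<close>

lemma deviation_lipschitz:
  fixes C :: "('b::{real_inner,second_countable_topology} ^ 's) \<Rightarrow>\<^sub>L ('b ^ 's)"
  assumes C: "hs C" "op_trace C = (\<Sum>i\<in>UNIV. ptcoeff C i i)" "op_trace C \<noteq> 0"
  shows "\<exists>K q0. q0 > 0 \<and> K \<ge> 0 \<and> (\<forall>T q. 0 \<le> q \<longrightarrow> q \<le> q0 \<longrightarrow> hs (T - C) \<longrightarrow> hs_norm (T - C) \<le> q \<longrightarrow>
    op_trace T = (\<Sum>i\<in>UNIV. ptcoeff T i i) \<longrightarrow> (\<forall>i k. \<bar>ptcoeff T i k - ptcoeff C i k\<bar> \<le> q) \<longrightarrow>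
    hs (deviation T - deviation C) \<and> hs_norm (deviation T - deviation C) \<le> K * q)"
proof -
  define n where "n = real CARD('s)"
  define P where "P = (\<Sum>i\<in>UNIV. \<Sum>k\<in>UNIV. \<bar>ptcoeff C i k\<bar>)"
  define t where "t = op_trace C"
  define K1 where "K1 = (\<bar>t\<bar> + P * n) * 2 / t\<^sup>2"
  define f where "f = (\<Sum>k\<in>UNIV. norm (blinfun_apply (factor1 C) (axis k 1)))"
  \<comment> \<open>The three terms belong to the summands \<open>?A\<close>, \<open>?B\<close> and
    \<open>T - C\<close> of the decomposition \<open>eq\<close> below.\<close>
  define K where "K = n * (n * K1) * (n * (hs_norm C + 1)) + f * n + 1"
  \<comment> \<open>The bound 1 gives \<open>hs_norm T \<le> hs_norm C + 1\<close>. The other keeps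
    the trace of \<open>T\<close> at least half as large as that of \<open>C\<close>, as the trace
    error is at most \<open>n * q\<close>.\<close>
  define q0 where "q0 = min 1 (\<bar>t\<bar> / (2 * n))"
  have n: "n > 0" by (simp add: n_def)
  have P: "\<bar>ptcoeff C i k\<bar> \<le> P" for i k
  proof -
    have "\<bar>ptcoeff C i k\<bar> \<le> (\<Sum>k\<in>UNIV. \<bar>ptcoeff C i k\<bar>)"
      by (rule member_le_sum) auto
    also have "\<dots> \<le> P"
      unfolding P_def by (rule member_le_sum) (auto intro!: sum_nonneg)
    finally show ?thesis .
  qed
  have P0: "P \<ge> 0" using P abs_ge_zero by (rule order_trans[rotated])
  have K1: "K1 \<ge> 0" using P0 n by (simp add: K1_def)
  have f: "f \<ge> 0" by (simp add: f_def sum_nonneg)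
  have K: "K \<ge> 0" using n K1 f hs_norm_nonneg[of C] by (simp add: K_def)
  have q0: "q0 > 0" using n C(3) by (simp add: q0_def t_def)
  show ?thesis
  proof (rule exI[of _ K], rule exI[of _ q0], intro conjI allI impI q0 K)
    fix T :: "('b ^ 's) \<Rightarrow>\<^sub>L ('b ^ 's)" and q
    assume q: "0 \<le> q" "q \<le> q0" and TC: "hs (T - C)" "hs_norm (T - C) \<le> q"
      and tr: "op_trace T = (\<Sum>i\<in>UNIV. ptcoeff T i i)"
      and pt: "\<forall>i k. \<bar>ptcoeff T i k - ptcoeff C i k\<bar> \<le> q"
    have T: "hs T" "hs_norm T \<le> hs_norm C + 1"
      using hs_add[OF TC(1) C(1)] TC(2) q unfolding q0_def by auto
    have "\<bar>op_trace T - t\<bar> \<le> (\<Sum>i\<in>(UNIV::'s set). q)"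
      unfolding t_def C(2) tr sum_subtractf[symmetric]
      by (rule order_trans[OF sum_abs]) (intro sum_mono pt[rule_format])
    then have dt: "\<bar>op_trace T - t\<bar> \<le> n * q" by (simp add: n_def)
    have "n * q \<le> n * (\<bar>t\<bar> / (2 * n))"
      using n q by (intro mult_left_mono) (auto simp: q0_def)
    then have t2: "\<bar>t\<bar> / 2 \<le> \<bar>op_trace T\<bar>" using dt n by (simp add: abs_if split: if_splits)
    have ent: "\<bar>blinfun_apply (factor1 T - factor1 C) (axis k 1) $ i\<bar> \<le> q * K1" for i k
      unfolding blinfun.diff_left vector_minus_component factor1_axis K1_def t_def[symmetric]
      using pt P dt t2 C(3) n q(1) by (intro divide_diff_bound) (auto simp: t_def)
    have "norm (blinfun_apply (factor1 T - factor1 C) (axis k 1)) \<le> n * (q * K1)" for k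
    proof -
      have "norm (blinfun_apply (factor1 T - factor1 C) (axis k 1)) \<le> (\<Sum>i\<in>(UNIV::'s set). q * K1)"
        by (rule order_trans[OF norm_le_l1_cart]) (intro sum_mono ent)
      then show ?thesis by (simp add: n_def)
    qed
    then have "(\<Sum>k\<in>UNIV. norm (blinfun_apply (factor1 T - factor1 C) (axis k 1))) \<le> (\<Sum>k\<in>(UNIV::'s set). n * (q * K1))"
      by (intro sum_mono) auto
    then have F: "(\<Sum>k\<in>UNIV. norm (blinfun_apply (factor1 T - factor1 C) (axis k 1))) \<le> n * (n * (q * K1))"
      by (simp add: n_def)
    let ?A = "tensor_op (factor1 T - factor1 C) (partial_trace1 T)"
    let ?B = "tensor_op (factor1 C) (partial_trace1 (T - C))"
    have A: "hs ?A" "hs_norm ?A \<le> n * (n * (q * K1)) * (n * (hs_norm C + 1))"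
    proof -
      note h = hs_partial_trace1[OF T(1)]
      show "hs ?A" by (rule hs_tensor_op h)+
      have "hs_norm ?A \<le> n * (n * (q * K1)) * hs_norm (partial_trace1 T)"
        by (rule order_trans[OF hs_tensor_op(2)[OF h(1)] mult_right_mono[OF F hs_norm_nonneg]])
      also have "\<dots> \<le> n * (n * (q * K1)) * (n * (hs_norm C + 1))"
        using h(2) T(2) n q K1 unfolding n_def[symmetric]
        by (intro mult_left_mono) (auto intro: order_trans mult_left_mono)
      finally show "hs_norm ?A \<le> n * (n * (q * K1)) * (n * (hs_norm C + 1))" .
    qed
    have B: "hs ?B" "hs_norm ?B \<le> f * (n * q)"
    proof -
      note h = hs_partial_trace1[OF TC(1)]
      show "hs ?B" by (rule hs_tensor_op h)+
      have "hs_norm ?B \<le> f * hs_norm (partial_trace1 (T - C))"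
        unfolding f_def by (rule hs_tensor_op(2)[OF h(1)])
      also have "\<dots> \<le> f * (n * q)"
        using h(2) TC(2) n f unfolding n_def[symmetric]
        by (intro mult_left_mono) (auto intro: order_trans mult_left_mono)
      finally show "hs_norm ?B \<le> f * (n * q)" .
    qed
    \<comment> \<open>One factor of the tensor product is replaced at a time, as in the product
      rule.\<close>
    have eq: "deviation T - deviation C = ?A + ?B - (T - C)"
      by (simp add: deviation_def factor2_eq T(1) C(1) partial_trace1_diff tensor_op_diff_left tensor_op_diff_right)
    note AB = hs_add[OF A(1) B(1)]
    show "hs (deviation T - deviation C)"
      unfolding eq by (rule hs_diff(1)[OF AB(1) TC(1)])
    have "hs_norm (deviation T - deviation C) \<le> n * (n * (q * K1)) * (n * (hs_norm C + 1)) + f * (n * q) + q"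
      unfolding eq using hs_diff(2)[OF AB(1) TC(1)] AB(2) A(2) B(2) TC(2) by linarith
    also have "\<dots> = K * q" by (simp add: K_def algebra_simps)
    finally show "hs_norm (deviation T - deviation C) \<le> K * q" .
  qed
qed

section \<open>Coupling an approximable sequence with its truncations\<close>

context prob_space
begin

lemma indep_vars_imp_indep_var:
  assumes "indep_vars N X I" "i \<in> I" "j \<in> I" "i \<noteq> j"
  shows "indep_var (N i) (X i) (N j) (X j)"
proof -
  have "indep_var (N i) ((\<lambda>g. g i) \<circ> (\<lambda>\<omega>. restrict (\<lambda>k. X k \<omega>) {i}))
      (N j) ((\<lambda>g. g j) \<circ> (\<lambda>\<omega>. restrict (\<lambda>k. X k \<omega>) {j}))"
    using assms by (intro indep_var_compose[OF indep_var_restrict[OF assms(1)]] measurable_component_singleton) auto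
  then show ?thesis by (simp add: o_def)
qed

text \<open>Given \<open>v = b\<close>, the joint probability factors by hypothesis, and the factor
  from \<open>A\<close> does not depend on \<open>b\<close>; Fubini integrates over
  \<open>b\<close>. This reduces a statement on three independent pieces (past, future, copy) to one
  on past and future alone.\<close>

lemma indep_var_frozen:
  assumes uv: "indep_var N u N' v" and A [measurable]: "A \<in> measurable N S"
    and B [measurable]: "B \<in> measurable (N \<Otimes>\<^sub>M N') T"
    and fr: "\<And>b. b \<in> space N' \<Longrightarrow> indep_var S (\<lambda>\<omega>. A (u \<omega>)) T (\<lambda>\<omega>. B (u \<omega>, b))"
  shows "indep_var S (\<lambda>\<omega>. A (u \<omega>)) T (\<lambda>\<omega>. B (u \<omega>, v \<omega>))"
proof -
  have [measurable]: "random_variable N u" "random_variable N' v"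
    using indep_var_rv1[OF uv] indep_var_rv2[OF uv] .
  have law: "distr M (N \<Otimes>\<^sub>M N') (\<lambda>\<omega>. (u \<omega>, v \<omega>)) = distr M N u \<Otimes>\<^sub>M distr M N' v"
    using uv by (simp add: indep_var_distribution_eq)
  interpret U: prob_space "distr M N u" by (rule prob_space_distr) measurable
  interpret V: prob_space "distr M N' v" by (rule prob_space_distr) measurable
  interpret UV: pair_prob_space "distr M N u" "distr M N' v" ..
  interpret SA: prob_space "distr M S (\<lambda>\<omega>. A (u \<omega>))" by (rule prob_space_distr) measurable
  interpret TB: prob_space "distr M T (\<lambda>\<omega>. B (u \<omega>, v \<omega>))" by (rule prob_space_distr) measurable
  have "distr M S (\<lambda>\<omega>. A (u \<omega>)) \<Otimes>\<^sub>M distr M T (\<lambda>\<omega>. B (u \<omega>, v \<omega>))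
      = distr M (S \<Otimes>\<^sub>M T) (\<lambda>\<omega>. (A (u \<omega>), B (u \<omega>, v \<omega>)))"
  proof (rule pair_measure_eqI)
    show "sigma_finite_measure (distr M S (\<lambda>\<omega>. A (u \<omega>)))" ..
    show "sigma_finite_measure (distr M T (\<lambda>\<omega>. B (u \<omega>, v \<omega>)))" ..
    fix a b assume "a \<in> sets (distr M S (\<lambda>\<omega>. A (u \<omega>)))" "b \<in> sets (distr M T (\<lambda>\<omega>. B (u \<omega>, v \<omega>)))"
    then have [measurable]: "a \<in> sets S" "b \<in> sets T" by auto
    have frozen: "(\<integral>\<^sup>+\<omega>. indicator a (A (u \<omega>)) * indicator b (B (u \<omega>, y)) \<partial>M)
        = (\<integral>\<^sup>+\<omega>. indicator a (A (u \<omega>)) \<partial>M) * (\<integral>\<^sup>+\<omega>. indicator b (B (u \<omega>, y)) \<partial>M)"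
      if y: "y \<in> space N'" for y
    proof -
      have [measurable]: "(\<lambda>\<omega>. B (u \<omega>, y)) \<in> measurable M T"
        using indep_var_rv2[OF fr[OF y]] .
      have "(\<integral>\<^sup>+\<omega>. indicator a (A (u \<omega>)) * indicator b (B (u \<omega>, y)) \<partial>M)
          = (\<integral>\<^sup>+\<omega>. indicator ((\<lambda>\<omega>. (A (u \<omega>), B (u \<omega>, y))) -` (a \<times> b) \<inter> space M) \<omega> \<partial>M)"
        by (intro nn_integral_cong) (auto simp: indicator_def)
      also have "\<dots> = emeasure M ((\<lambda>\<omega>. (A (u \<omega>), B (u \<omega>, y))) -` (a \<times> b) \<inter> space M)"
        by (intro nn_integral_indicator) measurable
      also have "\<dots> = emeasure M ((\<lambda>\<omega>. A (u \<omega>)) -` a \<inter> space M) * emeasure M ((\<lambda>\<omega>. B (u \<omega>, y)) -` b \<inter> space M)"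
        using indep_varD[OF fr[OF y], of a b]
        by (simp add: emeasure_eq_measure ennreal_mult measure_nonneg)
      also have "emeasure M ((\<lambda>\<omega>. A (u \<omega>)) -` a \<inter> space M) = (\<integral>\<^sup>+\<omega>. indicator ((\<lambda>\<omega>. A (u \<omega>)) -` a \<inter> space M) \<omega> \<partial>M)"
        by (intro nn_integral_indicator[symmetric]) measurable
      also have "\<dots> = (\<integral>\<^sup>+\<omega>. indicator a (A (u \<omega>)) \<partial>M)"
        by (intro nn_integral_cong) (auto simp: indicator_def)
      also have "emeasure M ((\<lambda>\<omega>. B (u \<omega>, y)) -` b \<inter> space M) = (\<integral>\<^sup>+\<omega>. indicator ((\<lambda>\<omega>. B (u \<omega>, y)) -` b \<inter> space M) \<omega> \<partial>M)"
        by (intro nn_integral_indicator[symmetric]) measurable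
      also have "\<dots> = (\<integral>\<^sup>+\<omega>. indicator b (B (u \<omega>, y)) \<partial>M)"
        by (intro nn_integral_cong) (auto simp: indicator_def)
      finally show ?thesis .
    qed
    \<comment> \<open>Tonelli with \<open>v\<close> integrated last; here the independence of
      \<open>u\<close> and \<open>v\<close> enters, through the product law.\<close>
    have tr: "(\<integral>\<^sup>+\<omega>. f (u \<omega>, v \<omega>) \<partial>M) = (\<integral>\<^sup>+y. \<integral>\<^sup>+\<omega>. f (u \<omega>, y) \<partial>M \<partial>distr M N' v)"
      if f [measurable]: "f \<in> borel_measurable (N \<Otimes>\<^sub>M N')" for f :: "_ \<Rightarrow> ennreal"
    proof -
      have "(\<integral>\<^sup>+\<omega>. f (u \<omega>, v \<omega>) \<partial>M) = (\<integral>\<^sup>+p. f p \<partial>(distr M N u \<Otimes>\<^sub>M distr M N' v))"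
        unfolding law[symmetric] by (subst nn_integral_distr) auto
      also have "\<dots> = (\<integral>\<^sup>+y. \<integral>\<^sup>+x. f (x, y) \<partial>distr M N u \<partial>distr M N' v)"
        by (intro UV.nn_integral_snd[symmetric]) measurable
      also have "\<dots> = (\<integral>\<^sup>+y. \<integral>\<^sup>+\<omega>. f (u \<omega>, y) \<partial>M \<partial>distr M N' v)"
        by (intro nn_integral_cong nn_integral_distr) auto
      finally show ?thesis .
    qed
    have "emeasure (distr M (S \<Otimes>\<^sub>M T) (\<lambda>\<omega>. (A (u \<omega>), B (u \<omega>, v \<omega>)))) (a \<times> b)
        = (\<integral>\<^sup>+p. indicator (a \<times> b) p \<partial>distr M (S \<Otimes>\<^sub>M T) (\<lambda>\<omega>. (A (u \<omega>), B (u \<omega>, v \<omega>))))"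
      by (intro nn_integral_indicator[symmetric]) measurable
    also have "\<dots> = (\<integral>\<^sup>+\<omega>. indicator (a \<times> b) (A (u \<omega>), B (u \<omega>, v \<omega>)) \<partial>M)"
      by (intro nn_integral_distr) measurable
    also have "\<dots> = (\<integral>\<^sup>+\<omega>. indicator a (A (u \<omega>)) * indicator b (B (u \<omega>, v \<omega>)) \<partial>M)"
      by (intro nn_integral_cong) (auto simp: indicator_def)
    also have "\<dots> = (\<integral>\<^sup>+y. \<integral>\<^sup>+\<omega>. indicator a (A (u \<omega>)) * indicator b (B (u \<omega>, y)) \<partial>M \<partial>distr M N' v)"
      using tr[of "\<lambda>p. indicator a (A (fst p)) * indicator b (B p)"] by simp
    also have "\<dots> = (\<integral>\<^sup>+y. (\<integral>\<^sup>+\<omega>. indicator a (A (u \<omega>)) \<partial>M) * (\<integral>\<^sup>+\<omega>. indicator b (B (u \<omega>, y)) \<partial>M) \<partial>distr M N' v)"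
      by (intro nn_integral_cong frozen) simp
    also have "\<dots> = (\<integral>\<^sup>+\<omega>. indicator a (A (u \<omega>)) \<partial>M) * (\<integral>\<^sup>+y. \<integral>\<^sup>+\<omega>. indicator b (B (u \<omega>, y)) \<partial>M \<partial>distr M N' v)"
      by (intro nn_integral_cmult) measurable
    also have "(\<integral>\<^sup>+y. \<integral>\<^sup>+\<omega>. indicator b (B (u \<omega>, y)) \<partial>M \<partial>distr M N' v) = (\<integral>\<^sup>+\<omega>. indicator b (B (u \<omega>, v \<omega>)) \<partial>M)"
      using tr[of "\<lambda>p. indicator b (B p)"] by simp
    also have "(\<integral>\<^sup>+\<omega>. indicator b (B (u \<omega>, v \<omega>)) \<partial>M) = (\<integral>\<^sup>+x. indicator b x \<partial>distr M T (\<lambda>\<omega>. B (u \<omega>, v \<omega>)))"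
      by (intro nn_integral_distr[symmetric]) measurable
    also have "(\<integral>\<^sup>+\<omega>. indicator a (A (u \<omega>)) \<partial>M) = (\<integral>\<^sup>+x. indicator a x \<partial>distr M S (\<lambda>\<omega>. A (u \<omega>)))"
      by (intro nn_integral_distr[symmetric]) measurable
    finally show "emeasure (distr M S (\<lambda>\<omega>. A (u \<omega>))) a * emeasure (distr M T (\<lambda>\<omega>. B (u \<omega>, v \<omega>))) b
        = emeasure (distr M (S \<Otimes>\<^sub>M T) (\<lambda>\<omega>. (A (u \<omega>), B (u \<omega>, v \<omega>)))) (a \<times> b)"
      by simp
  qed simp
  then show ?thesis
    unfolding indep_var_distribution_eq by simp
qed

text \<open>The law of the sequence is a product of identical factors, which a translation of the
  index set leaves unchanged.\<close>

lemma iid_shift: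
  fixes u :: "int \<Rightarrow> 'a \<Rightarrow> 'u"
  assumes u: "indep_vars (\<lambda>_. U) u UNIV" and id: "\<And>k. distr M U (u k) = distr M U (u 0)"
  shows "distr M (\<Pi>\<^sub>M k\<in>UNIV. U) (\<lambda>\<omega> k. u (k + n) \<omega>) = distr M (\<Pi>\<^sub>M k\<in>UNIV. U) (\<lambda>\<omega> k. u k \<omega>)"
proof -
  have rv [measurable]: "random_variable U (u k)" for k
    using u by (auto simp: indep_vars_def)
  have law: "distr M (\<Pi>\<^sub>M k\<in>UNIV. U) (\<lambda>\<omega> k. u k \<omega>) = (\<Pi>\<^sub>M k\<in>UNIV. distr M U (u 0))"
  proof -
    have "distr M (\<Pi>\<^sub>M k\<in>UNIV. U) (\<lambda>\<omega>. \<lambda>k\<in>UNIV. u k \<omega>) = (\<Pi>\<^sub>M k\<in>UNIV. distr M U (u k))"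
      using indep_vars_iff_distr_eq_PiM[where I = UNIV and X = u and M' = "\<lambda>_. U"] u rv by simp
    also have "\<dots> = (\<Pi>\<^sub>M k\<in>UNIV. distr M U (u 0))"
      by (rule PiM_cong[OF refl id])
    finally show ?thesis by (simp add: restrict_UNIV)
  qed
  interpret Q: prob_space "distr M U (u 0)" by (rule prob_space_distr) measurable
  have sets: "sets (\<Pi>\<^sub>M k\<in>(UNIV::int set). distr M U (u 0)) = sets (\<Pi>\<^sub>M k\<in>UNIV. U)"
    by (rule sets_PiM_cong) auto
  have mu [measurable]: "(\<lambda>\<omega> k. u k \<omega>) \<in> measurable M (\<Pi>\<^sub>M k\<in>UNIV. U)"
    by (rule measurable_PiM_single') (auto dest: measurable_space[OF rv])
  have ms [measurable]: "(\<lambda>a k. a (k + n)) \<in> measurable (\<Pi>\<^sub>M k\<in>(UNIV::int set). U) (\<Pi>\<^sub>M k\<in>UNIV. U)"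
    by (rule measurable_PiM_single') (auto simp: space_PiM PiE_def Pi_def)
  have "distr M (\<Pi>\<^sub>M k\<in>UNIV. U) (\<lambda>\<omega> k. u (k + n) \<omega>)
      = distr (distr M (\<Pi>\<^sub>M k\<in>UNIV. U) (\<lambda>\<omega> k. u k \<omega>)) (\<Pi>\<^sub>M k\<in>UNIV. U) (\<lambda>a k. a (k + n))"
    by (subst distr_distr) (auto simp: o_def)
  also have "\<dots> = distr (\<Pi>\<^sub>M k\<in>UNIV. distr M U (u 0)) (\<Pi>\<^sub>M k\<in>UNIV. distr M U (u 0)) (\<lambda>a. \<lambda>k\<in>UNIV. a (k + n))"
    unfolding law by (rule distr_cong) (auto simp: sets)
  also have "\<dots> = (\<Pi>\<^sub>M k\<in>UNIV. distr M U (u 0))"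
    by (rule distr_PiM_reindex[where f = "\<lambda>k. k + n"]) (auto intro: Q.prob_space_axioms)
  finally show ?thesis unfolding law .
qed

end

text \<open>What the variance estimate uses of approximability. \<open>W n m\<close> stands for the
  truncation of \<open>X n\<close> after lag \<open>m\<close>, with older innovations taken from a
  copy; \<open>s\<close> bounds the fourth-moment norms and \<open>d m\<close> the truncation
  errors. Both bounds are positive so that they can be divided out. Laws are compared for pairs,
  because each term of the estimator depends on a pair.\<close>

locale decoupled = prob_space M for M :: "'w measure" +
  fixes X :: "int \<Rightarrow> 'w \<Rightarrow> 'h::{real_inner,banach,second_countable_topology}"
    and W :: "int \<Rightarrow> nat \<Rightarrow> 'w \<Rightarrow> 'h" and s :: real and d :: "nat \<Rightarrow> real"
  assumes X_measurable [measurable]: "X n \<in> borel_measurable M"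
    and W_measurable [measurable]: "W n m \<in> borel_measurable M"
    and s_pos: "0 < s" and d_pos: "0 < d m" and d_summable: "summable d"
    and X_integrable: "integrable M (\<lambda>\<omega>. norm (X n \<omega>) ^ 4)"
    and X_moment: "(\<integral>\<omega>. norm (X n \<omega>) ^ 4 \<partial>M) \<le> s ^ 4"
    and W_integrable: "1 \<le> m \<Longrightarrow> integrable M (\<lambda>\<omega>. norm (W n m \<omega>) ^ 4)"
    and W_moment: "1 \<le> m \<Longrightarrow> (\<integral>\<omega>. norm (W n m \<omega>) ^ 4 \<partial>M) \<le> s ^ 4"
    and XW_integrable: "1 \<le> m \<Longrightarrow> integrable M (\<lambda>\<omega>. norm (X n \<omega> - W n m \<omega>) ^ 4)"
    and XW_moment: "1 \<le> m \<Longrightarrow> (\<integral>\<omega>. norm (X n \<omega> - W n m \<omega>) ^ 4 \<partial>M) \<le> d m ^ 4"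
    and stationary: "distr M (borel \<Otimes>\<^sub>M borel) (\<lambda>\<omega>. (X n \<omega>, X (n + k) \<omega>)) =
      distr M (borel \<Otimes>\<^sub>M borel) (\<lambda>\<omega>. (X 0 \<omega>, X k \<omega>))"
    and decoupling: "n + int h < n' - int m \<Longrightarrow>
      indep_var (borel \<Otimes>\<^sub>M borel) (\<lambda>\<omega>. (X n \<omega>, X (n + int h) \<omega>))
        (borel \<Otimes>\<^sub>M borel) (\<lambda>\<omega>. (W n' m \<omega>, W (n' + int h) m \<omega>))"

section \<open>From approximability to decoupling\<close>

lemma add_power4_le: "(a + b) ^ 4 \<le> 8 * (a ^ 4 + b ^ 4)" for a b :: real
proof -
  have sq: "(x + y)\<^sup>2 \<le> 2 * (x\<^sup>2 + y\<^sup>2)" for x y :: real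
    using sum_squares_bound[of x y] by (simp add: power2_sum)
  have "(a + b) ^ 4 = ((a + b)\<^sup>2)\<^sup>2" by simp
  also have "\<dots> \<le> (2 * (a\<^sup>2 + b\<^sup>2))\<^sup>2" by (intro power_mono sq) simp
  also have "\<dots> = 4 * (a\<^sup>2 + b\<^sup>2)\<^sup>2" unfolding power_mult_distrib by simp
  also have "\<dots> \<le> 4 * (2 * ((a\<^sup>2)\<^sup>2 + (b\<^sup>2)\<^sup>2))" by (intro mult_left_mono sq) simp
  finally show ?thesis by simp
qed

lemma nu_finiteD:
  assumes "nu M 4 Z < \<infinity>" and [measurable]: "Z \<in> borel_measurable M"
  shows "integrable M (\<lambda>\<omega>. norm (Z \<omega>) ^ 4)"
    "nu M 4 Z = ennreal ((\<integral>\<omega>. norm (Z \<omega>) ^ 4 \<partial>M) powr (1/4))"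
proof -
  have eq: "norm (Z \<omega>) powr 4 = norm (Z \<omega>) ^ 4" for \<omega>
    by (cases "Z \<omega> = 0") (simp_all add: powr_numeral)
  have fin: "(\<integral>\<^sup>+\<omega>. ennreal (norm (Z \<omega>) ^ 4) \<partial>M) < \<infinity>"
    using assms(1) unfolding nu_def Let_def eq by (auto simp: less_top split: if_splits)
  then show i: "integrable M (\<lambda>\<omega>. norm (Z \<omega>) ^ 4)"
    by (intro integrableI_nonneg) auto
  have "(\<integral>\<^sup>+\<omega>. ennreal (norm (Z \<omega>) ^ 4) \<partial>M) = ennreal (\<integral>\<omega>. norm (Z \<omega>) ^ 4 \<partial>M)"
    by (intro nn_integral_eq_integral i) auto
  then show "nu M 4 Z = ennreal ((\<integral>\<omega>. norm (Z \<omega>) ^ 4 \<partial>M) powr (1/4))"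
    unfolding nu_def Let_def eq by simp
qed

text \<open>All truncations are built from the single copy \<open>ustar 0 1\<close>. After any
  shift, \<open>u\<close> together with any of the copies has law
  \<open>P \<Otimes>\<^sub>M P\<close>, so the approximation error depends on the lag only and its
  summability carries over to the new truncations.\<close>

lemma approximable_imp_decoupled:
  fixes M :: "'w measure" and U :: "'u measure"
    and X :: "int \<Rightarrow> 'w \<Rightarrow> 'h::{real_inner,banach,second_countable_topology}"
  assumes "prob_space M" and app: "Lp_m_approximable M U 4 X"
  shows "\<exists>W s d. decoupled M X W s d"
proof -
  interpret prob_space M by fact
  obtain f u ustar where f [measurable]: "f \<in> borel_measurable (\<Pi>\<^sub>M j\<in>(UNIV::nat set). U)"
    and u: "indep_vars (\<lambda>_. U) u UNIV" and id': "\<forall>k. distr M U (u k) = distr M U (u 0)"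
    and X': "\<forall>n. \<forall>\<omega>\<in>space M. X n \<omega> = f (\<lambda>j. u (n - int j) \<omega>)"
    and cop: "independent_copies M U u ustar"
    and sum: "\<forall>n. (\<Sum>i. let m = Suc i in nu M 4 (\<lambda>\<omega>. X n \<omega> -
           f (\<lambda>j. if j \<le> m then u (n - int j) \<omega> else ustar n m (n - int j) \<omega>))) < \<infinity>"
    and nuX': "\<forall>n. nu M 4 (X n) < \<infinity>"
    using app unfolding Lp_m_approximable_def by (elim conjE exE) (rule that)
  note nuX = nuX'[rule_format] and X = X'[rule_format] and id = id'[rule_format]
  let ?PU = "\<Pi>\<^sub>M k\<in>(UNIV::int set). U"
  define P where "P = distr M ?PU (\<lambda>\<omega> k. u k \<omega>)"
  have rv [measurable]: "random_variable U (u k)" for k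
    using u by (auto simp: indep_vars_def)
  have mu [measurable]: "(\<lambda>\<omega> k. u k \<omega>) \<in> measurable M ?PU"
    by (rule measurable_PiM_single') (auto dest: measurable_space[OF rv])
  have shift [measurable]: "(\<lambda>a k. a (k + n)) \<in> measurable ?PU ?PU" for n :: int
    by (rule measurable_PiM_single') (auto simp: space_PiM PiE_def Pi_def)
  have lawu: "distr M ?PU (\<lambda>\<omega> k. u (k + n) \<omega>) = P" for n
    unfolding P_def by (rule iid_shift[OF u id])
  have uv: "indep_var ?PU (\<lambda>\<omega> k. u k \<omega>) ?PU (\<lambda>\<omega> k. ustar n m k \<omega>)" if "m \<ge> 1" for n m
    using indep_vars_imp_indep_var[OF conjunct1[OF cop[unfolded independent_copies_def]], of None "Some (n, m)"] that
    by simp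
  have ms: "(\<lambda>\<omega> k. ustar n m k \<omega>) \<in> measurable M ?PU" if "m \<ge> 1" for n m
    using indep_var_rv2[OF uv[OF that]] .
  have laws: "distr M ?PU (\<lambda>\<omega> k. ustar n m (k + i) \<omega>) = P" if "m \<ge> 1" for n m i
  proof -
    have "distr M ?PU (\<lambda>\<omega> k. ustar n m (k + i) \<omega>)
        = distr (distr M ?PU (\<lambda>\<omega> k. ustar n m k \<omega>)) ?PU (\<lambda>a k. a (k + i))"
      using ms[OF that] by (subst distr_distr) (auto simp: o_def)
    also have "distr M ?PU (\<lambda>\<omega> k. ustar n m k \<omega>) = P"
      using cop that unfolding independent_copies_def P_def by blast
    also have "distr P ?PU (\<lambda>a k. a (k + i)) = P"
      unfolding P_def by (subst distr_distr) (auto simp: o_def lawu[unfolded P_def])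
    finally show ?thesis .
  qed
  have joint: "distr M (?PU \<Otimes>\<^sub>M ?PU) (\<lambda>\<omega>. (\<lambda>k. u (k + i) \<omega>, \<lambda>k. ustar n m (k + i) \<omega>)) = P \<Otimes>\<^sub>M P"
    if "m \<ge> 1" for n m i
  proof -
    have "indep_var ?PU ((\<lambda>a k. a (k + i)) \<circ> (\<lambda>\<omega> k. u k \<omega>)) ?PU ((\<lambda>a k. a (k + i)) \<circ> (\<lambda>\<omega> k. ustar n m k \<omega>))"
      by (intro indep_var_compose[OF uv[OF that]] shift)
    then show ?thesis
      by (simp add: indep_var_distribution_eq o_def lawu laws[OF that])
  qed
  define G where "G m = (\<lambda>(a, b). f (\<lambda>j. a (0 - int j)) - f (\<lambda>j. if j \<le> m then a (0 - int j) else b (0 - int j)))"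
    for m :: nat
  have mix [measurable]: "(\<lambda>p. f (\<lambda>j. if j \<le> m then fst p (i - int j) else snd p (i - int j)))
      \<in> borel_measurable (?PU \<Otimes>\<^sub>M ?PU)" for m i
  proof (rule measurable_compose[OF _ f], rule measurable_PiM_single')
    show "(\<lambda>p. if j \<le> m then fst p (i - int j) else snd p (i - int j)) \<in> measurable (?PU \<Otimes>\<^sub>M ?PU) U" for j
      by (cases "j \<le> m") measurable
  qed (auto simp: space_pair_measure space_PiM PiE_def Pi_def)
  have past [measurable]: "(\<lambda>a. f (\<lambda>j. a (i - int j))) \<in> borel_measurable ?PU" for i
    by (rule measurable_compose[OF _ f], rule measurable_PiM_single') (auto simp: space_PiM PiE_def Pi_def)
  have G [measurable]: "G m \<in> borel_measurable (?PU \<Otimes>\<^sub>M ?PU)" for m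
  proof -
    have "(\<lambda>p. f (\<lambda>j. fst p (0 - int j)) - f (\<lambda>j. if j \<le> m then fst p (0 - int j) else snd p (0 - int j)))
        \<in> borel_measurable (?PU \<Otimes>\<^sub>M ?PU)" by measurable
    then show ?thesis unfolding G_def case_prod_unfold .
  qed
  define g where "g m = (\<integral>\<^sup>+p. ennreal (norm (G m p) powr 4) \<partial>(P \<Otimes>\<^sub>M P))" for m
  \<comment> \<open>The truncation lag \<open>l\<close> and the lag \<open>m\<close> that names the
    copy are kept apart: the hypothesis uses \<open>l = m\<close>, while \<open>W\<close> uses the
    copy with \<open>m = 1\<close> for every \<open>l\<close>.\<close>
  have law_diff: "(\<integral>\<^sup>+\<omega>. ennreal (norm (X n \<omega> - f (\<lambda>j. if j \<le> l then u (n - int j) \<omega> else ustar n' m (n - int j) \<omega>)) powr 4) \<partial>M) = g l"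
    if "m \<ge> 1" for n n' m l
  proof -
    have [measurable]: "(\<lambda>\<omega> k. ustar n' m (k + n) \<omega>) \<in> measurable M ?PU"
      using measurable_compose[OF ms[OF that] shift] .
    have [measurable]: "(\<lambda>\<omega> k. u (k + n) \<omega>) \<in> measurable M ?PU"
      using measurable_compose[OF mu shift] .
    have "g l = (\<integral>\<^sup>+\<omega>. ennreal (norm (G l (\<lambda>k. u (k + n) \<omega>, \<lambda>k. ustar n' m (k + n) \<omega>)) powr 4) \<partial>M)"
      unfolding g_def joint[OF that, of n n', symmetric] by (rule nn_integral_distr) measurable
    also have "\<dots> = (\<integral>\<^sup>+\<omega>. ennreal (norm (X n \<omega> - f (\<lambda>j. if j \<le> l then u (n - int j) \<omega> else ustar n' m (n - int j) \<omega>)) powr 4) \<partial>M)"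
    proof (intro nn_integral_cong)
      fix \<omega> assume "\<omega> \<in> space M"
      have e: "0 - int j + n = n - int j" for j by simp
      show "ennreal (norm (G l (\<lambda>k. u (k + n) \<omega>, \<lambda>k. ustar n' m (k + n) \<omega>)) powr 4) =
          ennreal (norm (X n \<omega> - f (\<lambda>j. if j \<le> l then u (n - int j) \<omega> else ustar n' m (n - int j) \<omega>)) powr 4)"
        unfolding G_def case_prod_conv e X[OF \<open>\<omega> \<in> space M\<close>] ..
    qed
    finally show ?thesis ..
  qed
  define W where "W n m \<omega> = f (\<lambda>j. if j \<le> m then u (n - int j) \<omega> else ustar 0 1 (n - int j) \<omega>)"
    for n m \<omega>
  note ms1 [measurable] = ms[OF order_refl, of 0]
  have Wm [measurable]: "W n m \<in> borel_measurable M" for n m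
  proof -
    have "(\<lambda>\<omega>. (\<lambda>k. u k \<omega>, \<lambda>k. ustar 0 1 k \<omega>)) \<in> measurable M (?PU \<Otimes>\<^sub>M ?PU)" by measurable
    from measurable_compose[OF this mix[of m n]] show ?thesis
      unfolding W_def[abs_def] fst_conv snd_conv .
  qed
  have Xm [measurable]: "X n \<in> borel_measurable M" for n
    using measurable_compose[OF mu past[of n]] by (subst measurable_cong[OF X]) auto
  have nuW: "nu M 4 (\<lambda>\<omega>. X n \<omega> - W n m \<omega>) = nu M 4 (\<lambda>\<omega>. X 0 \<omega> - f (\<lambda>j. if j \<le> m then u (0 - int j) \<omega> else ustar 0 m (0 - int j) \<omega>))"
    if "m \<ge> 1" for n m
    unfolding nu_def W_def law_diff[OF that] law_diff[OF order_refl] by simp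
  define D where "D m = (\<integral>\<omega>. norm (X 0 \<omega> - W 0 m \<omega>) ^ 4 \<partial>M) powr (1/4)" for m
  have sumD: "(\<Sum>i. nu M 4 (\<lambda>\<omega>. X 0 \<omega> - W 0 (Suc i) \<omega>)) < \<infinity>"
    using spec[OF sum, of 0] unfolding Let_def by (subst nuW) simp_all
  have finW: "nu M 4 (\<lambda>\<omega>. X n \<omega> - W n m \<omega>) < \<infinity>" if "m \<ge> 1" for n m
  proof -
    \<comment> \<open>The series in the hypothesis starts at lag 1, hence the index
      \<open>Suc (m - 1)\<close>.\<close>
    have "nu M 4 (\<lambda>\<omega>. X 0 \<omega> - W 0 (Suc (m - 1)) \<omega>) \<noteq> \<infinity>"
      using sumD by (intro ennreal_suminf_lessD[THEN less_imp_neq]) auto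
    then show ?thesis using that nuW[OF that, of n] nuW[OF that, of 0] by (simp add: less_top)
  qed
  have D: "(\<integral>\<omega>. norm (X n \<omega> - W n m \<omega>) ^ 4 \<partial>M) powr (1/4) = D m" if "m \<ge> 1" for n m
    using nu_finiteD(2)[OF finW[OF that, of n]] nu_finiteD(2)[OF finW[OF that, of 0]]
      nuW[OF that, of n] nuW[OF that, of 0]
    by (simp add: D_def)
  have "summable (\<lambda>i. D (Suc i))"
  proof (rule summable_suminf_not_top)
    show "(\<Sum>i. ennreal (D (Suc i))) \<noteq> \<top>"
      using sumD nu_finiteD(2)[OF finW[of "Suc _" 0]] by (simp add: D_def)
  qed (simp add: D_def)
  then have Dsum: "summable D" by (simp add: summable_Suc_iff)
  \<comment> \<open>The geometric term makes the bound strictly positive and keeps it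
    summable.\<close>
  define d where "d m = D m + (1/2) ^ m" for m
  have d_sum: "summable d"
    unfolding d_def using Dsum by (intro summable_add summable_geometric) auto
  have D0: "D m \<ge> 0" for m by (simp add: D_def)
  have d_pos: "d m > 0" for m using D0[of m] by (simp add: d_def add_nonneg_pos)
  have d4: "(\<integral>\<omega>. norm (X n \<omega> - W n m \<omega>) ^ 4 \<partial>M) \<le> d m ^ 4" if "m \<ge> 1" for n m
  proof -
    let ?I = "\<integral>\<omega>. norm (X n \<omega> - W n m \<omega>) ^ 4 \<partial>M"
    have "?I \<ge> 0" by simp
    then have "(?I powr (1/4)) ^ 4 = ?I"
      by (cases "?I = 0") (simp_all add: powr_powr flip: powr_numeral)
    then have "?I = D m ^ 4" using D[OF that, of n] by simp
    also have "\<dots> \<le> d m ^ 4" using D0 by (intro power_mono) (simp_all add: d_def)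
    finally show ?thesis .
  qed
  have stat: "distr M (borel \<Otimes>\<^sub>M borel) (\<lambda>\<omega>. (X n \<omega>, X (n + k) \<omega>)) =
      distr P (borel \<Otimes>\<^sub>M borel) (\<lambda>a. (f (\<lambda>j. a (0 - int j)), f (\<lambda>j. a (k - int j))))" for n k
  proof -
    have [measurable]: "(\<lambda>\<omega> k. u (k + n) \<omega>) \<in> measurable M ?PU"
      using measurable_compose[OF mu shift] .
    have "distr P (borel \<Otimes>\<^sub>M borel) (\<lambda>a. (f (\<lambda>j. a (0 - int j)), f (\<lambda>j. a (k - int j))))
        = distr M (borel \<Otimes>\<^sub>M borel) ((\<lambda>a. (f (\<lambda>j. a (0 - int j)), f (\<lambda>j. a (k - int j)))) \<circ> (\<lambda>\<omega> k. u (k + n) \<omega>))"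
      unfolding lawu[of n, symmetric] by (rule distr_distr) measurable
    also have "\<dots> = distr M (borel \<Otimes>\<^sub>M borel) (\<lambda>\<omega>. (X n \<omega>, X (n + k) \<omega>))"
    proof (rule distr_cong)
      fix \<omega> assume "\<omega> \<in> space M"
      have e: "0 - int j + n = n - int j" "k - int j + n = n + k - int j" for j by simp_all
      show "((\<lambda>a. (f (\<lambda>j. a (0 - int j)), f (\<lambda>j. a (k - int j)))) \<circ> (\<lambda>\<omega> k. u (k + n) \<omega>)) \<omega>
          = (X n \<omega>, X (n + k) \<omega>)"
        unfolding o_def e X[OF \<open>\<omega> \<in> space M\<close>] ..
    qed simp_all
    finally show ?thesis ..
  qed
  define A where "A = (\<integral>\<omega>. norm (X 0 \<omega>) ^ 4 \<partial>M)"
  have intX: "integrable M (\<lambda>\<omega>. norm (X n \<omega>) ^ 4)" for n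
    by (rule nu_finiteD(1)[OF nuX Xm])
  have A: "(\<integral>\<omega>. norm (X n \<omega>) ^ 4 \<partial>M) = A" for n
  proof -
    \<comment> \<open>Lag 0 in the stationarity of pairs yields that of single variables.\<close>
    have "(\<integral>\<omega>. norm (X n \<omega>) ^ 4 \<partial>M) = (\<integral>p. norm (fst p) ^ 4 \<partial>distr M (borel \<Otimes>\<^sub>M borel) (\<lambda>\<omega>. (X n \<omega>, X (n + 0) \<omega>)))" for n
      by (subst integral_distr) auto
    then show ?thesis unfolding A_def stat by simp
  qed
  \<comment> \<open>By \<open>add_power4_le\<close> the term with factor 8 bounds the fourth moments
    of the truncations; adding 1 gives \<open>s \<ge> 1\<close> and hence
    \<open>s \<le> s ^ 4\<close>.\<close>
  define s where "s = 8 * (A + suminf d ^ 4) + 1"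
  have A0: "A \<ge> 0" by (simp add: A_def)
  have ds: "d m \<le> suminf d" for m
    using sum_le_suminf[OF d_sum, of "{m}"] d_pos less_imp_le by auto
  have s1: "s \<ge> 1" using A0 by (simp add: s_def)
  have s4: "s \<le> s ^ 4" using s1 by (intro self_le_power) auto
  have dd: "d m ^ 4 \<le> suminf d ^ 4" for m
    by (intro power_mono ds less_imp_le[OF d_pos])
  have intXW: "integrable M (\<lambda>\<omega>. norm (X n \<omega> - W n m \<omega>) ^ 4)" if "m \<ge> 1" for n m
    by (rule nu_finiteD(1)[OF finW[OF that]]) measurable
  have W4: "norm (W n m \<omega>) ^ 4 \<le> 8 * (norm (X n \<omega>) ^ 4 + norm (X n \<omega> - W n m \<omega>) ^ 4)" for n m \<omega>
  proof -
    have "norm (W n m \<omega>) \<le> norm (X n \<omega>) + norm (X n \<omega> - W n m \<omega>)"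
      by (metis norm_minus_commute norm_triangle_sub)
    then have "norm (W n m \<omega>) ^ 4 \<le> (norm (X n \<omega>) + norm (X n \<omega> - W n m \<omega>)) ^ 4"
      by (intro power_mono) auto
    then show ?thesis using add_power4_le order_trans by blast
  qed
  have intW: "integrable M (\<lambda>\<omega>. norm (W n m \<omega>) ^ 4)" if "m \<ge> 1" for n m
  proof (rule Bochner_Integration.integrable_bound)
    show "integrable M (\<lambda>\<omega>. 8 * (norm (X n \<omega>) ^ 4 + norm (X n \<omega> - W n m \<omega>) ^ 4))"
      using intX intXW[OF that] by auto
    show "AE \<omega> in M. norm (norm (W n m \<omega>) ^ 4) \<le> norm (8 * (norm (X n \<omega>) ^ 4 + norm (X n \<omega> - W n m \<omega>) ^ 4))"
      using W4 by (intro always_eventually allI) (simp add: abs_of_nonneg)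
  qed measurable
  have "decoupled M X W s d"
  proof (unfold_locales)
    fix n n' k :: int and m h :: nat
    show "(\<integral>\<omega>. norm (X n \<omega>) ^ 4 \<partial>M) \<le> s ^ 4"
    proof -
      have "A \<le> s" using A0 by (simp add: s_def add_increasing2)
      then show ?thesis using A s4 by simp
    qed
    show "(\<integral>\<omega>. norm (W n m \<omega>) ^ 4 \<partial>M) \<le> s ^ 4" if m: "1 \<le> m"
    proof -
      have "(\<integral>\<omega>. norm (W n m \<omega>) ^ 4 \<partial>M) \<le> (\<integral>\<omega>. 8 * (norm (X n \<omega>) ^ 4 + norm (X n \<omega> - W n m \<omega>) ^ 4) \<partial>M)"
        by (intro integral_mono intW[OF m] W4) (use intX intXW[OF m] in auto)
      also have "\<dots> = 8 * (A + (\<integral>\<omega>. norm (X n \<omega> - W n m \<omega>) ^ 4 \<partial>M))"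
        using intX intXW[OF m] by (simp add: A)
      also have "\<dots> \<le> s" using d4[OF m, of n] dd[of m] by (simp add: s_def)
      finally show ?thesis using s4 by simp
    qed
    show "0 < s" using s1 by simp
    show "distr M (borel \<Otimes>\<^sub>M borel) (\<lambda>\<omega>. (X n \<omega>, X (n + k) \<omega>)) =
      distr M (borel \<Otimes>\<^sub>M borel) (\<lambda>\<omega>. (X 0 \<omega>, X k \<omega>))"
      using stat[of n k] stat[of 0 k] by simp
    show "indep_var (borel \<Otimes>\<^sub>M borel) (\<lambda>\<omega>. (X n \<omega>, X (n + int h) \<omega>))
        (borel \<Otimes>\<^sub>M borel) (\<lambda>\<omega>. (W n' m \<omega>, W (n' + int h) m \<omega>))" if lt: "n + int h < n' - int m"
    proof -
      define B where "B p = (f (\<lambda>j. if j \<le> m then fst p (n' - int j) else snd p (n' - int j)),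
          f (\<lambda>j. if j \<le> m then fst p (n' + int h - int j) else snd p (n' + int h - int j)))"
        for p :: "(int \<Rightarrow> 'u) \<times> (int \<Rightarrow> 'u)"
      have "indep_var (borel \<Otimes>\<^sub>M borel) (\<lambda>\<omega>. (\<lambda>a. (f (\<lambda>j. a (n - int j)), f (\<lambda>j. a (n + int h - int j)))) (\<lambda>k. u k \<omega>))
          (borel \<Otimes>\<^sub>M borel) (\<lambda>\<omega>. B (\<lambda>k. u k \<omega>, \<lambda>k. ustar 0 1 k \<omega>))"
      proof (rule indep_var_frozen[OF uv[OF order_refl]])
        show "B \<in> measurable (?PU \<Otimes>\<^sub>M ?PU) (borel \<Otimes>\<^sub>M borel)" unfolding B_def[abs_def] by measurable
        fix b assume b: "b \<in> space ?PU"
        \<comment> \<open>With the copy frozen at \<open>b\<close>, the pair of observations depends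
          on innovations up to time \<open>n + int h\<close>, and the truncated pair only on later
          ones, since \<open>n + int h < n' - int m\<close>.\<close>
        let ?L = "{..n + int h}" and ?R = "{n + int h<..}"
        let ?A' = "\<lambda>a. (f (\<lambda>j. a (n - int j)), f (\<lambda>j. a (n + int h - int j)))"
        have c1 [measurable]: "(\<lambda>a. f (\<lambda>j. a (i - int j))) \<in> borel_measurable (\<Pi>\<^sub>M k\<in>?L. U)" if "i \<le> n + int h" for i
          by (rule measurable_compose[OF _ f], rule measurable_PiM_single')
            (use that in \<open>auto simp: space_PiM PiE_def Pi_def intro!: measurable_component_singleton\<close>)
        have c2: "(\<lambda>a. f (\<lambda>j. if j \<le> m then a (i - int j) else b (i - int j))) \<in> borel_measurable (\<Pi>\<^sub>M k\<in>?R. U)"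
          if "n' \<le> i" for i
        proof (rule measurable_compose[OF _ f], rule measurable_PiM_single')
          show "(\<lambda>a. if j \<le> m then a (i - int j) else b (i - int j)) \<in> measurable (\<Pi>\<^sub>M k\<in>?R. U) U" for j
            using b that lt by (cases "j \<le> m") (auto simp: space_PiM PiE_def Pi_def intro!: measurable_component_singleton)
        qed (use b that lt in \<open>auto simp: space_PiM PiE_def Pi_def\<close>)
        have "indep_var (borel \<Otimes>\<^sub>M borel) (?A' \<circ> (\<lambda>\<omega>. restrict (\<lambda>k. u k \<omega>) ?L))
            (borel \<Otimes>\<^sub>M borel) ((\<lambda>a. B (a, b)) \<circ> (\<lambda>\<omega>. restrict (\<lambda>k. u k \<omega>) ?R))"
        proof (rule indep_var_compose[OF indep_var_restrict[OF u]])
          show "?A' \<in> measurable (\<Pi>\<^sub>M k\<in>?L. U) (borel \<Otimes>\<^sub>M borel)"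
            by (intro measurable_Pair c1) auto
          show "(\<lambda>a. B (a, b)) \<in> measurable (\<Pi>\<^sub>M k\<in>?R. U) (borel \<Otimes>\<^sub>M borel)"
            unfolding B_def fst_conv snd_conv by (intro measurable_Pair c2) auto
        qed auto
        moreover have "?A' \<circ> (\<lambda>\<omega>. restrict (\<lambda>k. u k \<omega>) ?L) = (\<lambda>\<omega>. ?A' (\<lambda>k. u k \<omega>))"
          by (simp add: fun_eq_iff)
        moreover have "(\<lambda>a. B (a, b)) \<circ> (\<lambda>\<omega>. restrict (\<lambda>k. u k \<omega>) ?R) = (\<lambda>\<omega>. B (\<lambda>k. u k \<omega>, b))"
        proof (rule ext)
          fix \<omega>
          have "(\<lambda>j. if j \<le> m then restrict (\<lambda>k. u k \<omega>) ?R (i - int j) else b (i - int j))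
              = (\<lambda>j. if j \<le> m then u (i - int j) \<omega> else b (i - int j))" if "n' \<le> i" for i
            using that lt by (intro ext) auto
          from this[of n'] this[of "n' + int h"]
          show "((\<lambda>a. B (a, b)) \<circ> (\<lambda>\<omega>. restrict (\<lambda>k. u k \<omega>) ?R)) \<omega> = B (\<lambda>k. u k \<omega>, b)"
            unfolding B_def o_def fst_conv snd_conv by simp
        qed
        ultimately show "indep_var (borel \<Otimes>\<^sub>M borel) (\<lambda>\<omega>. ?A' (\<lambda>k. u k \<omega>))
            (borel \<Otimes>\<^sub>M borel) (\<lambda>\<omega>. B (\<lambda>k. u k \<omega>, b))"
          by simp
      qed measurable
      \<comment> \<open>\<open>X\<close> is represented by \<open>f\<close> only on the space of
        \<open>M\<close>, so independence is transferred through the laws, which ignore other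
        points.\<close>
      then show ?thesis
        unfolding indep_var_distribution_eq B_def fst_conv snd_conv W_def[symmetric]
        by (auto simp: X cong: distr_cong)
    qed
  qed (use intX intW intXW d_sum d_pos d4 in auto)
  then show ?thesis by blast
qed

section \<open>Sample means of bilinear forms\<close>

lemma prod4_le: "x * y * (z * w) \<le> (x ^ 4 + y ^ 4 + z ^ 4 + w ^ 4) / 4" for x y z w :: real
proof -
  have sq: "a * b \<le> (a\<^sup>2 + b\<^sup>2) / 2" for a b :: real
    using sum_squares_bound[of a b] by simp
  have "x * y * (z * w) \<le> ((x * y)\<^sup>2 + (z * w)\<^sup>2) / 2" by (rule sq)
  also have "\<dots> = (x\<^sup>2 * y\<^sup>2 + z\<^sup>2 * w\<^sup>2) / 2" by (simp add: power_mult_distrib)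
  also have "\<dots> \<le> (((x\<^sup>2)\<^sup>2 + (y\<^sup>2)\<^sup>2) / 2 + ((z\<^sup>2)\<^sup>2 + (w\<^sup>2)\<^sup>2) / 2) / 2"
    by (intro divide_right_mono add_mono sq) simp
  also have "\<dots> = (x ^ 4 + y ^ 4 + z ^ 4 + w ^ 4) / 4" by (simp add: add_divide_distrib)
  finally show ?thesis .
qed

text \<open>\<open>c\<close> is an upper bound for the fourth-moment norm, not the norm itself; it
  is positive so that \<open>Z\<close> can be divided by it.\<close>

definition L4_bounded :: "'a measure \<Rightarrow> ('a \<Rightarrow> real) \<Rightarrow> real \<Rightarrow> bool" where
  "L4_bounded M Z c \<longleftrightarrow> Z \<in> borel_measurable M \<and> (\<forall>\<omega>. 0 \<le> Z \<omega>) \<and>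
     integrable M (\<lambda>\<omega>. Z \<omega> ^ 4) \<and> (\<integral>\<omega>. Z \<omega> ^ 4 \<partial>M) \<le> c ^ 4 \<and> 0 < c"

text \<open>By AM--GM applied to the factors divided by their bounds.\<close>

lemma L4_bounded_prod:
  assumes a: "L4_bounded M a A" and b: "L4_bounded M b B" and c: "L4_bounded M c C" and e: "L4_bounded M e E"
  shows "integrable M (\<lambda>\<omega>. a \<omega> * b \<omega> * (c \<omega> * e \<omega>))"
    "(\<integral>\<omega>. a \<omega> * b \<omega> * (c \<omega> * e \<omega>) \<partial>M) \<le> A * B * (C * E)"
proof -
  have [measurable]: "a \<in> borel_measurable M" "b \<in> borel_measurable M" "c \<in> borel_measurable M" "e \<in> borel_measurable M"
    and nn: "\<And>\<omega>. 0 \<le> a \<omega>" "\<And>\<omega>. 0 \<le> b \<omega>" "\<And>\<omega>. 0 \<le> c \<omega>" "\<And>\<omega>. 0 \<le> e \<omega>"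
    and pos: "A > 0" "B > 0" "C > 0" "E > 0"
    and int [simp]: "integrable M (\<lambda>\<omega>. a \<omega> ^ 4)" "integrable M (\<lambda>\<omega>. b \<omega> ^ 4)"
      "integrable M (\<lambda>\<omega>. c \<omega> ^ 4)" "integrable M (\<lambda>\<omega>. e \<omega> ^ 4)"
    and le: "(\<integral>\<omega>. a \<omega> ^ 4 \<partial>M) \<le> A ^ 4" "(\<integral>\<omega>. b \<omega> ^ 4 \<partial>M) \<le> B ^ 4"
      "(\<integral>\<omega>. c \<omega> ^ 4 \<partial>M) \<le> C ^ 4" "(\<integral>\<omega>. e \<omega> ^ 4 \<partial>M) \<le> E ^ 4"
    using assms by (auto simp: L4_bounded_def)
  let ?K = "A * B * (C * E)"
  let ?g = "\<lambda>\<omega>. ?K * ((a \<omega> ^ 4 / A ^ 4 + b \<omega> ^ 4 / B ^ 4 + c \<omega> ^ 4 / C ^ 4 + e \<omega> ^ 4 / E ^ 4) / 4)"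
  have K: "?K > 0" using pos by simp
  have bd: "a \<omega> * b \<omega> * (c \<omega> * e \<omega>) \<le> ?g \<omega>" for \<omega>
  proof -
    have "a \<omega> * b \<omega> * (c \<omega> * e \<omega>) = ?K * ((a \<omega> / A) * (b \<omega> / B) * ((c \<omega> / C) * (e \<omega> / E)))"
      using pos by simp
    also have "\<dots> \<le> ?g \<omega>"
      using prod4_le[of "a \<omega> / A" "b \<omega> / B" "c \<omega> / C" "e \<omega> / E"] K
      by (intro mult_left_mono) (simp_all add: power_divide)
    finally show ?thesis .
  qed
  have gi: "integrable M ?g" by simp
  show i: "integrable M (\<lambda>\<omega>. a \<omega> * b \<omega> * (c \<omega> * e \<omega>))"
  proof (rule Bochner_Integration.integrable_bound[OF gi])
    show "AE \<omega> in M. norm (a \<omega> * b \<omega> * (c \<omega> * e \<omega>)) \<le> norm (?g \<omega>)"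
    proof (intro always_eventually allI)
      fix \<omega>
      have "0 \<le> a \<omega> * b \<omega> * (c \<omega> * e \<omega>)" using nn by simp
      then show "norm (a \<omega> * b \<omega> * (c \<omega> * e \<omega>)) \<le> norm (?g \<omega>)"
        using bd[of \<omega>] by simp
    qed
  qed measurable
  have "(\<integral>\<omega>. a \<omega> * b \<omega> * (c \<omega> * e \<omega>) \<partial>M) \<le> (\<integral>\<omega>. ?g \<omega> \<partial>M)"
    by (intro integral_mono i gi bd)
  also have "\<dots> = ?K * (((\<integral>\<omega>. a \<omega> ^ 4 \<partial>M) / A ^ 4 + (\<integral>\<omega>. b \<omega> ^ 4 \<partial>M) / B ^ 4
      + (\<integral>\<omega>. c \<omega> ^ 4 \<partial>M) / C ^ 4 + (\<integral>\<omega>. e \<omega> ^ 4 \<partial>M) / E ^ 4) / 4)"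
    by simp
  also have "\<dots> \<le> ?K * ((1 + 1 + 1 + 1) / 4)"
    using K pos le by (intro mult_left_mono divide_right_mono add_mono) auto
  finally show "(\<integral>\<omega>. a \<omega> * b \<omega> * (c \<omega> * e \<omega>) \<partial>M) \<le> ?K" by simp
qed

text \<open>The brackets have the shapes that occur below: a centred term is bounded by a product of
  norms plus a constant, a truncation error by a sum of two products. Constants enter as constant
  functions.\<close>

lemma L4_bounded_dominated:
  fixes f :: "'a \<Rightarrow> real"
  assumes a: "L4_bounded M a A" "L4_bounded M b B" "L4_bounded M a' A'" "L4_bounded M b' B'"
    and c: "L4_bounded M c C" "L4_bounded M e E" "L4_bounded M c' C'" "L4_bounded M e' E'"
    and f: "f \<in> borel_measurable M"
      "\<And>\<omega>. \<bar>f \<omega>\<bar> \<le> (a \<omega> * b \<omega> + a' \<omega> * b' \<omega>) * (c \<omega> * e \<omega> + c' \<omega> * e' \<omega>)"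
  shows "integrable M f" "\<bar>\<integral>\<omega>. f \<omega> \<partial>M\<bar> \<le> (A * B + A' * B') * (C * E + C' * E')"
proof -
  let ?p = "\<lambda>\<omega>. a \<omega> * b \<omega> * (c \<omega> * e \<omega>)" and ?q = "\<lambda>\<omega>. a \<omega> * b \<omega> * (c' \<omega> * e' \<omega>)"
    and ?r = "\<lambda>\<omega>. a' \<omega> * b' \<omega> * (c \<omega> * e \<omega>)" and ?t = "\<lambda>\<omega>. a' \<omega> * b' \<omega> * (c' \<omega> * e' \<omega>)"
  note p = L4_bounded_prod[OF a(1,2) c(1,2)] and q = L4_bounded_prod[OF a(1,2) c(3,4)]
    and r = L4_bounded_prod[OF a(3,4) c(1,2)] and t = L4_bounded_prod[OF a(3,4) c(3,4)]
  let ?g = "\<lambda>\<omega>. ?p \<omega> + ?q \<omega> + ?r \<omega> + ?t \<omega>"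
  have g: "integrable M ?g" using p(1) q(1) r(1) t(1) by auto
  have fg: "\<bar>f \<omega>\<bar> \<le> ?g \<omega>" for \<omega> using f(2)[of \<omega>] by (simp add: distrib_left distrib_right)
  show fi: "integrable M f"
  proof (rule Bochner_Integration.integrable_bound[OF g f(1)])
    show "AE \<omega> in M. norm (f \<omega>) \<le> norm (?g \<omega>)"
    proof (intro always_eventually allI)
      fix \<omega>
      show "norm (f \<omega>) \<le> norm (?g \<omega>)"
        unfolding real_norm_def using fg[of \<omega>] abs_ge_self by (rule order_trans)
    qed
  qed
  have "\<bar>\<integral>\<omega>. f \<omega> \<partial>M\<bar> \<le> (\<integral>\<omega>. \<bar>f \<omega>\<bar> \<partial>M)" by simp
  also have "\<dots> \<le> (\<integral>\<omega>. ?g \<omega> \<partial>M)" using fi g fg by (intro integral_mono) auto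
  also have "\<dots> = (\<integral>\<omega>. ?p \<omega> \<partial>M) + (\<integral>\<omega>. ?q \<omega> \<partial>M) + (\<integral>\<omega>. ?r \<omega> \<partial>M) + (\<integral>\<omega>. ?t \<omega> \<partial>M)"
    using p(1) q(1) r(1) t(1) by simp
  also have "\<dots> \<le> A * B * (C * E) + A * B * (C' * E') + A' * B' * (C * E) + A' * B' * (C' * E')"
    by (intro add_mono p(2) q(2) r(2) t(2))
  also have "\<dots> = (A * B + A' * B') * (C * E + C' * E')" by (simp add: distrib_left distrib_right)
  finally show "\<bar>\<integral>\<omega>. f \<omega> \<partial>M\<bar> \<le> (A * B + A' * B') * (C * E + C' * E')" .
qed

lemma sum_prod_le_L2: "\<bar>\<Sum>i\<in>F. f i * g i\<bar> \<le> L2_set f F * L2_set g F"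
proof -
  have "\<bar>\<Sum>i\<in>F. f i * g i\<bar> \<le> (\<Sum>i\<in>F. \<bar>f i\<bar> * \<bar>g i\<bar>)"
    by (rule order_trans[OF sum_abs]) (simp add: abs_mult)
  also have "\<dots> \<le> L2_set f F * L2_set g F" by (rule L2_set_mult_ineq)
  finally show ?thesis .
qed

text \<open>Passes from bounds on finite sums to the integral over the counting measure, which can
  be interchanged with the expectation by Tonelli's theorem.\<close>

lemma nn_integral_count_space_le:
  fixes r :: "'b \<Rightarrow> real"
  assumes nn: "\<And>i. i \<in> B \<Longrightarrow> 0 \<le> r i" and c: "0 \<le> c"
    and le: "\<And>F. finite F \<Longrightarrow> F \<subseteq> B \<Longrightarrow> sum r F \<le> c"
  shows "(\<integral>\<^sup>+i. ennreal (r i) \<partial>count_space B) \<le> ennreal c"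
proof -
  have s: "r summable_on B"
    by (rule nonneg_bdd_above_summable_on) (auto intro!: nn bdd_aboveI2[of _ _ c] le)
  then have "(\<lambda>i. norm (r i)) summable_on B"
    using nn by (subst summable_on_cong[of B _ r]) auto
  then have a: "Infinite_Set_Sum.abs_summable_on r B" by (rule abs_summable_equivalent[THEN iffD1])
  have "(\<integral>\<^sup>+i. ennreal (r i) \<partial>count_space B) = ennreal (infsum r B)"
    using nn_integral_conv_infsetsum[OF a nn] infsetsum_infsum[OF a] by simp
  also have "\<dots> \<le> ennreal c"
    by (intro ennreal_leI infsum_le_finite_sums s le)
  finally show ?thesis .
qed

lemma sum_le_nn_integral_count_space:
  fixes r :: "'b \<Rightarrow> real"
  assumes nn: "\<And>i. i \<in> B \<Longrightarrow> 0 \<le> r i" and F: "finite F" "F \<subseteq> B"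
  shows "ennreal (sum r F) \<le> (\<integral>\<^sup>+i. ennreal (r i) \<partial>count_space B)"
proof -
  have "ennreal (sum r F) = (\<Sum>i\<in>F. ennreal (r i))"
    using nn F by (subst sum_ennreal) auto
  also have "\<dots> = (\<Sum>i\<in>F. ennreal (r i) * indicator F i)" by (rule sum.cong) auto
  also have "\<dots> = (\<integral>\<^sup>+i. ennreal (r i) * indicator F i \<partial>count_space B)"
    using F by (intro nn_integral_count_space'[symmetric]) auto
  also have "\<dots> \<le> (\<integral>\<^sup>+i. ennreal (r i) \<partial>count_space B)"
    by (intro nn_integral_mono) (auto simp: indicator_def)
  finally show ?thesis .
qed

section \<open>Covariances of bilinear forms, summed over the index set\<close>

context decoupled
begin

lemma L4_const: "0 < c \<Longrightarrow> L4_bounded M (\<lambda>_. c) c"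
  by (simp add: L4_bounded_def prob_space)

lemma L4_X: "L4_bounded M (\<lambda>\<omega>. norm (X n \<omega>)) s"
  using X_integrable X_moment s_pos by (simp add: L4_bounded_def)

lemma L4_W: "1 \<le> m \<Longrightarrow> L4_bounded M (\<lambda>\<omega>. norm (W n m \<omega>)) s"
  using W_integrable W_moment s_pos by (simp add: L4_bounded_def)

lemma L4_XW: "1 \<le> m \<Longrightarrow> L4_bounded M (\<lambda>\<omega>. norm (X n \<omega> - W n m \<omega>)) (d m)"
  using XW_integrable XW_moment d_pos by (simp add: L4_bounded_def)

text \<open>The bound for products of four factors, with two of them equal to 1.\<close>

lemma integrable_prod_norm:
  shows "integrable M (\<lambda>\<omega>. norm (X n \<omega>) * norm (X k \<omega>))"
    "(\<integral>\<omega>. norm (X n \<omega>) * norm (X k \<omega>) \<partial>M) \<le> s * s"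
  using L4_bounded_prod[OF L4_X[of n] L4_X[of k] L4_const L4_const, of 1 1] by simp_all

end

text \<open>\<open>L2_bound\<close> controls all forms at once and keeps the estimates uniform in
  \<open>F\<close>. The instances are the matrix coefficients in a basis and the inner products of
  components.\<close>

locale decoupled_bilinear = decoupled M X W s d
  for M :: "'w measure" and X :: "int \<Rightarrow> 'w \<Rightarrow> 'h::{real_inner,banach,second_countable_topology}" and W s d +
  fixes \<beta> :: "'i \<Rightarrow> 'h \<Rightarrow> 'h \<Rightarrow> real" and A :: "'i set" and h :: nat
  assumes bilinear: "i \<in> A \<Longrightarrow> bounded_bilinear (\<beta> i)"
    and L2_bound: "finite F \<Longrightarrow> F \<subseteq> A \<Longrightarrow> L2_set (\<lambda>i. \<beta> i x y) F \<le> norm x * norm y"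
begin

definition Y :: "'i \<Rightarrow> int \<Rightarrow> 'w \<Rightarrow> real" where
  "Y i n \<omega> = \<beta> i (X n \<omega>) (X (n + int h) \<omega>)"

definition \<mu> :: "'i \<Rightarrow> real" where
  "\<mu> i = (\<integral>\<omega>. \<beta> i (X 0 \<omega>) (X (int h) \<omega>) \<partial>M)"

text \<open>The covariance bound at time distance \<open>r\<close>. Independence after truncation at
  lag \<open>m\<close> needs \<open>m < r - h\<close>, and moment bounds need
  \<open>m \<ge> 1\<close>; so up to \<open>r = h + 1\<close> only the crude bound is available, and
  beyond it \<open>m = r - h - 1\<close> is the largest admissible lag. Each 4 is the product of two
  sums of two equal terms.\<close>

definition \<rho> :: "nat \<Rightarrow> real" where
  "\<rho> r = (if r \<le> h + 1 then 4 * s ^ 4 else 4 * s ^ 3 * d (r - h - 1))"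

lemma beta_measurable_pair:
  "i \<in> A \<Longrightarrow> (\<lambda>p. \<beta> i (fst p) (snd p)) \<in> borel_measurable (borel \<Otimes>\<^sub>M borel)"
  by (rule borel_measurable_continuous_Pair)
    (auto intro!: bounded_bilinear.continuous_on[OF bilinear] continuous_intros)

lemma beta_measurable:
  assumes "i \<in> A" "f \<in> borel_measurable N" "g \<in> borel_measurable N"
  shows "(\<lambda>\<omega>. \<beta> i (f \<omega>) (g \<omega>)) \<in> borel_measurable N"
  using measurable_compose[OF measurable_Pair[OF assms(2,3)] beta_measurable_pair[OF assms(1)]] by simp

lemma Y_measurable: "i \<in> A \<Longrightarrow> Y i n \<in> borel_measurable M"
  unfolding Y_def by (rule beta_measurable) measurable

lemma beta_le: "i \<in> A \<Longrightarrow> \<bar>\<beta> i x y\<bar> \<le> norm x * norm y"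
  using L2_bound[of "{i}" x y] by simp

lemma Y_integrable: "i \<in> A \<Longrightarrow> integrable M (Y i n)"
  by (rule Bochner_Integration.integrable_bound[OF integrable_prod_norm(1)[of n "n + int h"]])
    (auto simp: Y_measurable Y_def beta_le)

lemma Y_mean:
  assumes "i \<in> A"
  shows "(\<integral>\<omega>. Y i n \<omega> \<partial>M) = \<mu> i"
proof -
  have "(\<integral>\<omega>. Y i n \<omega> \<partial>M) = (\<integral>p. \<beta> i (fst p) (snd p) \<partial>distr M (borel \<Otimes>\<^sub>M borel) (\<lambda>\<omega>. (X n \<omega>, X (n + int h) \<omega>)))"
    by (subst integral_distr) (auto simp: Y_def[abs_def] intro!: beta_measurable_pair assms)
  also have "\<dots> = \<mu> i"
    unfolding stationary by (subst integral_distr) (auto simp: \<mu>_def intro!: beta_measurable_pair assms)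
  finally show ?thesis .
qed

text \<open>The norm of a mean is at most the mean of the norms: \<open>\<mu>\<close> is paired with
  itself, and Cauchy--Schwarz under the expectation leaves one factor \<open>L2_set \<mu> F\<close>
  to cancel.\<close>

lemma L2_mean:
  assumes F: "finite F" "F \<subseteq> A"
  shows "L2_set \<mu> F \<le> s * s"
proof (cases "L2_set \<mu> F = 0")
  case False
  then have pos: "L2_set \<mu> F > 0" using L2_set_nonneg[of \<mu> F] by linarith
  have "L2_set \<mu> F * L2_set \<mu> F = (\<Sum>i\<in>F. \<mu> i * \<mu> i)"
    by (simp add: L2_set_def sum_nonneg power2_eq_square)
  also have "\<dots> = (\<integral>\<omega>. (\<Sum>i\<in>F. \<mu> i * Y i 0 \<omega>) \<partial>M)"
    using F Y_integrable Y_mean by (subst Bochner_Integration.integral_sum) (auto intro!: sum.cong)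
  also have "\<dots> \<le> (\<integral>\<omega>. L2_set \<mu> F * (norm (X 0 \<omega>) * norm (X (int h) \<omega>)) \<partial>M)"
  proof (rule integral_mono)
    fix \<omega>
    have "(\<Sum>i\<in>F. \<mu> i * Y i 0 \<omega>) \<le> (\<Sum>i\<in>F. \<bar>\<mu> i\<bar> * \<bar>Y i 0 \<omega>\<bar>)"
      by (intro sum_mono) (simp add: abs_mult[symmetric])
    also have "\<dots> \<le> L2_set \<mu> F * L2_set (\<lambda>i. Y i 0 \<omega>) F" by (rule L2_set_mult_ineq)
    also have "\<dots> \<le> L2_set \<mu> F * (norm (X 0 \<omega>) * norm (X (int h) \<omega>))"
      using L2_bound[OF F, of "X 0 \<omega>" "X (int h) \<omega>"]
      by (intro mult_left_mono) (simp_all add: Y_def L2_set_nonneg)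
    finally show "(\<Sum>i\<in>F. \<mu> i * Y i 0 \<omega>) \<le> L2_set \<mu> F * (norm (X 0 \<omega>) * norm (X (int h) \<omega>))" .
  next
    show "integrable M (\<lambda>\<omega>. \<Sum>i\<in>F. \<mu> i * Y i 0 \<omega>)"
      using F Y_integrable by (intro Bochner_Integration.integrable_sum integrable_mult_right) auto
  qed (use integrable_prod_norm in auto)
  also have "\<dots> \<le> L2_set \<mu> F * (s * s)"
    using integrable_prod_norm(2)[of 0 "int h"] by (simp add: mult_left_mono L2_set_nonneg)
  finally show ?thesis using pos by simp
qed (use s_pos in simp)

lemma L2_centered:
  assumes F: "finite F" "F \<subseteq> A"
  shows "L2_set (\<lambda>i. Y i n \<omega> - \<mu> i) F \<le> norm (X n \<omega>) * norm (X (n + int h) \<omega>) + s * s"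
proof -
  have "L2_set (\<lambda>i. Y i n \<omega> + (- \<mu> i)) F \<le> L2_set (\<lambda>i. Y i n \<omega>) F + L2_set (\<lambda>i. - \<mu> i) F"
    by (rule L2_set_triangle_ineq)
  also have "L2_set (\<lambda>i. - \<mu> i) F = L2_set \<mu> F" by (simp add: L2_set_def)
  finally show ?thesis
    using L2_mean[OF F] L2_bound[OF F, of "X n \<omega>" "X (n + int h) \<omega>"] by (simp add: Y_def)
qed

text \<open>The trace of a cross-covariance matrix. Summing over \<open>F\<close> before estimating
  allows Cauchy--Schwarz over \<open>F\<close>, which gives bounds independent of
  \<open>F\<close>.\<close>

definition cov :: "'i set \<Rightarrow> int \<Rightarrow> int \<Rightarrow> real" where
  "cov F n k = (\<integral>\<omega>. (\<Sum>i\<in>F. (Y i n \<omega> - \<mu> i) * (Y i k \<omega> - \<mu> i)) \<partial>M)"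

lemma
  assumes F: "finite F" "F \<subseteq> A"
  shows cov_integrable: "integrable M (\<lambda>\<omega>. \<Sum>i\<in>F. (Y i n \<omega> - \<mu> i) * (Y i k \<omega> - \<mu> i))"
    and cov_le: "cov F n k \<le> 4 * s ^ 4"
proof -
  have m: "(\<lambda>\<omega>. \<Sum>i\<in>F. (Y i n \<omega> - \<mu> i) * (Y i k \<omega> - \<mu> i)) \<in> borel_measurable M"
    using F Y_measurable by (intro borel_measurable_sum borel_measurable_times borel_measurable_diff) auto
  have b: "\<bar>\<Sum>i\<in>F. (Y i n \<omega> - \<mu> i) * (Y i k \<omega> - \<mu> i)\<bar>
      \<le> (norm (X n \<omega>) * norm (X (n + int h) \<omega>) + s * s) * (norm (X k \<omega>) * norm (X (k + int h) \<omega>) + s * s)" for \<omega>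
    using s_pos by (intro order_trans[OF sum_prod_le_L2] mult_mono L2_centered F L2_set_nonneg) simp
  note * = L4_bounded_dominated[OF L4_X L4_X L4_const L4_const L4_X L4_X L4_const L4_const m b, OF s_pos s_pos s_pos s_pos]
  show "integrable M (\<lambda>\<omega>. \<Sum>i\<in>F. (Y i n \<omega> - \<mu> i) * (Y i k \<omega> - \<mu> i))" by (rule *(1))
  have "(s * s + s * s) * (s * s + s * s) = 4 * s ^ 4" by (simp add: power4_eq_xxxx)
  then show "cov F n k \<le> 4 * s ^ 4" using *(2) by (simp add: cov_def)
qed

text \<open>\<open>Y i k\<close> is split into its truncated version \<open>B i\<close> and an
  error. The truncated part is independent of the term at time \<open>n\<close> and contributes
  nothing; the error is of order \<open>d m\<close> by bilinearity.\<close>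

lemma cov_le_decoupled:
  assumes F: "finite F" "F \<subseteq> A" and m: "1 \<le> m" and lt: "n + int h < k - int m"
  shows "cov F n k \<le> 4 * s ^ 3 * d m"
proof -
  define B where "B i \<omega> = \<beta> i (W k m \<omega>) (W (k + int h) m \<omega>)" for i \<omega>
  have Bm: "B i \<in> borel_measurable M" if "i \<in> A" for i
    unfolding B_def by (rule beta_measurable[OF that]) measurable
  \<comment> \<open>The factor at time \<open>n\<close> is centred, so the expectation of the
    product vanishes whatever the mean of \<open>B i\<close> is.\<close>
  have zero: "(\<integral>\<omega>. (Y i n \<omega> - \<mu> i) * (B i \<omega> - \<mu> i) \<partial>M) = 0"
    and int: "integrable M (\<lambda>\<omega>. (Y i n \<omega> - \<mu> i) * (B i \<omega> - \<mu> i))" if i: "i \<in> A" for i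
  proof -
    have Bi: "integrable M (B i)"
    proof (rule Bochner_Integration.integrable_bound)
      show "integrable M (\<lambda>\<omega>. norm (W k m \<omega>) * norm (W (k + int h) m \<omega>))"
        using L4_bounded_prod(1)[OF L4_W[OF m, of k] L4_W[OF m, of "k + int h"] L4_const L4_const, of 1 1] by simp
    qed (auto simp: Bm i B_def beta_le)
    have pm: "(\<lambda>p. \<beta> i (fst p) (snd p) - \<mu> i) \<in> borel_measurable (borel \<Otimes>\<^sub>M borel)"
      using beta_measurable_pair[OF i] by simp
    have "indep_var borel ((\<lambda>p. \<beta> i (fst p) (snd p) - \<mu> i) \<circ> (\<lambda>\<omega>. (X n \<omega>, X (n + int h) \<omega>)))
        borel ((\<lambda>p. \<beta> i (fst p) (snd p) - \<mu> i) \<circ> (\<lambda>\<omega>. (W k m \<omega>, W (k + int h) m \<omega>)))"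
      by (rule indep_var_compose[OF decoupling[OF lt] pm pm])
    then have ind: "indep_var borel (\<lambda>\<omega>. Y i n \<omega> - \<mu> i) borel (\<lambda>\<omega>. B i \<omega> - \<mu> i)"
      by (simp add: o_def Y_def B_def)
    have Yi: "integrable M (\<lambda>\<omega>. Y i n \<omega> - \<mu> i)" "integrable M (\<lambda>\<omega>. B i \<omega> - \<mu> i)"
      using Y_integrable[OF i] Bi by auto
    show "integrable M (\<lambda>\<omega>. (Y i n \<omega> - \<mu> i) * (B i \<omega> - \<mu> i))"
      by (rule indep_var_integrable[OF ind Yi])
    have "(\<integral>\<omega>. Y i n \<omega> - \<mu> i \<partial>M) = 0"
      using Y_integrable[OF i] Y_mean[OF i] by (simp add: prob_space)
    then show "(\<integral>\<omega>. (Y i n \<omega> - \<mu> i) * (B i \<omega> - \<mu> i) \<partial>M) = 0"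
      using indep_var_lebesgue_integral[OF ind Yi] by simp
  qed
  have mm: "(\<lambda>\<omega>. \<Sum>i\<in>F. (Y i n \<omega> - \<mu> i) * (Y i k \<omega> - B i \<omega>)) \<in> borel_measurable M"
    using F Y_measurable Bm by (intro borel_measurable_sum borel_measurable_times borel_measurable_diff) auto
  \<comment> \<open>The two arguments are truncated one after the other, which leaves a truncation
    error in exactly one argument of each form.\<close>
  have diff: "L2_set (\<lambda>i. Y i k \<omega> - B i \<omega>) F \<le> norm (X k \<omega> - W k m \<omega>) * norm (X (k + int h) \<omega>)
      + norm (W k m \<omega>) * norm (X (k + int h) \<omega> - W (k + int h) m \<omega>)" for \<omega>
  proof -
    have "L2_set (\<lambda>i. Y i k \<omega> - B i \<omega>) F = L2_set (\<lambda>i. \<beta> i (X k \<omega> - W k m \<omega>) (X (k + int h) \<omega>)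
        + \<beta> i (W k m \<omega>) (X (k + int h) \<omega> - W (k + int h) m \<omega>)) F"
      using F bilinear by (intro L2_set_cong refl)
        (auto simp: Y_def B_def bounded_bilinear.diff_left bounded_bilinear.diff_right subset_eq)
    also have "\<dots> \<le> L2_set (\<lambda>i. \<beta> i (X k \<omega> - W k m \<omega>) (X (k + int h) \<omega>)) F
        + L2_set (\<lambda>i. \<beta> i (W k m \<omega>) (X (k + int h) \<omega> - W (k + int h) m \<omega>)) F"
      by (rule L2_set_triangle_ineq)
    also have "\<dots> \<le> norm (X k \<omega> - W k m \<omega>) * norm (X (k + int h) \<omega>)
        + norm (W k m \<omega>) * norm (X (k + int h) \<omega> - W (k + int h) m \<omega>)"
      by (intro add_mono L2_bound F)
    finally show ?thesis .
  qed
  have b: "\<bar>\<Sum>i\<in>F. (Y i n \<omega> - \<mu> i) * (Y i k \<omega> - B i \<omega>)\<bar>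
      \<le> (norm (X n \<omega>) * norm (X (n + int h) \<omega>) + s * s) *
        (norm (X k \<omega> - W k m \<omega>) * norm (X (k + int h) \<omega>)
          + norm (W k m \<omega>) * norm (X (k + int h) \<omega> - W (k + int h) m \<omega>))" for \<omega>
    using s_pos by (intro order_trans[OF sum_prod_le_L2] mult_mono L2_centered diff F L2_set_nonneg) simp
  note * = L4_bounded_dominated[OF L4_X L4_X L4_const L4_const L4_XW L4_X L4_W L4_XW mm b, OF s_pos s_pos m m m]
  have "cov F n k = (\<integral>\<omega>. (\<Sum>i\<in>F. (Y i n \<omega> - \<mu> i) * (Y i k \<omega> - B i \<omega>))
      + (\<Sum>i\<in>F. (Y i n \<omega> - \<mu> i) * (B i \<omega> - \<mu> i)) \<partial>M)"
    unfolding cov_def by (intro Bochner_Integration.integral_cong refl)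
      (simp add: sum.distrib[symmetric] distrib_left[symmetric])
  also have "\<dots> = (\<integral>\<omega>. (\<Sum>i\<in>F. (Y i n \<omega> - \<mu> i) * (Y i k \<omega> - B i \<omega>)) \<partial>M)
      + (\<Sum>i\<in>F. (\<integral>\<omega>. (Y i n \<omega> - \<mu> i) * (B i \<omega> - \<mu> i) \<partial>M))"
    using *(1) int F
    by (subst Bochner_Integration.integral_add)
      (auto intro!: Bochner_Integration.integral_sum Bochner_Integration.integrable_sum)
  also have "\<dots> = (\<integral>\<omega>. (\<Sum>i\<in>F. (Y i n \<omega> - \<mu> i) * (Y i k \<omega> - B i \<omega>)) \<partial>M)"
    using zero F by (simp add: subset_eq)
  also have "\<dots> \<le> (s * s + s * s) * (d m * s + s * d m)" using *(2) by linarith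
  also have "\<dots> = 4 * s ^ 3 * d m" by (simp add: power3_eq_cube)
  finally show ?thesis .
qed

lemma rho_nonneg: "0 \<le> \<rho> r"
  using s_pos d_pos[of "r - h - 1"] by (simp add: \<rho>_def less_imp_le)

lemma rho_summable: "summable \<rho>"
proof -
  have "summable (\<lambda>r. 4 * s ^ 3 * d (r + 1))"
    using d_summable by (intro summable_mult) (simp add: summable_Suc_iff)
  moreover have "\<rho> (r + (h + 2)) = 4 * s ^ 3 * d (r + 1)" for r by (simp add: \<rho>_def)
  ultimately have "summable (\<lambda>r. \<rho> (r + (h + 2)))" by simp
  then show ?thesis by (rule summable_iff_shift[THEN iffD1])
qed

lemma cov_commute: "cov F n k = cov F k n"
  by (simp add: cov_def mult.commute)

lemma cov_le_rho_less:
  assumes F: "finite F" "F \<subseteq> A" and "n \<le> k"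
  shows "cov F n k \<le> \<rho> (nat (k - n))"
proof (cases "nat (k - n) \<le> h + 1")
  case True
  then show ?thesis using cov_le[OF F] by (simp add: \<rho>_def)
next
  case False
  then have "1 \<le> nat (k - n) - h - 1" "n + int h < k - int (nat (k - n) - h - 1)" by auto
  from cov_le_decoupled[OF F this] show ?thesis using False by (simp add: \<rho>_def)
qed

lemma cov_le_rho:
  assumes F: "finite F" "F \<subseteq> A"
  shows "cov F n k \<le> \<rho> (nat \<bar>k - n\<bar>)"
proof (cases "n \<le> k")
  case True
  then show ?thesis using cov_le_rho_less[OF F True] by simp
next
  case False
  then show ?thesis using cov_le_rho_less[OF F, of k n] by (simp add: cov_commute[of F n k])
qed

text \<open>Each distance occurs at most once on either side of \<open>n\<close>, hence the factor
  2.\<close>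

lemma sum_rho_le:
  assumes I: "finite (I :: int set)"
  shows "(\<Sum>k\<in>I. \<rho> (nat \<bar>k - n\<bar>)) \<le> 2 * suminf \<rho>"
proof -
  have inj: "(\<Sum>k\<in>J. \<rho> (nat \<bar>k - n\<bar>)) \<le> suminf \<rho>"
    if "finite J" "inj_on (\<lambda>k. nat \<bar>k - n\<bar>) J" for J
  proof -
    have "(\<Sum>k\<in>J. \<rho> (nat \<bar>k - n\<bar>)) = sum \<rho> ((\<lambda>k. nat \<bar>k - n\<bar>) ` J)"
      using that(2) by (simp add: sum.reindex)
    also have "\<dots> \<le> suminf \<rho>"
      using that(1) by (intro sum_le_suminf rho_summable) (auto simp: rho_nonneg)
    finally show ?thesis .
  qed
  have "(\<Sum>k\<in>I. \<rho> (nat \<bar>k - n\<bar>)) = (\<Sum>k\<in>{k\<in>I. k \<ge> n}. \<rho> (nat \<bar>k - n\<bar>)) + (\<Sum>k\<in>{k\<in>I. k < n}. \<rho> (nat \<bar>k - n\<bar>))"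
    using I by (subst sum.union_disjoint[symmetric]) (auto intro!: sum.cong)
  also have "\<dots> \<le> suminf \<rho> + suminf \<rho>"
    using I by (intro add_mono inj) (auto simp: inj_on_def)
  finally show ?thesis by simp
qed

definition avg :: "'i \<Rightarrow> nat \<Rightarrow> 'w \<Rightarrow> real" where
  "avg i N \<omega> = (1 / (real N - real h)) * (\<Sum>n = 1..int N - int h. Y i n \<omega>)"

lemma avg_measurable: "i \<in> A \<Longrightarrow> avg i N \<in> borel_measurable M"
  unfolding avg_def[abs_def] using Y_measurable by auto

text \<open>The square expands into a double sum of covariances. Every row is at most
  \<open>2 * suminf \<rho>\<close>, and one of the two factors \<open>1 / L\<close> is spent on the
  number of rows.\<close>

lemma avg_variance:
  assumes F: "finite F" "F \<subseteq> A" and N: "h < N"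
  shows "integrable M (\<lambda>\<omega>. \<Sum>i\<in>F. (avg i N \<omega> - \<mu> i)\<^sup>2)"
    "(\<integral>\<omega>. (\<Sum>i\<in>F. (avg i N \<omega> - \<mu> i)\<^sup>2) \<partial>M) \<le> 2 * suminf \<rho> / (real N - real h)"
proof -
  define L where "L = real N - real h"
  let ?I = "{1..int N - int h}"
  have L: "L > 0" and card: "real (card ?I) = L" using N by (auto simp: L_def)
  have center: "avg i N \<omega> - \<mu> i = (1 / L) * (\<Sum>n\<in>?I. Y i n \<omega> - \<mu> i)" for i \<omega>
    using L card by (simp add: avg_def L_def[symmetric] sum_subtractf field_simps)
  have eq: "(\<Sum>i\<in>F. (avg i N \<omega> - \<mu> i)\<^sup>2)
      = (1 / L\<^sup>2) * (\<Sum>n\<in>?I. \<Sum>k\<in>?I. \<Sum>i\<in>F. (Y i n \<omega> - \<mu> i) * (Y i k \<omega> - \<mu> i))" for \<omega>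
  proof -
    have "(\<Sum>i\<in>F. (avg i N \<omega> - \<mu> i)\<^sup>2)
        = (\<Sum>i\<in>F. (1 / L\<^sup>2) * (\<Sum>n\<in>?I. \<Sum>k\<in>?I. (Y i n \<omega> - \<mu> i) * (Y i k \<omega> - \<mu> i)))"
      unfolding center by (simp add: power_mult_distrib power_divide power2_eq_square sum_product)
    also have "\<dots> = (1 / L\<^sup>2) * (\<Sum>i\<in>F. \<Sum>n\<in>?I. \<Sum>k\<in>?I. (Y i n \<omega> - \<mu> i) * (Y i k \<omega> - \<mu> i))"
      by (simp add: sum_distrib_left)
    also have "(\<Sum>i\<in>F. \<Sum>n\<in>?I. \<Sum>k\<in>?I. (Y i n \<omega> - \<mu> i) * (Y i k \<omega> - \<mu> i))
        = (\<Sum>n\<in>?I. \<Sum>i\<in>F. \<Sum>k\<in>?I. (Y i n \<omega> - \<mu> i) * (Y i k \<omega> - \<mu> i))"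
      by (rule sum.swap)
    also have "\<dots> = (\<Sum>n\<in>?I. \<Sum>k\<in>?I. \<Sum>i\<in>F. (Y i n \<omega> - \<mu> i) * (Y i k \<omega> - \<mu> i))"
      by (intro sum.cong refl sum.swap)
    finally show ?thesis .
  qed
  show "integrable M (\<lambda>\<omega>. \<Sum>i\<in>F. (avg i N \<omega> - \<mu> i)\<^sup>2)"
    unfolding eq by (intro integrable_mult_right Bochner_Integration.integrable_sum cov_integrable F)
  have "(\<integral>\<omega>. (\<Sum>i\<in>F. (avg i N \<omega> - \<mu> i)\<^sup>2) \<partial>M) = (1 / L\<^sup>2) * (\<Sum>n\<in>?I. \<Sum>k\<in>?I. cov F n k)"
    unfolding eq cov_def using cov_integrable[OF F]
    by (subst integral_mult_right_zero, subst Bochner_Integration.integral_sum)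
      (auto intro!: Bochner_Integration.integrable_sum sum.cong Bochner_Integration.integral_sum arg_cong2[where f = "(*)"])
  also have "\<dots> \<le> (1 / L\<^sup>2) * (\<Sum>n\<in>?I. 2 * suminf \<rho>)"
    by (intro mult_left_mono sum_mono order_trans[OF sum_mono[OF cov_le_rho[OF F]] sum_rho_le]) auto
  also have "\<dots> = 2 * suminf \<rho> / L"
    using L by (simp only: sum_constant card) (simp add: power2_eq_square field_simps)
  finally show "(\<integral>\<omega>. (\<Sum>i\<in>F. (avg i N \<omega> - \<mu> i)\<^sup>2) \<partial>M) \<le> 2 * suminf \<rho> / (real N - real h)"
    by (simp add: L_def)
qed

text \<open>Markov's inequality for the sum \<open>V\<close> over the whole index set, whose
  expectation inherits the bound for finite sums. Since \<open>V\<close> dominates every finite sum,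
  one event serves all \<open>F\<close>.\<close>

lemma avg_tight:
  assumes A: "countable A" and \<epsilon>: "\<epsilon> > 0"
  shows "\<exists>c>0. \<forall>N > 2 * h. \<exists>E\<in>events. prob E \<ge> 1 - \<epsilon> \<and>
    (\<forall>\<omega>\<in>E. \<forall>F. finite F \<longrightarrow> F \<subseteq> A \<longrightarrow> (\<Sum>i\<in>F. (avg i N \<omega> - \<mu> i)\<^sup>2) \<le> c / real N)"
proof -
  define K where "K = 2 * suminf \<rho>"
  have K: "K \<ge> 0" using suminf_nonneg[OF rho_summable rho_nonneg] by (simp add: K_def)
  \<comment> \<open>The constant from Markov's inequality, with
    \<open>real N - real h \<ge> real N / 2\<close> because \<open>N > 2 * h\<close>; the summand 1
    keeps \<open>c\<close> positive when \<open>K = 0\<close>.\<close>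
  define c where "c = 2 * K / \<epsilon> + 1"
  have c: "c > 0" using K \<epsilon> by (simp add: c_def add_nonneg_pos)
  show ?thesis
  proof (intro exI[of _ c] conjI c allI impI)
    fix N assume N: "N > 2 * h"
    define V where "V \<omega> = (\<integral>\<^sup>+i. ennreal ((avg i N \<omega> - \<mu> i)\<^sup>2) \<partial>count_space A)" for \<omega>
    have meas: "(\<lambda>\<omega>. ennreal ((avg i N \<omega> - \<mu> i)\<^sup>2)) \<in> borel_measurable M" if "i \<in> A" for i
      using avg_measurable[OF that] by simp
    \<comment> \<open>Countability of \<open>A\<close> makes the integrand jointly measurable in the
      index and the sample point.\<close>
    have [measurable]: "V \<in> borel_measurable M"
    proof -
      interpret C: sigma_finite_measure "count_space A" by (rule sigma_finite_measure_count_space_countable[OF A])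
      have "(\<lambda>p. ennreal ((avg (fst p) N (snd p) - \<mu> (fst p))\<^sup>2)) \<in> borel_measurable (count_space A \<Otimes>\<^sub>M M)"
        by (rule measurable_pair_measure_countable1[OF A]) (use meas in auto)
      from C.borel_measurable_nn_integral_fst[OF measurable_pair_swap[OF this]]
      show ?thesis by (simp add: V_def[abs_def])
    qed
    have int1: "integrable M (\<lambda>\<omega>. (avg i N \<omega> - \<mu> i)\<^sup>2)" if "i \<in> A" for i
      using avg_variance(1)[of "{i}" N] that N by simp
    have "(\<integral>\<^sup>+\<omega>. V \<omega> \<partial>M) = (\<integral>\<^sup>+i. \<integral>\<^sup>+\<omega>. ennreal ((avg i N \<omega> - \<mu> i)\<^sup>2) \<partial>M \<partial>count_space A)"
      unfolding V_def by (rule nn_integral_count_space_nn_integral[OF A meas])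
    also have "\<dots> = (\<integral>\<^sup>+i. ennreal (\<integral>\<omega>. (avg i N \<omega> - \<mu> i)\<^sup>2 \<partial>M) \<partial>count_space A)"
      by (intro nn_integral_cong nn_integral_eq_integral int1) auto
    also have "\<dots> \<le> ennreal (K / (real N - real h))"
    proof (rule nn_integral_count_space_le)
      fix F assume F: "finite F" "F \<subseteq> A"
      have "(\<Sum>i\<in>F. \<integral>\<omega>. (avg i N \<omega> - \<mu> i)\<^sup>2 \<partial>M) = (\<integral>\<omega>. (\<Sum>i\<in>F. (avg i N \<omega> - \<mu> i)\<^sup>2) \<partial>M)"
        using F int1 by (intro Bochner_Integration.integral_sum[symmetric]) auto
      also have "\<dots> \<le> K / (real N - real h)"
        unfolding K_def using N by (intro avg_variance F) auto
      finally show "(\<Sum>i\<in>F. \<integral>\<omega>. (avg i N \<omega> - \<mu> i)\<^sup>2 \<partial>M) \<le> K / (real N - real h)" .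
    qed (use K N in auto)
    also have "\<dots> \<le> ennreal (\<epsilon> * (c / real N))"
    proof (rule ennreal_leI)
      have "K / (real N - real h) \<le> K / (real N / 2)"
        using K N by (intro divide_left_mono) auto
      also have "\<dots> \<le> \<epsilon> * (c / real N)"
        using N \<epsilon> by (simp add: c_def field_simps)
      finally show "K / (real N - real h) \<le> \<epsilon> * (c / real N)" .
    qed
    finally have EV: "(\<integral>\<^sup>+\<omega>. V \<omega> \<partial>M) \<le> ennreal (\<epsilon> * (c / real N))" .
    have cN: "c / real N > 0" using c N by simp
    let ?B = "{\<omega>\<in>space M. 1 \<le> ennreal (real N / c) * V \<omega>}"
    have "emeasure M ?B \<le> ennreal (real N / c) * (\<integral>\<^sup>+\<omega>. V \<omega> * indicator (space M) \<omega> \<partial>M)"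
      by (rule nn_integral_Markov_inequality) auto
    also have "(\<integral>\<^sup>+\<omega>. V \<omega> * indicator (space M) \<omega> \<partial>M) = (\<integral>\<^sup>+\<omega>. V \<omega> \<partial>M)"
      by (intro nn_integral_cong) auto
    also have "ennreal (real N / c) * \<dots> \<le> ennreal (real N / c) * ennreal (\<epsilon> * (c / real N))"
      by (intro mult_left_mono EV) auto
    also have "\<dots> = ennreal \<epsilon>"
      using c N \<epsilon> by (simp add: ennreal_mult[symmetric])
    finally have "prob ?B \<le> \<epsilon>" using \<epsilon> by (simp add: emeasure_eq_measure)
    then have P: "prob (space M - ?B) \<ge> 1 - \<epsilon>"
      by (subst prob_compl) auto
    have "(\<Sum>i\<in>F. (avg i N \<omega> - \<mu> i)\<^sup>2) \<le> c / real N"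
      if \<omega>: "\<omega> \<in> space M - ?B" and F: "finite F" "F \<subseteq> A" for \<omega> F
    proof (rule ccontr)
      let ?S = "\<Sum>i\<in>F. (avg i N \<omega> - \<mu> i)\<^sup>2"
      assume "\<not> ?S \<le> c / real N"
      then have "1 \<le> real N / c * ?S" using c N by (simp add: field_simps)
      then have "1 \<le> ennreal (real N / c) * ennreal ?S"
        using c by (simp add: ennreal_mult[symmetric] sum_nonneg)
      also have "\<dots> \<le> ennreal (real N / c) * V \<omega>"
        unfolding V_def by (intro mult_left_mono sum_le_nn_integral_count_space F) auto
      finally show False using \<omega> by auto
    qed
    with P show "\<exists>E\<in>events. prob E \<ge> 1 - \<epsilon> \<and>
        (\<forall>\<omega>\<in>E. \<forall>F. finite F \<longrightarrow> F \<subseteq> A \<longrightarrow> (\<Sum>i\<in>F. (avg i N \<omega> - \<mu> i)\<^sup>2) \<le> c / real N)"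
      by (intro bexI[of _ "space M - ?B"]) auto
  qed
qed

end

section \<open>The covariance estimator\<close>

lemma norm_outer: "norm (outer x y) = norm x * norm y"
proof (rule antisym)
  show "norm (outer x y) \<le> norm x * norm y"
  proof (rule norm_blinfun_bound)
    fix z
    have "\<bar>inner y z\<bar> * norm x \<le> (norm y * norm z) * norm x"
      by (intro mult_right_mono Cauchy_Schwarz_ineq2) simp
    then show "norm (blinfun_apply (outer x y) z) \<le> norm x * norm y * norm z"
      by (simp add: outer_apply mult_ac)
  qed simp
  show "norm x * norm y \<le> norm (outer x y)"
  proof (cases "y = 0")
    case False
    have "norm x * norm y * norm y = norm (blinfun_apply (outer x y) y)"
      by (simp add: outer_apply dot_square_norm power2_eq_square)
    also have "\<dots> \<le> norm (outer x y) * norm y" by (rule norm_blinfun)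
    finally show ?thesis using False by (simp add: mult_le_cancel_right)
  qed simp
qed

text \<open>Sums over an infinite basis are limits along a net. Dominated convergence and the
  measurability of limits need a sequence inside that net.\<close>

lemma finite_subsets_exhaust:
  assumes "countable B"
  obtains F :: "nat \<Rightarrow> 'a set" where "\<And>k. finite (F k)" "\<And>k. F k \<subseteq> B"
    "filterlim F (finite_subsets_at_top B) sequentially"
proof
  let ?F = "\<lambda>k. {b\<in>B. to_nat_on B b \<le> k}"
  show fin: "finite (?F k)" for k
  proof (rule finite_imageD)
    show "finite (to_nat_on B ` ?F k)" by (rule finite_subset[of _ "{..k}"]) auto
    show "inj_on (to_nat_on B) (?F k)" by (rule inj_on_subset[OF inj_on_to_nat_on[OF assms]]) auto
  qed
  show "?F k \<subseteq> B" for k by auto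
  show "filterlim ?F (finite_subsets_at_top B) sequentially"
    unfolding filterlim_finite_subsets_at_top
  proof (intro allI impI)
    fix Z assume Z: "finite Z \<and> Z \<subseteq> B"
    obtain m where m: "\<And>z. z \<in> Z \<Longrightarrow> to_nat_on B z \<le> m"
      using finite_nat_set_iff_bounded_le[of "to_nat_on B ` Z"] Z by auto
    show "\<forall>\<^sub>F k in sequentially. finite (?F k) \<and> Z \<subseteq> ?F k \<and> ?F k \<subseteq> B"
      using eventually_ge_at_top[of m] by eventually_elim (use Z fin m in \<open>auto intro: order_trans\<close>)
  qed
qed

text \<open>Bessel and Cauchy--Schwarz dominate the partial sums by the product of the norms. The
  same bound makes the expectations absolutely summable, so the limit along one sequence determines
  the sum.\<close>

lemma infsum_expectation_inner:
  fixes Z Z' :: "'w \<Rightarrow> 'b::{real_inner,second_countable_topology}"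
  assumes [measurable]: "Z \<in> borel_measurable M" "Z' \<in> borel_measurable M"
    and int: "integrable M (\<lambda>\<omega>. norm (Z \<omega>) * norm (Z' \<omega>))"
  shows "(\<Sum>\<^sub>\<infinity>v\<in>some_onb. \<integral>\<omega>. inner v (Z \<omega>) * inner v (Z' \<omega>) \<partial>M) = (\<integral>\<omega>. inner (Z \<omega>) (Z' \<omega>) \<partial>M)"
proof -
  let ?B = "some_onb :: 'b set"
  let ?f = "\<lambda>v \<omega>. inner v (Z \<omega>) * inner v (Z' \<omega>)"
  have bd: "(\<Sum>v\<in>F. \<bar>?f v \<omega>\<bar>) \<le> norm (Z \<omega>) * norm (Z' \<omega>)" if F: "finite F" "F \<subseteq> ?B" for F \<omega>
  proof -
    have le: "L2_set (\<lambda>v. inner v x) F \<le> norm x" for x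
      unfolding L2_set_def using bessel[OF F(1) orthonormal_onb[OF onb_some_onb F(2)], of x]
      by (simp add: real_le_lsqrt)
    have "(\<Sum>v\<in>F. \<bar>?f v \<omega>\<bar>) \<le> L2_set (\<lambda>v. inner v (Z \<omega>)) F * L2_set (\<lambda>v. inner v (Z' \<omega>)) F"
      unfolding abs_mult by (rule L2_set_mult_ineq)
    also have "\<dots> \<le> norm (Z \<omega>) * norm (Z' \<omega>)" by (intro mult_mono le L2_set_nonneg) simp
    finally show ?thesis .
  qed
  have fi: "integrable M (?f v)" if "v \<in> ?B" for v
    by (rule Bochner_Integration.integrable_bound[OF int]) (use bd[of "{v}"] that in auto)
  have "(\<lambda>v. \<integral>\<omega>. ?f v \<omega> \<partial>M) summable_on ?B"
  proof (rule abs_summable_summable, rule nonneg_bdd_above_summable_on)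
    show "bdd_above (sum (\<lambda>v. norm (\<integral>\<omega>. ?f v \<omega> \<partial>M)) ` {F. F \<subseteq> ?B \<and> finite F})"
    proof (rule bdd_aboveI2)
      fix F assume F: "F \<in> {F. F \<subseteq> ?B \<and> finite F}"
      have "(\<Sum>v\<in>F. norm (\<integral>\<omega>. ?f v \<omega> \<partial>M)) \<le> (\<Sum>v\<in>F. \<integral>\<omega>. \<bar>?f v \<omega>\<bar> \<partial>M)"
        by (rule sum_mono) simp
      also have "\<dots> = (\<integral>\<omega>. (\<Sum>v\<in>F. \<bar>?f v \<omega>\<bar>) \<partial>M)"
        using F fi by (intro Bochner_Integration.integral_sum[symmetric]) auto
      also have "\<dots> \<le> (\<integral>\<omega>. norm (Z \<omega>) * norm (Z' \<omega>) \<partial>M)"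
        using F fi by (intro integral_mono int bd Bochner_Integration.integrable_sum) auto
      finally show "(\<Sum>v\<in>F. norm (\<integral>\<omega>. ?f v \<omega> \<partial>M)) \<le> (\<integral>\<omega>. norm (Z \<omega>) * norm (Z' \<omega>) \<partial>M)" .
    qed
  qed simp
  note tend = infsum_tendsto[OF this]
  obtain F :: "nat \<Rightarrow> 'b set" where F: "\<And>k. finite (F k)" "\<And>k. F k \<subseteq> ?B"
    and lim: "filterlim F (finite_subsets_at_top ?B) sequentially"
    using finite_subsets_exhaust[OF countable_onb[OF onb_some_onb]] by metis
  have "(\<lambda>k. \<integral>\<omega>. (\<Sum>v\<in>F k. ?f v \<omega>) \<partial>M) \<longlonglongrightarrow> (\<integral>\<omega>. inner (Z \<omega>) (Z' \<omega>) \<partial>M)"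
  proof (rule integral_dominated_convergence[OF _ _ int])
    show "AE \<omega> in M. (\<lambda>k. \<Sum>v\<in>F k. ?f v \<omega>) \<longlonglongrightarrow> inner (Z \<omega>) (Z' \<omega>)"
      using filterlim_compose[OF parseval[OF onb_some_onb, unfolded has_sum_def] lim] by simp
    show "AE \<omega> in M. norm (\<Sum>v\<in>F k. ?f v \<omega>) \<le> norm (Z \<omega>) * norm (Z' \<omega>)" for k
      using bd[OF F(1)[of k] F(2)[of k]] by (auto intro: order_trans[OF sum_abs])
  qed measurable
  moreover have "(\<integral>\<omega>. (\<Sum>v\<in>F k. ?f v \<omega>) \<partial>M) = (\<Sum>v\<in>F k. \<integral>\<omega>. ?f v \<omega> \<partial>M)" for k
    using F[of k] fi by (intro Bochner_Integration.integral_sum) auto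
  ultimately have "(\<lambda>k. \<Sum>v\<in>F k. \<integral>\<omega>. ?f v \<omega> \<partial>M) \<longlonglongrightarrow> (\<integral>\<omega>. inner (Z \<omega>) (Z' \<omega>) \<partial>M)" by simp
  with filterlim_compose[OF tend lim] show ?thesis by (rule LIMSEQ_unique)
qed

lemma hs_sum: "finite I \<Longrightarrow> (\<And>i. i \<in> I \<Longrightarrow> hs (T i)) \<Longrightarrow> hs (\<Sum>i\<in>I. T i)"
  for T :: "'i \<Rightarrow> 'a::{real_inner,second_countable_topology} \<Rightarrow>\<^sub>L 'b::{real_inner,second_countable_topology}"
  by (induction I rule: finite_induct) (auto simp: hs_add, simp add: hs_def)

lemma hs_scaleR: "hs T \<Longrightarrow> hs (c *\<^sub>R T)"
  by (simp add: hs_def blinfun.scaleR_left power_mult_distrib summable_on_cmult_right)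

lemma hs_outer:
  fixes x :: "'b::{real_inner,second_countable_topology}" and y :: "'a::{real_inner,second_countable_topology}"
  shows "hs (outer x y)"
  using has_sum_cmult_left[OF parseval_norm[OF onb_some_onb, of y], of "(norm x)\<^sup>2"]
  by (auto simp: hs_def outer_apply power_mult_distrib inner_commute[of y] has_sum_iff)

lemma est_cov_apply:
  "blinfun_apply (est_cov N h x) z = (1 / (real N - real h)) *\<^sub>R (\<Sum>n = 1..int N - int h. inner (x (n + int h)) z *\<^sub>R x n)"
  by (simp add: est_cov_def blinfun.scaleR_left blinfun.sum_left outer_apply)

lemma hs_est_cov: "hs (est_cov N h (x :: int \<Rightarrow> 'a::{real_inner,second_countable_topology}))"
  unfolding est_cov_def by (intro hs_scaleR hs_sum hs_outer) simp

lemma inner_est_cov: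
  "inner v (blinfun_apply (est_cov N h x) w)
    = (1 / (real N - real h)) * (\<Sum>n = 1..int N - int h. inner v (x n) * inner w (x (n + int h)))"
  by (simp add: est_cov_apply inner_sum_right inner_commute[of _ w] mult.commute)

lemma ptcoeff_est_cov:
  fixes x :: "int \<Rightarrow> 'b::{real_inner,second_countable_topology} ^ 's"
  shows "ptcoeff (est_cov N h x) i k = (1 / (real N - real h)) * (\<Sum>n = 1..int N - int h. inner (x n $ i) (x (n + int h) $ k))"
proof -
  have "((\<lambda>v. (1 / (real N - real h)) * (\<Sum>n = 1..int N - int h. inner v (x n $ i) * inner v (x (n + int h) $ k))) has_sum
      (1 / (real N - real h)) * (\<Sum>n = 1..int N - int h. inner (x n $ i) (x (n + int h) $ k))) some_onb"
    by (intro has_sum_cmult_right has_sum_sum parseval onb_some_onb) simp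
  then show ?thesis
    unfolding ptcoeff_def tcoeff_def inner_est_cov inner_tensor_vec_axis by (rule infsumI)
qed

text \<open>The two sides use unrelated bases, one of the product space and one of its second
  factor. Parseval turns both into inner products of observations, which split over the
  components.\<close>

lemma op_trace_est_cov:
  fixes x :: "int \<Rightarrow> 'b::{real_inner,second_countable_topology} ^ 's"
  shows "op_trace (est_cov N h x) = (\<Sum>i\<in>UNIV. ptcoeff (est_cov N h x) i i)"
proof -
  have "((\<lambda>v. (1 / (real N - real h)) * (\<Sum>n = 1..int N - int h. inner v (x n) * inner v (x (n + int h)))) has_sum
      (1 / (real N - real h)) * (\<Sum>n = 1..int N - int h. inner (x n) (x (n + int h)))) some_onb"
    by (intro has_sum_cmult_right has_sum_sum parseval onb_some_onb) simp
  then have "op_trace (est_cov N h x) = (1 / (real N - real h)) * (\<Sum>n = 1..int N - int h. inner (x n) (x (n + int h)))"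
    unfolding op_trace_def inner_est_cov by (rule infsumI)
  also have "\<dots> = (\<Sum>i\<in>UNIV. ptcoeff (est_cov N h x) i i)"
    unfolding ptcoeff_est_cov sum_distrib_left[symmetric] inner_vec_def
    by (subst sum.swap) (rule refl)
  finally show ?thesis .
qed

context decoupled
begin

lemma lag_cov_apply:
  "blinfun_apply (lag_cov M X h) z = (\<integral>\<omega>. inner (X (int h) \<omega>) z *\<^sub>R X 0 \<omega> \<partial>M)"
  unfolding lag_cov_def
  by (subst blinfun_apply_expect_op) (auto simp: outer_apply norm_outer integrable_prod_norm(1))

lemma inner_lag_cov:
  "inner v (blinfun_apply (lag_cov M X h) w) = (\<integral>\<omega>. inner v (X 0 \<omega>) * inner w (X (int h) \<omega>) \<partial>M)"
proof -
  have "integrable M (\<lambda>\<omega>. inner (X (int h) \<omega>) w *\<^sub>R X 0 \<omega>)"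
  proof (rule Bochner_Integration.integrable_bound)
    show "integrable M (\<lambda>\<omega>. norm w * (norm (X 0 \<omega>) * norm (X (int h) \<omega>)))"
      using integrable_prod_norm(1)[of 0 "int h"] by simp
    show "AE \<omega> in M. norm (inner (X (int h) \<omega>) w *\<^sub>R X 0 \<omega>) \<le> norm (norm w * (norm (X 0 \<omega>) * norm (X (int h) \<omega>)))"
    proof (intro always_eventually allI)
      fix \<omega>
      have "\<bar>inner (X (int h) \<omega>) w\<bar> * norm (X 0 \<omega>) \<le> (norm (X (int h) \<omega>) * norm w) * norm (X 0 \<omega>)"
        by (intro mult_right_mono Cauchy_Schwarz_ineq2) simp
      then show "norm (inner (X (int h) \<omega>) w *\<^sub>R X 0 \<omega>) \<le> norm (norm w * (norm (X 0 \<omega>) * norm (X (int h) \<omega>)))"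
        by (simp add: mult_ac)
    qed
  qed measurable
  from integral_bounded_linear[OF bounded_linear_inner_right[of v] this]
  show ?thesis unfolding lag_cov_apply by (simp add: mult.commute inner_commute[of _ w])
qed

lemma op_trace_lag_cov: "op_trace (lag_cov M X h) = (\<integral>\<omega>. inner (X 0 \<omega>) (X (int h) \<omega>) \<partial>M)"
  unfolding op_trace_def inner_lag_cov
  by (rule infsum_expectation_inner) (auto simp: integrable_prod_norm)

end

section \<open>The two families of bilinear forms\<close>

definition coordinate_form :: "'h::real_inner \<times> 'h \<Rightarrow> 'h \<Rightarrow> 'h \<Rightarrow> real" where
  "coordinate_form p x y = inner (fst p) x * inner (snd p) y"

text \<open>The sample means of these forms are the block traces \<open>ptcoeff\<close> of the
  estimator; those of \<open>coordinate_form\<close> are its matrix coefficients.\<close>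

definition component_form :: "'s \<times> 's \<Rightarrow> 'b::real_inner ^ 's \<Rightarrow> 'b ^ 's \<Rightarrow> real" where
  "component_form p x y = inner (x $ fst p) (y $ snd p)"

text \<open>Over a rectangle of indices the square sum factors, and Bessel's inequality applies to
  each factor.\<close>

lemma L2_set_coordinate_form:
  fixes x y :: "'h::{real_inner,second_countable_topology}"
  assumes F: "finite F" "F \<subseteq> some_onb \<times> some_onb"
  shows "L2_set (\<lambda>p. coordinate_form p x y) F \<le> norm x * norm y"
proof -
  let ?V = "fst ` F" and ?W = "snd ` F"
  have V: "finite ?V" "?V \<subseteq> some_onb" and W: "finite ?W" "?W \<subseteq> some_onb" using F by auto
  have "(\<Sum>p\<in>F. (coordinate_form p x y)\<^sup>2) \<le> (\<Sum>p\<in>?V \<times> ?W. (coordinate_form p x y)\<^sup>2)"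
    by (rule sum_mono2) (use V W in \<open>force+\<close>)
  also have "\<dots> = (\<Sum>v\<in>?V. (inner v x)\<^sup>2) * (\<Sum>w\<in>?W. (inner w y)\<^sup>2)"
    by (simp add: sum_product sum.cartesian_product coordinate_form_def power_mult_distrib case_prod_unfold)
  also have "\<dots> \<le> (norm x)\<^sup>2 * (norm y)\<^sup>2"
    by (intro mult_mono bessel V W orthonormal_onb[OF onb_some_onb] sum_nonneg) auto
  finally show ?thesis
    unfolding L2_set_def by (intro real_le_lsqrt) (simp_all add: power_mult_distrib)
qed

lemma L2_set_component_form:
  fixes x y :: "'b::real_inner ^ 's"
  assumes F: "finite F"
  shows "L2_set (\<lambda>p. component_form p x y) F \<le> norm x * norm y"
proof -
  have "(\<Sum>p\<in>F. (component_form p x y)\<^sup>2) \<le> (\<Sum>p\<in>UNIV. (component_form p x y)\<^sup>2)"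
    by (rule sum_mono2) auto
  also have "\<dots> \<le> (\<Sum>p\<in>UNIV. (norm (x $ fst p))\<^sup>2 * (norm (y $ snd p))\<^sup>2)"
    using Cauchy_Schwarz_ineq by (intro sum_mono) (simp add: component_form_def dot_square_norm[symmetric])
  also have "\<dots> = (\<Sum>i\<in>UNIV. (norm (x $ i))\<^sup>2) * (\<Sum>k\<in>UNIV. (norm (y $ k))\<^sup>2)"
    by (simp add: sum_product sum.cartesian_product case_prod_unfold flip: UNIV_Times_UNIV)
  also have "\<dots> = (norm x)\<^sup>2 * (norm y)\<^sup>2"
    by (simp add: norm_vec_def L2_set_def sum_nonneg)
  finally show ?thesis
    unfolding L2_set_def by (intro real_le_lsqrt) (simp_all add: power_mult_distrib)
qed

lemma decoupled_bilinear_coordinate: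
  fixes X :: "int \<Rightarrow> 'w \<Rightarrow> 'h::{real_inner,banach,second_countable_topology}"
  assumes "decoupled M X W s d"
  shows "decoupled_bilinear M X W s d coordinate_form (some_onb \<times> some_onb)"
proof (intro decoupled_bilinear.intro decoupled_bilinear_axioms.intro assms)
  show "bounded_bilinear (coordinate_form i :: 'h \<Rightarrow> 'h \<Rightarrow> real)" for i
      unfolding coordinate_form_def[abs_def]
      by (intro bounded_bilinear.comp[OF bounded_bilinear_mult] bounded_linear_inner_right)
qed (rule L2_set_coordinate_form)

lemma decoupled_bilinear_component:
  fixes X :: "int \<Rightarrow> 'w \<Rightarrow> ('b::{real_inner,banach,second_countable_topology}) ^ 's"
  assumes "decoupled M X W s d"
  shows "decoupled_bilinear M X W s d component_form UNIV"
proof (intro decoupled_bilinear.intro decoupled_bilinear_axioms.intro assms)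
  show "bounded_bilinear (component_form i :: 'b ^ 's \<Rightarrow> 'b ^ 's \<Rightarrow> real)" for i
      unfolding component_form_def[abs_def]
      by (intro bounded_bilinear.comp[OF bounded_bilinear_inner] bounded_linear_vec_nth)
qed (rule L2_set_component_form)

section \<open>Asymptotics of the test statistic\<close>

text \<open>The hypothesis concerns the images of fixed vectors, so no measurability of
  operator-valued maps is involved; the norm is a limit along a sequence exhausting the
  basis.\<close>

lemma borel_measurable_hs_norm_sq:
  fixes T :: "'w \<Rightarrow> 'a::{real_inner,second_countable_topology} \<Rightarrow>\<^sub>L 'b::{real_inner,second_countable_topology}"
  assumes hs: "\<And>\<omega>. hs (T \<omega>)" and m: "\<And>e. (\<lambda>\<omega>. norm (blinfun_apply (T \<omega>) e)) \<in> borel_measurable M"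
  shows "(\<lambda>\<omega>. (hs_norm (T \<omega>))\<^sup>2) \<in> borel_measurable M"
proof -
  obtain F :: "nat \<Rightarrow> 'a set" where F: "\<And>k. finite (F k)" "\<And>k. F k \<subseteq> some_onb"
    and lim: "filterlim F (finite_subsets_at_top some_onb) sequentially"
    using finite_subsets_exhaust[OF countable_onb[OF onb_some_onb]] by metis
  show ?thesis
  proof (rule borel_measurable_LIMSEQ_real)
    show "(\<lambda>k. \<Sum>e\<in>F k. (norm (blinfun_apply (T \<omega>) e))\<^sup>2) \<longlonglongrightarrow> (hs_norm (T \<omega>))\<^sup>2" for \<omega>
      unfolding hs_norm_sq
      by (rule filterlim_compose[OF infsum_tendsto[OF hs[unfolded hs_def]] lim])
    show "(\<lambda>\<omega>. \<Sum>e\<in>F k. (norm (blinfun_apply (T \<omega>) e))\<^sup>2) \<in> borel_measurable M" for k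
      using m by (intro borel_measurable_sum borel_measurable_power) auto
  qed
qed

lemma measurable_vec_nth:
  fixes f :: "'w \<Rightarrow> 'b::{real_inner,second_countable_topology} ^ 's"
  assumes "f \<in> borel_measurable M"
  shows "(\<lambda>\<omega>. f \<omega> $ i) \<in> borel_measurable M"
  by (rule measurable_compose[OF assms borel_measurable_continuous_onI])
    (intro continuous_intros)

lemma measurable_norm_vec:
  fixes f :: "'w \<Rightarrow> 'b::{real_inner,second_countable_topology} ^ 's"
  assumes "\<And>i. (\<lambda>\<omega>. f \<omega> $ i) \<in> borel_measurable M"
  shows "(\<lambda>\<omega>. norm (f \<omega>)) \<in> borel_measurable M"
proof -
  note assms [measurable]
  show ?thesis unfolding norm_vec_def L2_set_def by measurable
qed

text \<open>Expresses the deviation through block traces, the trace and images of fixed vectors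
  under \<open>T\<close>; for the estimator these are measurable by explicit formulas.\<close>

lemma deviation_nth:
  fixes T :: "('b::{real_inner,second_countable_topology} ^ 's) \<Rightarrow>\<^sub>L ('b ^ 's)"
  assumes "hs T"
  shows "blinfun_apply (deviation T) e $ j =
    (\<Sum>k\<in>UNIV. (ptcoeff T j k / op_trace T) *\<^sub>R (\<Sum>i\<in>UNIV. blinfun_apply T (tensor_vec (axis i 1) (e $ k)) $ i))
      - blinfun_apply T e $ j"
  by (simp add: deviation_def factor2_eq[OF assms] blinfun.diff_left tensor_op.rep_eq tensor_vec_def[of "blinfun_apply _ _"]
      factor1_axis partial_trace1.rep_eq)

lemma test_stat_deviation: "test_stat N h x = real N * (hs_norm (deviation (est_cov N h x)))\<^sup>2"
  by (simp add: test_stat_def Let_def deviation_def)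

text \<open>Probabilities are compared by inclusion of events, and \<open>measure\<close> is
  monotone only if the larger set is measurable.\<close>

lemma borel_measurable_test_stat:
  fixes X :: "int \<Rightarrow> 'w \<Rightarrow> 'b::{real_inner,second_countable_topology} ^ 's"
  assumes [measurable]: "\<And>n. X n \<in> borel_measurable M"
  shows "(\<lambda>\<omega>. test_stat N h (\<lambda>n. X n \<omega>)) \<in> borel_measurable M"
proof -
  note [measurable] = measurable_vec_nth
  have ap [measurable]: "(\<lambda>\<omega>. blinfun_apply (est_cov N h (\<lambda>n. X n \<omega>)) z) \<in> borel_measurable M" for z
    unfolding est_cov_apply by measurable
  have pt [measurable]: "(\<lambda>\<omega>. ptcoeff (est_cov N h (\<lambda>n. X n \<omega>)) i k) \<in> borel_measurable M" for i k
    unfolding ptcoeff_est_cov by measurable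
  have tr [measurable]: "(\<lambda>\<omega>. op_trace (est_cov N h (\<lambda>n. X n \<omega>))) \<in> borel_measurable M"
    unfolding op_trace_est_cov by measurable
  have "(\<lambda>\<omega>. (hs_norm (deviation (est_cov N h (\<lambda>n. X n \<omega>))))\<^sup>2) \<in> borel_measurable M"
    by (intro borel_measurable_hs_norm_sq hs_deviation hs_est_cov measurable_norm_vec)
      (unfold deviation_nth[OF hs_est_cov], measurable)
  then show ?thesis unfolding test_stat_deviation by simp
qed

section \<open>Block traces of the true covariance operator\<close>

lemma tcoeff_lag_cov:
  fixes X :: "int \<Rightarrow> 'w \<Rightarrow> ('b::{real_inner,banach,second_countable_topology}) ^ 's"
  assumes "decoupled M X W s d"
  shows "tcoeff (lag_cov M X h) i v k w = (\<integral>\<omega>. inner v (X 0 \<omega> $ i) * inner w (X (int h) \<omega> $ k) \<partial>M)"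
proof -
  interpret decoupled M X W s d by fact
  show ?thesis by (simp add: tcoeff_def inner_lag_cov inner_tensor_vec_axis)
qed

text \<open>Basis sum and expectation are exchanged both in the factor and in the product space; the
  inner product then splits over the components. The second claim is the trace identity that
  \<open>deviation_lipschitz\<close> asks of \<open>C\<close>.\<close>

lemma
  fixes X :: "int \<Rightarrow> 'w \<Rightarrow> ('b::{real_inner,banach,second_countable_topology}) ^ 's"
  assumes "decoupled M X W s d"
  shows ptcoeff_lag_cov: "ptcoeff (lag_cov M X h) i k = (\<integral>\<omega>. inner (X 0 \<omega> $ i) (X (int h) \<omega> $ k) \<partial>M)"
    and op_trace_lag_cov_ptcoeff: "op_trace (lag_cov M X h) = (\<Sum>i\<in>UNIV. ptcoeff (lag_cov M X h) i i)"
proof -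
  interpret decoupled M X W s d by fact
  note [measurable] = measurable_vec_nth
  have int: "integrable M (\<lambda>\<omega>. norm (X 0 \<omega> $ i) * norm (X (int h) \<omega> $ k))" for i k
  proof (rule Bochner_Integration.integrable_bound[OF integrable_prod_norm(1)[of 0 "int h"]])
    show "AE \<omega> in M. norm (norm (X 0 \<omega> $ i) * norm (X (int h) \<omega> $ k)) \<le> norm (norm (X 0 \<omega>) * norm (X (int h) \<omega>))"
      by (auto intro!: mult_mono Finite_Cartesian_Product.norm_nth_le)
  qed measurable
  show pt: "ptcoeff (lag_cov M X h) i k = (\<integral>\<omega>. inner (X 0 \<omega> $ i) (X (int h) \<omega> $ k) \<partial>M)" for i k
    unfolding ptcoeff_def tcoeff_lag_cov[OF assms]
    by (rule infsum_expectation_inner[OF _ _ int]) measurable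
  have ii: "integrable M (\<lambda>\<omega>. inner (X 0 \<omega> $ i) (X (int h) \<omega> $ i))" for i
    by (rule Bochner_Integration.integrable_bound[OF int[of i i]]) (auto simp: Cauchy_Schwarz_ineq2)
  show "op_trace (lag_cov M X h) = (\<Sum>i\<in>UNIV. ptcoeff (lag_cov M X h) i i)"
    unfolding op_trace_lag_cov pt inner_vec_def
    by (rule Bochner_Integration.integral_sum) (rule ii)
qed

text \<open>On the intersection of the tightness events of the two families, the estimator is within
  \<open>sqrt (c / real N)\<close> of \<open>C\<close> in every sense required by
  \<open>deviation_lipschitz\<close>.\<close>

lemma test_stat_tight:
  fixes X :: "int \<Rightarrow> 'w \<Rightarrow> ('b::{real_inner,banach,second_countable_topology}) ^ 's"
  assumes dec: "decoupled M X W s d" and C: "C = lag_cov M X h" and tr: "op_trace C \<noteq> 0"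
    and \<epsilon>: "\<epsilon> > 0"
  shows "\<exists>K. \<forall>\<^sub>F N in sequentially. \<exists>E\<in>sets M. measure M E \<ge> 1 - \<epsilon> \<and>
    (\<forall>\<omega>\<in>E. \<bar>test_stat N h (\<lambda>n. X n \<omega>) - real N * (hs_norm (deviation C))\<^sup>2\<bar> \<le> K * sqrt (real N))"
    and "hs C"
proof -
  interpret decoupled M X W s d by fact
  interpret D1: decoupled_bilinear M X W s d coordinate_form "some_onb \<times> some_onb" h
    by (rule decoupled_bilinear_coordinate[OF dec])
  interpret D2: decoupled_bilinear M X W s d component_form UNIV h
    by (rule decoupled_bilinear_component[OF dec])
  have mu1: "D1.\<mu> (v, w) = inner v (blinfun_apply C w)" for v w
    by (simp add: D1.\<mu>_def coordinate_form_def C inner_lag_cov)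
  have mu2: "D2.\<mu> (i, k) = ptcoeff C i k" for i k
    by (simp add: D2.\<mu>_def component_form_def C ptcoeff_lag_cov[OF dec])
  have avg1: "D1.avg (v, w) N \<omega> = inner v (blinfun_apply (est_cov N h (\<lambda>n. X n \<omega>)) w)" for v w N \<omega>
    by (simp add: D1.avg_def D1.Y_def coordinate_form_def inner_est_cov)
  have avg2: "D2.avg (i, k) N \<omega> = ptcoeff (est_cov N h (\<lambda>n. X n \<omega>)) i k" for i k N \<omega>
    by (simp add: D2.avg_def D2.Y_def component_form_def ptcoeff_est_cov)
  \<comment> \<open>The coefficients of \<open>C\<close> are the means of the coordinate forms,
    whose finite square sums \<open>L2_mean\<close> bounds.\<close>
  show hsC: "hs C"
  proof (rule hs_coeffI(1)[of "s * s"])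
    fix F :: "(('b ^ 's) \<times> ('b ^ 's)) set" assume F: "finite F" "F \<subseteq> some_onb \<times> some_onb"
    have "(\<Sum>p\<in>F. (D1.\<mu> p)\<^sup>2) \<le> (s * s)\<^sup>2"
      using D1.L2_mean[OF F] unfolding L2_set_def by (rule sqrt_le_D)
    also have "(\<Sum>p\<in>F. (D1.\<mu> p)\<^sup>2) = (\<Sum>(v,w)\<in>F. (inner v (blinfun_apply C w))\<^sup>2)"
      by (intro sum.cong) (auto simp: mu1)
    finally show "(\<Sum>(v,w)\<in>F. (inner v (blinfun_apply C w))\<^sup>2) \<le> (s * s)\<^sup>2" .
  qed simp
  have trC: "op_trace C = (\<Sum>i\<in>UNIV. ptcoeff C i i)"
    unfolding C by (rule op_trace_lag_cov_ptcoeff[OF dec])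
  obtain K q0 where q0: "q0 > 0" and K: "K \<ge> 0"
    and lip': "\<forall>T q. 0 \<le> q \<longrightarrow> q \<le> q0 \<longrightarrow> hs (T - C) \<longrightarrow> hs_norm (T - C) \<le> q \<longrightarrow>
      op_trace T = (\<Sum>i\<in>UNIV. ptcoeff T i i) \<longrightarrow> (\<forall>i k. \<bar>ptcoeff T i k - ptcoeff C i k\<bar> \<le> q) \<longrightarrow>
      hs (deviation T - deviation C) \<and> hs_norm (deviation T - deviation C) \<le> K * q"
    using deviation_lipschitz[OF hsC trC tr] by (elim exE conjE) (rule that)
  note lip = lip'[rule_format]
  \<comment> \<open>Half of the error probability for each of the two families.\<close>
  have \<epsilon>2: "\<epsilon> / 2 > 0" using \<epsilon> by simp
  have cnt: "countable (some_onb \<times> some_onb :: (('b ^ 's) \<times> ('b ^ 's)) set)"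
    by (intro countable_SIGMA countable_onb onb_some_onb)
  obtain c1 where c1: "c1 > 0" and E1: "\<And>N. N > 2 * h \<Longrightarrow> \<exists>E\<in>events. prob E \<ge> 1 - \<epsilon> / 2 \<and>
    (\<forall>\<omega>\<in>E. \<forall>F. finite F \<longrightarrow> F \<subseteq> some_onb \<times> some_onb \<longrightarrow> (\<Sum>p\<in>F. (D1.avg p N \<omega> - D1.\<mu> p)\<^sup>2) \<le> c1 / real N)"
    using D1.avg_tight[OF cnt \<epsilon>2] by blast
  obtain c2 where c2: "c2 > 0" and E2: "\<And>N. N > 2 * h \<Longrightarrow> \<exists>E\<in>events. prob E \<ge> 1 - \<epsilon> / 2 \<and>
    (\<forall>\<omega>\<in>E. \<forall>F. finite F \<longrightarrow> F \<subseteq> UNIV \<longrightarrow> (\<Sum>p\<in>F. (D2.avg p N \<omega> - D2.\<mu> p)\<^sup>2) \<le> c2 / real N)"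
    using D2.avg_tight[OF countable_finite[OF finite] \<epsilon>2] by blast
  define c where "c = c1 + c2"
  define \<delta> where "\<delta> = hs_norm (deviation C)"
  have c: "c > 0" "c1 \<le> c" "c2 \<le> c" using c1 c2 by (auto simp: c_def)
  have \<delta>: "\<delta> \<ge> 0" by (simp add: \<delta>_def hs_norm_nonneg)
  \<comment> \<open>If \<open>?a\<close> is within \<open>?r\<close> of \<open>\<delta>\<close>, the
    squares differ by at most \<open>?r * (?r + 2 * \<delta>)\<close>. After multiplication by
    \<open>N\<close> the quadratic part is bounded and the linear part has order
    \<open>sqrt N\<close>.\<close>
  have key: "\<bar>real N * (hs_norm (deviation T))\<^sup>2 - real N * \<delta>\<^sup>2\<bar> \<le> (K\<^sup>2 * c + 2 * K * \<delta> * sqrt c) * sqrt (real N)"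
    if N: "N > 0" and T: "hs T" and D: "hs (deviation T - deviation C)"
      "hs_norm (deviation T - deviation C) \<le> K * sqrt (c / real N)" for N and T :: "('b ^ 's) \<Rightarrow>\<^sub>L ('b ^ 's)"
  proof -
    let ?a = "hs_norm (deviation T)" and ?r = "K * sqrt (c / real N)"
    have r: "?r \<ge> 0" using K c by simp
    have "?a \<le> hs_norm (deviation T - deviation C) + \<delta>"
      unfolding \<delta>_def using hs_add(2)[OF D(1) hs_deviation[OF hsC]] by simp
    moreover have "\<delta> \<le> ?a + hs_norm (deviation T - deviation C)"
      unfolding \<delta>_def using hs_diff(2)[OF hs_deviation[OF T] D(1)] by simp
    ultimately have ad: "\<bar>?a - \<delta>\<bar> \<le> ?r" using D(2) by linarith
    have "\<bar>?a\<^sup>2 - \<delta>\<^sup>2\<bar> = \<bar>?a - \<delta>\<bar> * \<bar>?a + \<delta>\<bar>"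
      by (simp add: power2_eq_square square_diff_square_factored abs_mult mult.commute)
    also have "\<dots> \<le> ?r * (?r + 2 * \<delta>)"
      using ad r \<delta> hs_norm_nonneg[of "deviation T"] by (intro mult_mono) auto
    finally have "real N * \<bar>?a\<^sup>2 - \<delta>\<^sup>2\<bar> \<le> real N * (?r * (?r + 2 * \<delta>))"
      by (intro mult_left_mono) auto
    also have "\<dots> = K\<^sup>2 * c + 2 * K * \<delta> * sqrt c * sqrt (real N)"
    proof -
      have sN: "sqrt (real N) * sqrt (real N) = real N" "sqrt c * sqrt c = c" using c by auto
      have nz: "sqrt (real N) \<noteq> 0" using N by simp
      have "real N * (?r * (?r + 2 * \<delta>))
          = sqrt (real N) * sqrt (real N) * (K * (sqrt c / sqrt (real N)) * (K * (sqrt c / sqrt (real N)) + 2 * \<delta>))"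
        unfolding sN real_sqrt_divide ..
      also have "\<dots> = K\<^sup>2 * (sqrt c * sqrt c) + 2 * K * \<delta> * sqrt c * sqrt (real N)"
        using nz by (simp add: field_simps power2_eq_square del: real_sqrt_mult_self)
      finally show ?thesis unfolding sN .
    qed
    \<comment> \<open>The bounded part is absorbed since
      \<open>sqrt (real N) \<ge> 1\<close>.\<close>
    also have "\<dots> \<le> K\<^sup>2 * c * sqrt (real N) + 2 * K * \<delta> * sqrt c * sqrt (real N)"
      using N c mult_left_mono[of 1 "sqrt (real N)" "K\<^sup>2 * c"] by simp
    finally show ?thesis
      by (simp add: distrib_right abs_mult flip: right_diff_distrib)
  qed
  \<comment> \<open>The first condition is required by \<open>avg_tight\<close>; the second says
    that \<open>sqrt (c / real N)\<close> is at most the radius \<open>q0\<close> of the Lipschitz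
    estimate.\<close>
  have ev: "\<forall>\<^sub>F N in sequentially. N > 2 * h \<and> real N \<ge> c / q0\<^sup>2"
    using filterlim_real_sequentially
    by (intro eventually_conj eventually_gt_at_top) (simp add: filterlim_at_top)
  show "\<exists>K. \<forall>\<^sub>F N in sequentially. \<exists>E\<in>events. prob E \<ge> 1 - \<epsilon> \<and>
    (\<forall>\<omega>\<in>E. \<bar>test_stat N h (\<lambda>n. X n \<omega>) - real N * (hs_norm (deviation C))\<^sup>2\<bar> \<le> K * sqrt (real N))"
  proof (rule exI, rule eventually_mono[OF ev])
    fix N assume N: "N > 2 * h \<and> real N \<ge> c / q0\<^sup>2"
    then have N0: "N > 0" by auto
    let ?q = "sqrt (c / real N)"
    have qq: "0 \<le> ?q" "?q \<le> q0"
    proof -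
      have "c / real N \<le> q0\<^sup>2" using N N0 q0 by (simp add: field_simps)
      then show "?q \<le> q0" using q0 by (simp add: real_le_lsqrt)
    qed (use c in simp)
    have q2: "?q\<^sup>2 = c / real N" using c by simp
    from E1[OF conjunct1[OF N]] obtain A where A: "A \<in> events" "prob A \<ge> 1 - \<epsilon> / 2"
      and A': "\<forall>\<omega>\<in>A. \<forall>F. finite F \<longrightarrow> F \<subseteq> some_onb \<times> some_onb \<longrightarrow> (\<Sum>p\<in>F. (D1.avg p N \<omega> - D1.\<mu> p)\<^sup>2) \<le> c1 / real N"
      by (elim bexE conjE) (rule that)
    from E2[OF conjunct1[OF N]] obtain B where B: "B \<in> events" "prob B \<ge> 1 - \<epsilon> / 2"
      and B': "\<forall>\<omega>\<in>B. \<forall>F. finite F \<longrightarrow> F \<subseteq> UNIV \<longrightarrow> (\<Sum>p\<in>F. (D2.avg p N \<omega> - D2.\<mu> p)\<^sup>2) \<le> c2 / real N"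
      by (elim bexE conjE) (rule that)
    have "prob A + prob B = prob (A \<union> B) + prob (A \<inter> B)"
      using A(1) B(1) measure_Un3[of A M B] by (simp add: fmeasurable_eq_sets)
    then have AB: "prob (A \<inter> B) \<ge> 1 - \<epsilon>"
      using A(2) B(2) prob_le_1[of "A \<union> B"] by linarith
    have "\<bar>test_stat N h (\<lambda>n. X n \<omega>) - real N * (hs_norm (deviation C))\<^sup>2\<bar>
        \<le> (K\<^sup>2 * c + 2 * K * \<delta> * sqrt c) * sqrt (real N)" if \<omega>: "\<omega> \<in> A \<inter> B" for \<omega>
    proof -
      let ?T = "est_cov N h (\<lambda>n. X n \<omega>)"
      have "(\<Sum>(v,w)\<in>F. (inner v (blinfun_apply (?T - C) w))\<^sup>2) \<le> ?q\<^sup>2"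
        if F: "finite F" "F \<subseteq> some_onb \<times> some_onb" for F
      proof -
        have "(\<Sum>(v,w)\<in>F. (inner v (blinfun_apply (?T - C) w))\<^sup>2) = (\<Sum>p\<in>F. (D1.avg p N \<omega> - D1.\<mu> p)\<^sup>2)"
          by (intro sum.cong) (auto simp: avg1 mu1 blinfun.diff_left inner_diff_right)
        also have "\<dots> \<le> c1 / real N" using \<omega> by (intro A'[rule_format] F) auto
        also have "\<dots> \<le> c / real N" using c by (intro divide_right_mono) auto
        finally show ?thesis unfolding q2 .
      qed
      note TC = hs_coeffI[OF qq(1) this]
      have "\<bar>ptcoeff ?T i k - ptcoeff C i k\<bar> \<le> ?q" for i k
      proof (rule real_le_rsqrt)
        have "(\<Sum>p\<in>{(i,k)}. (D2.avg p N \<omega> - D2.\<mu> p)\<^sup>2) \<le> c2 / real N" using \<omega> by (intro B'[rule_format]) auto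
        also have "\<dots> \<le> c / real N" using c by (intro divide_right_mono) auto
        finally show "\<bar>ptcoeff ?T i k - ptcoeff C i k\<bar>\<^sup>2 \<le> c / real N" by (simp add: avg2 mu2)
      qed
      then have "hs (deviation ?T - deviation C) \<and> hs_norm (deviation ?T - deviation C) \<le> K * ?q"
        by (intro lip qq TC op_trace_est_cov) auto
      then show ?thesis
        unfolding test_stat_deviation \<delta>_def[symmetric] by (intro key N0 hs_est_cov) auto
    qed
    then show "\<exists>E\<in>events. prob E \<ge> 1 - \<epsilon> \<and>
        (\<forall>\<omega>\<in>E. \<bar>test_stat N h (\<lambda>n. X n \<omega>) - real N * (hs_norm (deviation C))\<^sup>2\<bar>
          \<le> (K\<^sup>2 * c + 2 * K * \<delta> * sqrt c) * sqrt (real N))"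
      using AB A(1) B(1) by (intro bexI[of _ "A \<inter> B"]) auto
  qed
qed

text \<open>On the event of the stochastic bound, \<open>Y N\<close> is at least
  \<open>real N * a - K' * sqrt (real N)\<close>, which tends to infinity because \<open>a\<close>
  is positive.\<close>

lemma (in prob_space) big_O_P_diverges:
  assumes [measurable]: "\<And>N. Y N \<in> borel_measurable M"
    and O: "big_O_P M (\<lambda>N \<omega>. Y N \<omega> - real N * a) (\<lambda>N. sqrt (real N))" and a: "a > 0"
  shows "diverges_in_prob M Y"
  unfolding diverges_in_prob_def tendsto_iff
proof (intro allI impI)
  fix K e :: real assume e: "e > 0"
  obtain K' where K': "\<forall>\<^sub>F N in sequentially. prob {\<omega>\<in>space M. \<bar>Y N \<omega> - real N * a\<bar> \<le> K' * sqrt (real N)} \<ge> 1 - e / 2"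
    using O e unfolding big_O_P_def by (meson half_gt_zero)
  have sq: "filterlim (\<lambda>N. sqrt (real N)) at_top sequentially"
    by (rule filterlim_compose[OF sqrt_at_top filterlim_real_sequentially])
  have "filterlim (\<lambda>N. - K' + a * sqrt (real N)) at_top sequentially"
    by (intro filterlim_tendsto_add_at_top[OF tendsto_const] filterlim_tendsto_pos_mult_at_top[OF tendsto_const a] sq)
  then have "filterlim (\<lambda>N. sqrt (real N) * (sqrt (real N) * a - K')) at_top sequentially"
    by (intro filterlim_at_top_mult_at_top[OF sq]) (simp add: mult.commute)
  then have "\<forall>\<^sub>F N in sequentially. K < sqrt (real N) * (sqrt (real N) * a - K')"
    by (simp add: filterlim_at_top_dense)
  with K' show "\<forall>\<^sub>F N in sequentially. dist (prob {\<omega>\<in>space M. K < Y N \<omega>}) 1 < e"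
  proof eventually_elim
    case (elim N)
    have "sqrt (real N) * (sqrt (real N) * a - K') = real N * a - K' * sqrt (real N)"
      by (simp add: algebra_simps flip: mult.assoc)
    with elim(2) have "{\<omega>\<in>space M. \<bar>Y N \<omega> - real N * a\<bar> \<le> K' * sqrt (real N)} \<subseteq> {\<omega>\<in>space M. K < Y N \<omega>}"
      by auto
    then have "prob {\<omega>\<in>space M. \<bar>Y N \<omega> - real N * a\<bar> \<le> K' * sqrt (real N)} \<le> prob {\<omega>\<in>space M. K < Y N \<omega>}"
      by (intro finite_measure_mono) measurable
    then show ?case
      using elim(1) e prob_le_1[of "{\<omega>\<in>space M. K < Y N \<omega>}"] unfolding dist_real_def by linarith
  qed
qed

theorem theorem3p4:
  fixes M :: "'w measure" and U :: "'u measure"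
    and X :: "int \<Rightarrow> 'w \<Rightarrow> L2 ^ 's" and h :: nat
    and C \<Delta> :: "(L2 ^ 's) \<Rightarrow>\<^sub>L (L2 ^ 's)"
  assumes "prob_space M"
    and "Lp_m_approximable M U 4 X"
    and "\<forall>n. (\<integral>\<omega>. X n \<omega> \<partial>M) = 0"
    and "C = lag_cov M X h"
    and "op_trace C \<noteq> 0"
    and "\<Delta> = tensor_op (factor1 C) (factor2 C) - C"
    and "\<Delta> \<noteq> 0"
  shows "big_O_P M (\<lambda>N \<omega>. test_stat N h (\<lambda>n. X n \<omega>) - real N * (hs_norm \<Delta>)\<^sup>2) (\<lambda>N. sqrt (real N))
    \<and> diverges_in_prob M (\<lambda>N \<omega>. test_stat N h (\<lambda>n. X n \<omega>))"
proof -
  obtain W s d where dec: "decoupled M X W s d"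
    using approximable_imp_decoupled[OF assms(1,2)] by blast
  interpret decoupled M X W s d by fact
  have \<Delta>: "\<Delta> = deviation C" using assms(6) by (simp add: deviation_def)
  note [measurable] = borel_measurable_test_stat[OF X_measurable]
  note tight = test_stat_tight[OF dec assms(4,5)]
  have "big_O_P M (\<lambda>N \<omega>. test_stat N h (\<lambda>n. X n \<omega>) - real N * (hs_norm \<Delta>)\<^sup>2) (\<lambda>N. sqrt (real N))"
    unfolding big_O_P_def
  proof (intro allI impI)
    fix \<epsilon> :: real assume "\<epsilon> > 0"
    from tight(1)[OF this] obtain K where K: "\<forall>\<^sub>F N in sequentially. \<exists>E\<in>sets M. measure M E \<ge> 1 - \<epsilon> \<and>
      (\<forall>\<omega>\<in>E. \<bar>test_stat N h (\<lambda>n. X n \<omega>) - real N * (hs_norm \<Delta>)\<^sup>2\<bar> \<le> K * sqrt (real N))"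
      unfolding \<Delta> by blast
    show "\<exists>K. \<forall>\<^sub>F N in sequentially. 1 - \<epsilon>
        \<le> measure M {\<omega>\<in>space M. \<bar>test_stat N h (\<lambda>n. X n \<omega>) - real N * (hs_norm \<Delta>)\<^sup>2\<bar> \<le> K * sqrt (real N)}"
    proof (rule exI[of _ K], rule eventually_mono[OF K])
      fix N assume "\<exists>E\<in>sets M. measure M E \<ge> 1 - \<epsilon> \<and>
        (\<forall>\<omega>\<in>E. \<bar>test_stat N h (\<lambda>n. X n \<omega>) - real N * (hs_norm \<Delta>)\<^sup>2\<bar> \<le> K * sqrt (real N))"
      then obtain E where E: "E \<in> sets M" "measure M E \<ge> 1 - \<epsilon>"
        "\<And>\<omega>. \<omega> \<in> E \<Longrightarrow> \<bar>test_stat N h (\<lambda>n. X n \<omega>) - real N * (hs_norm \<Delta>)\<^sup>2\<bar> \<le> K * sqrt (real N)"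
        by blast
      \<comment> \<open>\<open>E\<close> is merely contained in the event of \<open>big_O_P\<close>;
        measurability of the statistic permits the comparison of probabilities.\<close>
      have "E \<subseteq> {\<omega>\<in>space M. \<bar>test_stat N h (\<lambda>n. X n \<omega>) - real N * (hs_norm \<Delta>)\<^sup>2\<bar> \<le> K * sqrt (real N)}"
        using E(1,3) sets.sets_into_space by blast
      then have "measure M E \<le> measure M {\<omega>\<in>space M. \<bar>test_stat N h (\<lambda>n. X n \<omega>) - real N * (hs_norm \<Delta>)\<^sup>2\<bar> \<le> K * sqrt (real N)}"
        by (intro finite_measure_mono) measurable
      with E(2) show "1 - \<epsilon>
        \<le> measure M {\<omega>\<in>space M. \<bar>test_stat N h (\<lambda>n. X n \<omega>) - real N * (hs_norm \<Delta>)\<^sup>2\<bar> \<le> K * sqrt (real N)}"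
        by linarith
    qed
  qed
  \<comment> \<open>\<open>tight(2)\<close> is \<open>hs C\<close>, obtained with the arbitrary
    choice \<open>\<epsilon> = 1\<close>. Nonvanishing of the operator gives a positive norm only
    within the class \<open>hs\<close>.\<close>
  moreover have "(hs_norm \<Delta>)\<^sup>2 > 0"
    using hs_norm_pos[OF hs_deviation[OF tight(2)[OF zero_less_one]]] assms(7) by (simp add: \<Delta>)
  ultimately show ?thesis
    by (intro conjI big_O_P_diverges[of _ "(hs_norm \<Delta>)\<^sup>2"]) (simp_all add: borel_measurable_test_stat)
qed

end
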